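(* Let $I=I_1\sqcup I_2\sqcup I_3\sqcup I_4$ and let $(\mathbf{X}_n^{(i)})_{i\in I}$ be independent unnormalized Wigner matrices with uniformly controlled moments and parameters $\beta_i\in\mathbb{C}$ (as defined in the context). Let $(b_n^{(i)})_n$ be band widths with $b_n^{(i)}\to\infty$ (and no further assumption) for $i\in I_1$, of slow growth for $i\in I_2$, of full proportion for $i\in I_3$, and of proper proportion for $i\in I_4$. Let $\mathcal{Q}_n=(\mathbf{\Lambda}_n^{(i)})_{i\in I_1}\cup(\mathbf{\Theta}_n^{(i)})_{i\in I_2\cup I_3\cup I_4}$, with $\mathbf{\Lambda}_n^{(i)}$ the normalized periodic random band matrices and $\mathbf{\Theta}_n^{(i)}$ the normalized random band matrices. Let $m\in\mathbb{N}$, $m\ge1$. For any test graph $T$ with labels in $I$, $$\mathbb{E}\Big[\Big|\frac1n\mathrm{tr}[T(\mathcal{Q}_n)]-\mathbb{E}\frac1n\mathrm{tr}[T(\mathcal{Q}_n)]\Big|^{2m}\Big]=O_T(n^{-m}).$$ The bound is tight in the sense that there exist test graphs $T$ such that $$\mathbb{E}\Big[\Big|\frac1n\mathrm{tr}[T(\mathcal{Q}_n)]-\mathbb{E}\frac1n\mathrm{tr}[T(\mathcal{Q}_n)]\Big|^{2m}\Big]=\Theta_T(n^{-m}).$$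
   Context: Wigner matrices: for each $n$, $(\mathbf{X}_n^{(i)})_{i\in I}$ are random Hermitian $n\times n$ matrices such that the entries $(\mathbf{X}_n^{(i)}(j,k):1\le j\le k\le n,\ i\in I)$ are independent; diagonal entries are real-valued; for $j<k$, $\mathbb{E}\mathbf{X}_n^{(i)}(j,k)=0$, $\mathbb{E}|\mathbf{X}_n^{(i)}(j,k)|^2=1$, $\mathbb{E}[\mathbf{X}_n^{(i)}(j,k)^2]=\beta_i$; and for every finite $I_0\subset I$ and $\ell\in\mathbb{N}$, $\sup_n\sup_{i\in I_0}\sup_{1\le j\le k\le n}\mathbb{E}|\mathbf{X}_n^{(i)}(j,k)|^\ell<\infty$. Band widths $b_n$ are nonnegative integers. Slow growth: $b_n\to\infty$, $b_n=o(n)$. Proportional growth: $b_n/n\to c\in(0,1]$; full proportion: $c=1$; proper proportion: $c\in(0,1)$. Random band matrices: $\mathbf{\Xi}_n(j,k)=\mathbf{1}\{|j-k|\le b_n\}\mathbf{X}_n(j,k)$; $\mathbf{\Theta}_n=(2b_n)^{-1/2}\mathbf{\Xi}_n$ for slow growth and $\mathbf{\Theta}_n=(2c-c^2)^{-1/2}n^{-1/2}\mathbf{\Xi}_n$ for proportional growth. Periodic random band matrices: with $|j-k|_n=\min\{|j-k|,n-|j-k|\}$, $\mathbf{\Lambda}_n(j,k)=(2b_n)^{-1/2}\mathbf{1}\{|j-k|_n\le b_n\}\mathbf{X}_n(j,k)$. A test graph $T=(V,E,\mathrm{src},\mathrm{tar},\gamma)$ with labels in $I$ is a finite, connected directed multigraph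 (loops and multiple edges allowed, $V\ne\emptyset$) with $\gamma:E\to I$. For $\mathcal{Q}_n=(\mathbf{Q}_n^{(i)})_{i\in I}$, $\mathrm{tr}[T(\mathcal{Q}_n)]=\sum_{\phi:V\to[n]}\prod_{e\in E}\mathbf{Q}_n^{(\gamma(e))}(\phi(\mathrm{tar}(e)),\phi(\mathrm{src}(e)))$. Implicit constants do not depend on $n$ (they may depend on $T$, on the fixed $m$, and on the family of matrices).
   Formalization: Tightness is claimed only if some label i in I lies outside I_1 or has b_n^{(i)} = O(n); otherwise (I empty, or all bands periodic with b_n/n unbounded, e.g. b_n = n^2) no test graph attains order n^{-m}. *)

theory Defs
  imports
    "HOL-Probability.Probability"
    "HOL-Library.Landau_Symbols"
    "Graph_Theory.Digraph_Component"
begin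

text \<open>An \<open>n \<times> n\<close> matrix is a function on pairs of indices, of which only the values
  at indices in \<open>{1..n}\<close> are relevant.\<close>

type_synonym cmatrix = "nat \<Rightarrow> nat \<Rightarrow> complex"

definition upper_indices :: "nat \<Rightarrow> (nat \<times> nat) set" where
  "upper_indices n = {(j, k). 1 \<le> j \<and> j \<le> k \<and> k \<le> n}"

definition hermitian :: "nat \<Rightarrow> cmatrix \<Rightarrow> bool" where
  "hermitian n A \<longleftrightarrow> (\<forall>j\<in>{1..n}. \<forall>k\<in>{1..n}. A k j = cnj (A j k))"

text \<open>Independent unnormalized Wigner matrices with uniformly controlled moments. The
  probability space may change with \<open>n\<close>. Diagonal entries are real by \<open>hermitian\<close>; no
  condition is imposed on their mean or variance. The moment bound is stated with the
  nonnegative integral, so it entails the integrability of all the moments that occur.\<close>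

definition wigner_family ::
    "(nat \<Rightarrow> 'w measure) \<Rightarrow> 'i set \<Rightarrow> ('i \<Rightarrow> complex) \<Rightarrow> (nat \<Rightarrow> 'i \<Rightarrow> 'w \<Rightarrow> cmatrix) \<Rightarrow> bool" where
  "wigner_family M I \<beta> X \<longleftrightarrow>
     (\<forall>n. prob_space (M n)) \<and>
     (\<forall>n. \<forall>i\<in>I. \<forall>\<omega>\<in>space (M n). hermitian n (X n i \<omega>)) \<and>
     (\<forall>n. prob_space.indep_vars (M n) (\<lambda>_. borel)
            (\<lambda>(i, j, k) \<omega>. X n i \<omega> j k) (I \<times> upper_indices n)) \<and>
     (\<forall>n. \<forall>i\<in>I. \<forall>(j, k)\<in>upper_indices n. j < k \<longrightarrow>
        (\<integral>\<omega>. X n i \<omega> j k \<partial>M n) = 0 \<and>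
        (\<integral>\<omega>. (cmod (X n i \<omega> j k))\<^sup>2 \<partial>M n) = 1 \<and>
        (\<integral>\<omega>. (X n i \<omega> j k)\<^sup>2 \<partial>M n) = \<beta> i) \<and>
     (\<forall>I\<^sub>0 l. finite I\<^sub>0 \<and> I\<^sub>0 \<subseteq> I \<longrightarrow>
        (SUP n. SUP i\<in>I\<^sub>0. SUP (j, k)\<in>upper_indices n.
           \<integral>\<^sup>+\<omega>. ennreal (cmod (X n i \<omega> j k) ^ l) \<partial>M n) < \<infinity>)"

definition slow_growth :: "(nat \<Rightarrow> nat) \<Rightarrow> bool" where
  "slow_growth b \<longleftrightarrow> filterlim b at_top at_top \<and> (\<lambda>n. real (b n)) \<in> o(\<lambda>n. real n)"

definition proportional_growth :: "(nat \<Rightarrow> nat) \<Rightarrow> real \<Rightarrow> bool" where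
  "proportional_growth b c \<longleftrightarrow> 0 < c \<and> c \<le> 1 \<and> (\<lambda>n. real (b n) / real n) \<longlonglongrightarrow> c"

definition periodic_dist :: "nat \<Rightarrow> nat \<Rightarrow> nat \<Rightarrow> int" where
  "periodic_dist n j k = min \<bar>int j - int k\<bar> (int n - \<bar>int j - int k\<bar>)"

text \<open>In the normalizations below, division by zero yields \<open>0\<close>; since band widths tend to
  infinity this affects finitely many \<open>n\<close> only.\<close>

definition band_matrix :: "nat \<Rightarrow> cmatrix \<Rightarrow> cmatrix" where
  "band_matrix b A j k = (if \<bar>int j - int k\<bar> \<le> int b then A j k else 0)"

definition slow_band_matrix :: "nat \<Rightarrow> cmatrix \<Rightarrow> cmatrix" where
  "slow_band_matrix b A j k = complex_of_real (1 / sqrt (2 * real b)) * band_matrix b A j k"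

definition proportional_band_matrix :: "real \<Rightarrow> nat \<Rightarrow> nat \<Rightarrow> cmatrix \<Rightarrow> cmatrix" where
  "proportional_band_matrix c n b A j k =
     complex_of_real (1 / (sqrt (2 * c - c\<^sup>2) * sqrt (real n))) * band_matrix b A j k"

definition periodic_band_matrix :: "nat \<Rightarrow> nat \<Rightarrow> cmatrix \<Rightarrow> cmatrix" where
  "periodic_band_matrix n b A j k =
     complex_of_real (1 / sqrt (2 * real b)) *
       (if periodic_dist n j k \<le> int b then A j k else 0)"

text \<open>The matrices indexed by \<open>I1\<close> are periodic, by \<open>I2\<close> of slow growth, by \<open>I3\<close> of full
  proportion, and all others of proportion \<open>c i\<close>.\<close>

definition mixed_band_family ::
    "'i set \<Rightarrow> 'i set \<Rightarrow> 'i set \<Rightarrow> ('i \<Rightarrow> real) \<Rightarrow> ('i \<Rightarrow> nat \<Rightarrow> nat) \<Rightarrow>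
     (nat \<Rightarrow> 'i \<Rightarrow> 'w \<Rightarrow> cmatrix) \<Rightarrow> nat \<Rightarrow> 'i \<Rightarrow> 'w \<Rightarrow> cmatrix" where
  "mixed_band_family I1 I2 I3 c b X n i \<omega> =
     (if i \<in> I1 then periodic_band_matrix n (b i n) (X n i \<omega>)
      else if i \<in> I2 then slow_band_matrix (b i n) (X n i \<omega>)
      else if i \<in> I3 then proportional_band_matrix 1 n (b i n) (X n i \<omega>)
      else proportional_band_matrix (c i) n (b i n) (X n i \<omega>))"

text \<open>A test graph is a finite directed multigraph with edge labels; \<open>tail\<close> is the source and
  \<open>head\<close> the target of an edge. The library's \<open>connected\<close> ignores the directions of the edges
  and entails that there is a vertex.\<close>

definition test_graph :: "'i set \<Rightarrow> ('v, 'e) pre_digraph \<Rightarrow> ('e \<Rightarrow> 'i) \<Rightarrow> bool" where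
  "test_graph I G \<gamma> \<longleftrightarrow>
     fin_digraph G \<and> Digraph_Component.connected G \<and> \<gamma> \<in> arcs G \<rightarrow> I"

definition graph_trace ::
    "('v, 'e) pre_digraph \<Rightarrow> ('e \<Rightarrow> 'i) \<Rightarrow> nat \<Rightarrow> ('i \<Rightarrow> cmatrix) \<Rightarrow> complex" where
  "graph_trace G \<gamma> n A =
     (\<Sum>\<phi>\<in>verts G \<rightarrow>\<^sub>E {1..n}. \<Prod>e\<in>arcs G. A (\<gamma> e) (\<phi> (head G e)) (\<phi> (tail G e)))"

definition abs_central_moment :: "'w measure \<Rightarrow> nat \<Rightarrow> ('w \<Rightarrow> complex) \<Rightarrow> real" where
  "abs_central_moment M p Z = (\<integral>\<omega>. cmod (Z \<omega> - (\<integral>\<omega>'. Z \<omega>' \<partial>M)) ^ p \<partial>M)"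

definition trace_moment ::
    "(nat \<Rightarrow> 'w measure) \<Rightarrow> (nat \<Rightarrow> 'i \<Rightarrow> 'w \<Rightarrow> cmatrix) \<Rightarrow>
     ('v, 'e) pre_digraph \<Rightarrow> ('e \<Rightarrow> 'i) \<Rightarrow> nat \<Rightarrow> nat \<Rightarrow> real" where
  "trace_moment M Q G \<gamma> p n =
     abs_central_moment (M n) p
       (\<lambda>\<omega>. complex_of_real (1 / real n) * graph_trace G \<gamma> n (\<lambda>i. Q n i \<omega>))"

end

theory Submission
  imports Defs
begin

text \<open>
  The \<open>2 m\<close>-th central moment is expanded over labellings of the vertices of \<open>2 m\<close> copies of the
  test graph. By independence and centredness a labelling contributes only if every copy shares a
  matrix entry with another copy and every off-diagonal entry occurs at least twice. Exploring the
  labelled vertices along edges and shared entries, a new root costs a factor \<open>n\<close>, and at most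
  \<open>m\<close> roots are needed. Every other new value enters through a new matrix entry, whose
  squared weight compensates the number of possible values. This leaves \<open>n\<^sup>m\<close> out of the
  normalization \<open>n\<^sup>2\<^sup>m\<close>.

  For tightness, take two edges of the same label out of one vertex. This works for every \<open>\<beta>\<close>,
  because products of two distinct off-diagonal entries of a row form an orthonormal system, and both
  orders of the two edges yield the same product. There are about \<open>n\<close> times the squared band width of them,
  so the variance is at least of the order \<open>1/n\<close>, and the higher moments follow by Jensen's inequality.
\<close>

section \<open>Counting labellings\<close>

text \<open>The labels differ in the order of their band widths, so vertices cannot be counted
  against powers of a single scale. Values along an edge are therefore never counted: the squared
  weights of a row sum to a constant whatever the width, and each distinct off-diagonal entry
  supplies one such square, because a surviving one occurs at least twice and weights are eventually
  at most 1. Diagonal entries have arbitrary means and may occur alone, but the two ends of such an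
  edge carry the same value, so there is no freedom to be paid for. The number of roots is halved
  because a copy that shares no entry has a centred factor independent of all the others: from a
  copy started by a root, a second one is reached through the shared entry. In the lower bound the
  trace is tested against ordered wedges inside the band only; the terms of the trace that are not
  such wedges need no estimate, being orthogonal to them.\<close>

lemma prod_le_prod_subset:
  fixes f :: "'a \<Rightarrow> real"
  assumes "finite B" "A \<subseteq> B" "\<And>x. x \<in> B \<Longrightarrow> 0 \<le> f x" "\<And>x. x \<in> B \<Longrightarrow> f x \<le> 1"
  shows "prod f B \<le> prod f A"
proof -
  have "prod f B = prod f (B - A) * prod f A"
    using assms by (simp add: prod.subset_diff)
  also have "\<dots> \<le> 1 * prod f A"
    using assms by (intro mult_right_mono prod_le_1 prod_nonneg) auto
  finally show ?thesis by simp
qed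

lemma sum_PiE_insert:
  fixes F :: "('a \<Rightarrow> 'b) \<Rightarrow> 'c::comm_monoid_add"
  assumes "v \<notin> S"
  shows "(\<Sum>\<Phi>\<in>insert v S \<rightarrow>\<^sub>E T. F \<Phi>) = (\<Sum>\<Phi>\<in>S \<rightarrow>\<^sub>E T. \<Sum>y\<in>T. F (\<Phi>(v := y)))"
proof -
  have "(\<Sum>\<Phi>\<in>insert v S \<rightarrow>\<^sub>E T. F \<Phi>) = (\<Sum>(y, \<Phi>)\<in>T \<times> (S \<rightarrow>\<^sub>E T). F (\<Phi>(v := y)))"
    unfolding PiE_insert_eq
    by (subst sum.reindex[OF inj_combinator[OF assms]]) (auto intro!: sum.cong)
  also have "\<dots> = (\<Sum>y\<in>T. \<Sum>\<Phi>\<in>S \<rightarrow>\<^sub>E T. F (\<Phi>(v := y)))"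
    by (simp add: sum.cartesian_product)
  also have "\<dots> = (\<Sum>\<Phi>\<in>S \<rightarrow>\<^sub>E T. \<Sum>y\<in>T. F (\<Phi>(v := y)))"
    by (rule sum.swap)
  finally show ?thesis .
qed

section \<open>Exploration of a labelled edge system\<close>

definition diagonal :: "'i \<times> nat \<times> nat \<Rightarrow> bool" where
  "diagonal = (\<lambda>(i, a, b). a = b)"

locale edge_system =
  fixes V :: "'x set" and E :: "'d set" and hd tl :: "'d \<Rightarrow> 'x" and lab :: "'d \<Rightarrow> 'i"
  assumes finite_V: "finite V" and finite_E: "finite E"
    and ends: "\<And>d. d \<in> E \<Longrightarrow> hd d \<in> V" "\<And>d. d \<in> E \<Longrightarrow> tl d \<in> V"
begin

text \<open>The matrix entry used by an edge is, up to conjugation, the upper entry at this position.\<close>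

definition slot :: "('x \<Rightarrow> nat) \<Rightarrow> 'd \<Rightarrow> 'i \<times> nat \<times> nat" where
  "slot \<Phi> d = (lab d, min (\<Phi> (hd d)) (\<Phi> (tl d)), max (\<Phi> (hd d)) (\<Phi> (tl d)))"

text \<open>The number counts the roots. Only the existence of a suitable order of the vertices
  matters, so the order is kept as a derivation, along which the sum over labellings is later
  bounded. Pairs in \<open>Gl\<close> force equal values; an edge limits the new value through its
  weight.\<close>

inductive explored :: "('x \<times> 'x) set \<Rightarrow> 'x set \<Rightarrow> nat \<Rightarrow> bool" for Gl where
  empty: "explored Gl {} 0"
| root: "explored Gl S k \<Longrightarrow> v \<in> V \<Longrightarrow> v \<notin> S \<Longrightarrow> explored Gl (insert v S) (Suc k)"
| glue: "explored Gl S k \<Longrightarrow> v \<in> V \<Longrightarrow> v \<notin> S \<Longrightarrow> u \<in> S \<Longrightarrow> (u, v) \<in> Gl \<or> (v, u) \<in> Gl \<Longrightarrow>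
    explored Gl (insert v S) k"
| edge: "explored Gl S k \<Longrightarrow> v \<in> V \<Longrightarrow> v \<notin> S \<Longrightarrow> u \<in> S \<Longrightarrow> d \<in> E \<Longrightarrow>
    (hd d = u \<and> tl d = v) \<or> (hd d = v \<and> tl d = u) \<Longrightarrow> explored Gl (insert v S) k"

lemma explored_subset: "explored Gl S k \<Longrightarrow> S \<subseteq> V"
  by (induction rule: explored.induct) auto

text \<open>Pairs with an end outside of \<open>S\<close> are ignored, so the condition makes sense
  for a partial labelling and is inherited when a vertex is removed.\<close>

definition glued :: "('x \<times> 'x) set \<Rightarrow> 'x set \<Rightarrow> ('x \<Rightarrow> nat) \<Rightarrow> bool" where
  "glued Gl S \<Phi> \<longleftrightarrow> (\<forall>(u, v)\<in>Gl. u \<in> S \<longrightarrow> v \<in> S \<longrightarrow> \<Phi> u = \<Phi> v)"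

lemma glued_update: "glued Gl (insert v S) (\<Phi>(v := y)) \<Longrightarrow> v \<notin> S \<Longrightarrow> glued Gl S \<Phi>"
  by (force simp: glued_def split: if_splits)

definition inner :: "'x set \<Rightarrow> 'd set" where
  "inner S = {d \<in> E. hd d \<in> S \<and> tl d \<in> S}"

text \<open>A set of slots, so that an entry met by several edges counts once. Diagonal slots are
  left out since their entries may occur a single time, and then no square of the weight is
  available.\<close>

definition off_slots :: "'x set \<Rightarrow> ('x \<Rightarrow> nat) \<Rightarrow> ('i \<times> nat \<times> nat) set" where
  "off_slots S \<Phi> = {k \<in> slot \<Phi> ` inner S. \<not> diagonal k}"

lemma finite_off_slots [simp]: "finite (off_slots S \<Phi>)"
  using finite_E by (simp add: off_slots_def inner_def)

lemma off_slots_update: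
  assumes "v \<notin> S"
  shows "off_slots S (\<Phi>(v := y)) = off_slots S \<Phi>"
proof -
  have "slot (\<Phi>(v := y)) d = slot \<Phi> d" if "d \<in> inner S" for d
    using that assms by (auto simp: slot_def inner_def)
  then have "slot (\<Phi>(v := y)) ` inner S = slot \<Phi> ` inner S"
    by (rule image_cong[OF refl])
  then show ?thesis by (simp add: off_slots_def)
qed

lemma off_slots_mono: "S \<subseteq> S' \<Longrightarrow> off_slots S \<Phi> \<subseteq> off_slots S' \<Phi>"
  by (auto simp: off_slots_def inner_def)

end

locale weighted_edge_system = edge_system V E hd tl lab
  for V :: "'x set" and E :: "'d set" and hd tl and lab :: "'d \<Rightarrow> 'i" +
  fixes w :: "'i \<Rightarrow> nat \<Rightarrow> nat \<Rightarrow> real" and T :: "nat set" and C :: real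
  assumes finite_T: "finite T"
    and w_nonneg: "\<And>i a b. 0 \<le> w i a b"
    and w_le_1: "\<And>d a b. d \<in> E \<Longrightarrow> w (lab d) a b \<le> 1"
    and w_sym: "\<And>i a b. w i a b = w i b a"
    and w_sum: "\<And>d a. d \<in> E \<Longrightarrow> a \<in> T \<Longrightarrow> (\<Sum>b\<in>T. (w (lab d) a b)\<^sup>2) \<le> C"
    and C_nonneg: "0 \<le> C"
begin

definition slot_weight :: "'i \<times> nat \<times> nat \<Rightarrow> real" where
  "slot_weight = (\<lambda>(i, a, b). w i a b)"

text \<open>The exponent 2 is the least multiplicity of an off-diagonal slot in a surviving
  labelling, and it is the power whose row sums are bounded.\<close>

definition saved_weight :: "'x set \<Rightarrow> ('x \<Rightarrow> nat) \<Rightarrow> real" where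
  "saved_weight S \<Phi> = (\<Prod>k\<in>off_slots S \<Phi>. (slot_weight k)\<^sup>2)"

lemma slot_weight_slot: "slot_weight (slot \<Phi> d) = w (lab d) (\<Phi> (hd d)) (\<Phi> (tl d))"
  by (auto simp: slot_weight_def slot_def min_def max_def w_sym)

lemma slot_weight_nonneg: "0 \<le> slot_weight k"
  by (auto simp: slot_weight_def w_nonneg split: prod.split)

lemma slot_weight_le_1: "k \<in> slot \<Phi> ` E \<Longrightarrow> slot_weight k \<le> 1"
  using w_le_1 by (auto simp: slot_weight_slot)

lemma off_slot_weight_le_1: "k \<in> off_slots S \<Phi> \<Longrightarrow> (slot_weight k)\<^sup>2 \<le> 1"
  using slot_weight_le_1[of k \<Phi>] slot_weight_nonneg[of k]
  by (auto simp: off_slots_def inner_def power_le_one)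

lemma saved_weight_nonneg: "0 \<le> saved_weight S \<Phi>"
  by (simp add: saved_weight_def prod_nonneg)

lemma saved_weight_update_le:
  assumes "v \<notin> S"
  shows "saved_weight (insert v S) (\<Phi>(v := y)) \<le> saved_weight S \<Phi>"
proof -
  have "off_slots S \<Phi> \<subseteq> off_slots (insert v S) (\<Phi>(v := y))"
    using off_slots_mono[of S "insert v S" "\<Phi>(v := y)"] off_slots_update[OF assms] by auto
  then show ?thesis
    unfolding saved_weight_def by (intro prod_le_prod_subset) (auto intro: off_slot_weight_le_1)
qed

text \<open>The slot of \<open>d\<close> contains the value \<open>y\<close>, which no vertex of
  \<open>S\<close> carries, so it is absent from the old slots and its square splits off. It is
  off-diagonal because \<open>u\<close> carries a different value.\<close>

lemma saved_weight_update_new: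
  assumes "v \<notin> S" "u \<in> S" "d \<in> E" "(hd d = u \<and> tl d = v) \<or> (hd d = v \<and> tl d = u)" "y \<notin> \<Phi> ` S"
  shows "saved_weight (insert v S) (\<Phi>(v := y)) \<le> (w (lab d) (\<Phi> u) y)\<^sup>2 * saved_weight S \<Phi>"
proof -
  let ?\<Psi> = "\<Phi>(v := y)"
  let ?k = "slot ?\<Psi> d"
  have uv: "u \<noteq> v" "\<Phi> u \<noteq> y" using assms by auto
  have inn: "d \<in> inner (insert v S)" using assms by (auto simp: inner_def)
  have k_in: "?k \<in> off_slots (insert v S) ?\<Psi>"
    using inn uv assms(4) by (auto simp: off_slots_def diagonal_def slot_def min_def max_def)
  have k_notin: "?k \<notin> off_slots S \<Phi>"
  proof
    assume "?k \<in> off_slots S \<Phi>"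
    then obtain d' where d': "d' \<in> inner S" "?k = slot \<Phi> d'" by (auto simp: off_slots_def)
    have "y \<in> {\<Phi> (hd d'), \<Phi> (tl d')}"
      using d'(2) uv assms(4) by (auto simp: slot_def min_def max_def split: if_splits)
    then show False using d'(1) assms(5) by (auto simp: inner_def)
  qed
  have sub: "insert ?k (off_slots S \<Phi>) \<subseteq> off_slots (insert v S) ?\<Psi>"
    using off_slots_mono[of S "insert v S" ?\<Psi>] off_slots_update[OF assms(1)] k_in by auto
  have "saved_weight (insert v S) ?\<Psi> \<le> (\<Prod>k\<in>insert ?k (off_slots S \<Phi>). (slot_weight k)\<^sup>2)"
    unfolding saved_weight_def using sub by (intro prod_le_prod_subset) (auto intro: off_slot_weight_le_1)
  also have "\<dots> = (slot_weight ?k)\<^sup>2 * saved_weight S \<Phi>"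
    using k_notin by (simp add: saved_weight_def)
  also have "slot_weight ?k = w (lab d) (\<Phi> u) y"
    unfolding slot_weight_slot using uv assms(4) by (auto simp: w_sym)
  finally show ?thesis .
qed

lemma sum_saved_weight_edge:
  assumes "v \<notin> S" "u \<in> S" "d \<in> E" "(hd d = u \<and> tl d = v) \<or> (hd d = v \<and> tl d = u)"
    "\<Phi> u \<in> T" "S \<subseteq> V"
  shows "(\<Sum>y\<in>T. saved_weight (insert v S) (\<Phi>(v := y))) \<le> (card V + C) * saved_weight S \<Phi>"
proof -
  have finS: "finite S" using assms(6) finite_V finite_subset by auto
  have "(\<Sum>y\<in>T. saved_weight (insert v S) (\<Phi>(v := y)))
      \<le> (\<Sum>y\<in>T. (of_bool (y \<in> \<Phi> ` S) + (w (lab d) (\<Phi> u) y)\<^sup>2) * saved_weight S \<Phi>)"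
  proof (rule sum_mono)
    fix y assume "y \<in> T"
    show "saved_weight (insert v S) (\<Phi>(v := y))
        \<le> (of_bool (y \<in> \<Phi> ` S) + (w (lab d) (\<Phi> u) y)\<^sup>2) * saved_weight S \<Phi>"
    proof (cases "y \<in> \<Phi> ` S")
      case True
      have "saved_weight (insert v S) (\<Phi>(v := y)) \<le> 1 * saved_weight S \<Phi>"
        using saved_weight_update_le[OF assms(1)] by simp
      also have "\<dots> \<le> (of_bool (y \<in> \<Phi> ` S) + (w (lab d) (\<Phi> u) y)\<^sup>2) * saved_weight S \<Phi>"
        using True by (intro mult_right_mono) (auto simp: saved_weight_nonneg)
      finally show ?thesis .
    next
      case False
      then show ?thesis using saved_weight_update_new[OF assms(1-4)] by simp
    qed
  qed
  also have "\<dots> = ((\<Sum>y\<in>T. of_bool (y \<in> \<Phi> ` S)) + (\<Sum>y\<in>T. (w (lab d) (\<Phi> u) y)\<^sup>2)) * saved_weight S \<Phi>"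
    by (simp add: sum_distrib_right[symmetric] sum.distrib)
  also have "\<dots> \<le> (card V + C) * saved_weight S \<Phi>"
  proof (intro mult_right_mono add_mono saved_weight_nonneg)
    have "(\<Sum>y\<in>T. of_bool (y \<in> \<Phi> ` S)) = real (card (T \<inter> \<Phi> ` S))"
      using finite_T by (simp add: Int_def)
    also have "card (T \<inter> \<Phi> ` S) \<le> card (\<Phi> ` S)" using finS by (intro card_mono) auto
    also have "\<dots> \<le> card S" by (rule card_image_le[OF finS])
    also have "\<dots> \<le> card V" using assms(6) finite_V by (rule card_mono[rotated])
    finally show "(\<Sum>y\<in>T. of_bool (y \<in> \<Phi> ` S)) \<le> real (card V)" by simp
    show "(\<Sum>y\<in>T. (w (lab d) (\<Phi> u) y)\<^sup>2) \<le> C" using w_sum assms by auto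
  qed
  finally show ?thesis .
qed

text \<open>Adding vertices one at a time, a new root costs a factor \<open>card T\<close>. A vertex attached by
  an edge costs only a constant: either its value has occurred before, or its edge uses a new
  slot, whose squared weight sums to a constant.\<close>

lemma sum_saved_weight_le:
  assumes "explored Gl S k"
  shows "(\<Sum>\<Phi>\<in>S \<rightarrow>\<^sub>E T. of_bool (glued Gl S \<Phi>) * saved_weight S \<Phi>)
    \<le> real (card T) ^ k * (card V + C + 1) ^ card S"
  using assms
proof (induction rule: explored.induct)
  case empty
  show ?case by (simp add: PiE_empty_domain saved_weight_def off_slots_def inner_def glued_def)
next
  case (root S k v)
  \<comment> \<open>The summand 1 keeps the base at least 1, so that roots and glued vertices can be
    charged the same factor as vertices attached by an edge; this makes the exponent
    \<open>card S\<close>.\<close>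
  let ?D = "card V + C + 1"
  have finS: "finite S" using explored_subset[OF root(1)] finite_V finite_subset by auto
  have D: "1 \<le> ?D" using C_nonneg by simp
  have "(\<Sum>\<Phi>\<in>insert v S \<rightarrow>\<^sub>E T. of_bool (glued Gl (insert v S) \<Phi>) * saved_weight (insert v S) \<Phi>)
     \<le> (\<Sum>\<Phi>\<in>S \<rightarrow>\<^sub>E T. \<Sum>y\<in>T. of_bool (glued Gl S \<Phi>) * saved_weight S \<Phi>)"
    unfolding sum_PiE_insert[OF root(3)] using root(3)
    by (intro sum_mono mult_mono saved_weight_update_le) (auto dest: glued_update simp: saved_weight_nonneg)
  also have "\<dots> = card T * (\<Sum>\<Phi>\<in>S \<rightarrow>\<^sub>E T. of_bool (glued Gl S \<Phi>) * saved_weight S \<Phi>)"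
    by (simp add: sum_distrib_left)
  also have "\<dots> \<le> card T * (real (card T) ^ k * ?D ^ card S * ?D)"
  proof (intro mult_left_mono order.trans[OF root(4)])
    show "real (card T) ^ k * ?D ^ card S \<le> real (card T) ^ k * ?D ^ card S * ?D"
      using D mult_left_mono[of 1 ?D "real (card T) ^ k * ?D ^ card S"] by simp
  qed auto
  finally show ?case using root(3) finS by (simp add: mult_ac)
next
  case (glue S k v u)
  let ?D = "card V + C + 1"
  have finS: "finite S" using explored_subset[OF glue(1)] finite_V finite_subset by auto
  have D: "1 \<le> ?D" using C_nonneg by simp
  \<comment> \<open>Gluing dictates the value of \<open>v\<close>, so one term of the inner sum
    survives and no root is spent.\<close>
  have "(\<Sum>\<Phi>\<in>insert v S \<rightarrow>\<^sub>E T. of_bool (glued Gl (insert v S) \<Phi>) * saved_weight (insert v S) \<Phi>)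
     \<le> (\<Sum>\<Phi>\<in>S \<rightarrow>\<^sub>E T. \<Sum>y\<in>T. of_bool (y = \<Phi> u) * (of_bool (glued Gl S \<Phi>) * saved_weight S \<Phi>))"
    unfolding sum_PiE_insert[OF glue(3)]
  proof (intro sum_mono)
    fix \<Phi> y
    show "of_bool (glued Gl (insert v S) (\<Phi>(v := y))) * saved_weight (insert v S) (\<Phi>(v := y))
      \<le> of_bool (y = \<Phi> u) * (of_bool (glued Gl S \<Phi>) * saved_weight S \<Phi>)"
    proof (cases "glued Gl (insert v S) (\<Phi>(v := y))")
      case True
      then have "y = \<Phi> u" "glued Gl S \<Phi>"
        using glue(3-5) glued_update[OF True] by (auto simp: glued_def split: if_splits)
      then show ?thesis using True saved_weight_update_le[OF glue(3), of "\<Phi>" y] by simp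
    qed (simp add: saved_weight_nonneg)
  qed
  also have "\<dots> = (\<Sum>\<Phi>\<in>S \<rightarrow>\<^sub>E T. of_bool (glued Gl S \<Phi>) * saved_weight S \<Phi>)"
  proof (intro sum.cong refl)
    fix \<Phi> assume "\<Phi> \<in> S \<rightarrow>\<^sub>E T"
    then have "\<Phi> u \<in> T" using glue(4) by auto
    then have "(\<Sum>y\<in>T. of_bool (y = \<Phi> u) :: real) = 1" using finite_T by (simp add: of_bool_def)
    then show "(\<Sum>y\<in>T. of_bool (y = \<Phi> u) * (of_bool (glued Gl S \<Phi>) * saved_weight S \<Phi>))
        = of_bool (glued Gl S \<Phi>) * saved_weight S \<Phi>"
      by (simp only: sum_distrib_right[symmetric])
  qed
  also have "\<dots> \<le> real (card T) ^ k * ?D ^ card S" by (rule glue(6))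
  also have "\<dots> \<le> real (card T) ^ k * ?D ^ card (insert v S)"
    using D by (intro mult_left_mono power_increasing card_mono) (auto simp: finS)
  finally show ?case .
next
  case (edge S k v u d)
  let ?D = "card V + C + 1"
  have SV: "S \<subseteq> V" using explored_subset[OF edge(1)] .
  have finS: "finite S" using SV finite_V finite_subset by auto
  have "(\<Sum>\<Phi>\<in>insert v S \<rightarrow>\<^sub>E T. of_bool (glued Gl (insert v S) \<Phi>) * saved_weight (insert v S) \<Phi>)
     \<le> (\<Sum>\<Phi>\<in>S \<rightarrow>\<^sub>E T. \<Sum>y\<in>T. of_bool (glued Gl S \<Phi>) * saved_weight (insert v S) (\<Phi>(v := y)))"
    unfolding sum_PiE_insert[OF edge(3)] using edge(3)
    by (intro sum_mono mult_right_mono) (auto dest: glued_update simp: saved_weight_nonneg)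
  also have "\<dots> \<le> (\<Sum>\<Phi>\<in>S \<rightarrow>\<^sub>E T. of_bool (glued Gl S \<Phi>) * (?D * saved_weight S \<Phi>))"
  proof (intro sum_mono)
    fix \<Phi> assume "\<Phi> \<in> S \<rightarrow>\<^sub>E T"
    then have "\<Phi> u \<in> T" using edge(4) by auto
    then have "(\<Sum>y\<in>T. saved_weight (insert v S) (\<Phi>(v := y))) \<le> (card V + C) * saved_weight S \<Phi>"
      using sum_saved_weight_edge edge(3-6) SV by blast
    also have "\<dots> \<le> ?D * saved_weight S \<Phi>"
      by (intro mult_right_mono saved_weight_nonneg) simp
    finally have "(\<Sum>y\<in>T. saved_weight (insert v S) (\<Phi>(v := y))) \<le> ?D * saved_weight S \<Phi>" .
    then show "(\<Sum>y\<in>T. of_bool (glued Gl S \<Phi>) * saved_weight (insert v S) (\<Phi>(v := y)))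
       \<le> of_bool (glued Gl S \<Phi>) * (?D * saved_weight S \<Phi>)"
      by (simp add: sum_distrib_left[symmetric])
  qed
  also have "\<dots> = ?D * (\<Sum>\<Phi>\<in>S \<rightarrow>\<^sub>E T. of_bool (glued Gl S \<Phi>) * saved_weight S \<Phi>)"
    by (simp only: sum_distrib_left) (simp only: mult_ac)
  also have "\<dots> \<le> ?D * (real (card T) ^ k * ?D ^ card S)"
    using C_nonneg by (intro mult_left_mono edge.IH) simp
  finally show ?case using edge(3) finS by (simp add: mult_ac)
qed

text \<open>Grouping the edges by slot turns the product into slot weights raised to their
  multiplicities. Diagonal slots are discarded and multiplicities above 2 are lowered to 2; both
  only enlarge the product, since weights are at most 1.\<close>

lemma prod_weight_le_saved_weight:
  assumes "\<And>d. d \<in> E \<Longrightarrow> \<not> diagonal (slot \<Phi> d) \<Longrightarrow> \<exists>d'\<in>E. d' \<noteq> d \<and> slot \<Phi> d' = slot \<Phi> d"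
  shows "(\<Prod>d\<in>E. w (lab d) (\<Phi> (hd d)) (\<Phi> (tl d))) \<le> saved_weight V \<Phi>"
proof -
  let ?F = "\<lambda>k. {d \<in> E. slot \<Phi> d = k}"
  have inV: "inner V = E" using ends by (auto simp: inner_def)
  have "(\<Prod>d\<in>E. w (lab d) (\<Phi> (hd d)) (\<Phi> (tl d))) = (\<Prod>d\<in>E. slot_weight (slot \<Phi> d))"
    by (simp add: slot_weight_slot)
  also have "\<dots> = (\<Prod>k\<in>slot \<Phi> ` E. \<Prod>d\<in>?F k. slot_weight (slot \<Phi> d))"
    by (rule prod.image_gen[OF finite_E])
  also have "\<dots> = (\<Prod>k\<in>slot \<Phi> ` E. slot_weight k ^ card (?F k))"
    by (intro prod.cong refl) simp
  also have "\<dots> \<le> (\<Prod>k\<in>off_slots V \<Phi>. slot_weight k ^ card (?F k))"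
    using finite_E
    by (intro prod_le_prod_subset power_le_one zero_le_power slot_weight_nonneg
          slot_weight_le_1[of _ \<Phi>]) (auto simp: off_slots_def inV)
  also have "\<dots> \<le> (\<Prod>k\<in>off_slots V \<Phi>. (slot_weight k)\<^sup>2)"
  proof (intro prod_mono conjI zero_le_power slot_weight_nonneg)
    fix k assume k: "k \<in> off_slots V \<Phi>"
    then obtain d where d: "d \<in> E" "slot \<Phi> d = k" "\<not> diagonal k" by (auto simp: off_slots_def inV)
    then obtain d' where d': "d' \<in> E" "d' \<noteq> d" "slot \<Phi> d' = k" using assms by metis
    have "card {d, d'} \<le> card (?F k)" using d d' finite_E by (intro card_mono) auto
    then have "2 \<le> card (?F k)" using d'(2) by simp
    then show "slot_weight k ^ card (?F k) \<le> (slot_weight k)\<^sup>2"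
      using slot_weight_nonneg slot_weight_le_1[of k \<Phi>] d by (intro power_decreasing) auto
  qed
  finally show ?thesis by (simp add: saved_weight_def)
qed

end


section \<open>Disjoint copies of a connected graph\<close>

lemma connected_crossing_arc:
  assumes wf: "wf_digraph G" and conn: "Digraph_Component.connected G" and S: "S \<subseteq> verts G" "S \<noteq> {}" "S \<noteq> verts G"
  obtains e u v where "e \<in> arcs G" "u \<in> S" "v \<in> verts G - S"
    "(head G e = u \<and> tail G e = v) \<or> (head G e = v \<and> tail G e = u)"
proof -
  obtain a z where az: "a \<in> S" "z \<in> verts G - S" using S by auto
  then have "a \<rightarrow>\<^sup>*\<^bsub>mk_symmetric G\<^esub> z"
    using conn S(1) by (auto simp: Digraph_Component.connected_def strongly_connected_def)
  then have rt: "(a, z) \<in> (parcs (mk_symmetric G))\<^sup>*"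
    by (auto dest: reachable_rtranclI)
  \<comment> \<open>Induction along the path: as long as no crossing has been met, the current
    vertex still lies in \<open>S\<close>.\<close>
  have "\<exists>u v. (u, v) \<in> parcs (mk_symmetric G) \<and> u \<in> S \<and> v \<notin> S" if "z \<notin> S"
    using rt that by (induction rule: rtrancl_induct) (use az in auto)
  then obtain u v where uv: "(u, v) \<in> parcs (mk_symmetric G)" "u \<in> S" "v \<notin> S" using az by auto
  from uv(1) obtain e where e: "e \<in> arcs G"
    "(head G e = u \<and> tail G e = v) \<or> (head G e = v \<and> tail G e = u)"
    by (auto simp: parcs_mk_symmetric)
  have "v \<in> verts G" using e wf_digraph.wellformed[OF wf] by auto
  then show ?thesis using that e uv by blast
qed

definition copies :: "nat \<Rightarrow> 'a set \<Rightarrow> (nat \<times> 'a) set" where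
  "copies p A = {..<p} \<times> A"

locale copied_graph = fin_digraph G for G :: "('v, 'e) pre_digraph" +
  fixes \<gamma> :: "'e \<Rightarrow> 'i" and p :: nat
  assumes conn: "Digraph_Component.connected G"
begin

sublocale edge_system "copies p (verts G)" "copies p (arcs G)"
  "\<lambda>(r, e). (r, head G e)" "\<lambda>(r, e). (r, tail G e)" "\<lambda>(r, e). \<gamma> e"
  by unfold_locales (auto simp: copies_def)

text \<open>Connectedness lets one vertex of a copy draw in all the others by edge steps, so only
  the entry into a copy can cost a root.\<close>

lemma explored_fill_copy:
  assumes "explored Gl (A \<union> {r} \<times> S) k" "S \<subseteq> verts G" "S \<noteq> {}" "r < p" "A \<inter> {r} \<times> verts G = {}"
  shows "explored Gl (A \<union> {r} \<times> verts G) k"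
  using assms(1-3)
proof (induction "card (verts G - S)" arbitrary: S rule: less_induct)
  case less
  show ?case
  proof (cases "S = verts G")
    case False
    obtain e u v where e: "e \<in> arcs G" "u \<in> S" "v \<in> verts G - S"
      "(head G e = u \<and> tail G e = v) \<or> (head G e = v \<and> tail G e = u)"
      using connected_crossing_arc[OF wf_digraph_axioms conn less(3,4) False] by metis
    have "explored Gl (insert (r, v) (A \<union> {r} \<times> S)) k"
      using less(2) e assms(4,5)
      by (intro edge[where u = "(r, u)" and d = "(r, e)"]) (auto simp: copies_def)
    moreover have "insert (r, v) (A \<union> {r} \<times> S) = A \<union> {r} \<times> insert v S" by auto
    ultimately have "explored Gl (A \<union> {r} \<times> insert v S) k" by (simp only:)
    moreover have "card (verts G - insert v S) < card (verts G - S)"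
      using e(3) by (intro psubset_card_mono) auto
    moreover have "insert v S \<subseteq> verts G" using less(3) e(3) by simp
    ultimately show ?thesis by (intro less(1)) auto
  qed (use less in simp)
qed

text \<open>Every copy is glued to another one, so a new root is needed only for at most half of them.\<close>

lemma explored_copies:
  assumes s: "\<And>r. r < p \<Longrightarrow> s r < p \<and> s r \<noteq> r"
    and x: "\<And>r. r < p \<Longrightarrow> x r \<in> verts G" and y: "\<And>r. r < p \<Longrightarrow> y r \<in> verts G"
  defines "Gl \<equiv> {((r, x r), (s r, y r)) | r. r < p}"
  obtains k where "2 * k \<le> p" "explored Gl (copies p (verts G)) k"
proof -
  \<comment> \<open>Invariant of the induction on the number of missing copies: the completed copies
    \<open>B\<close> have used at most half as many roots as there are members of
    \<open>B\<close>.\<close>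
  have ne: "r < p \<Longrightarrow> explored Gl (B \<times> verts G) k \<Longrightarrow> B \<subseteq> {..<p} \<Longrightarrow> 2 * k \<le> card B \<Longrightarrow>
      \<exists>k. 2 * k \<le> p \<and> explored Gl (copies p (verts G)) k" for r B k
  proof (induction "p - card B" arbitrary: B k r rule: less_induct)
    case less
    have finB: "finite B" using less(4) finite_subset by auto
    show ?case
    proof (cases "B = {..<p}")
      case True
      then show ?thesis using less(3,5) by (auto simp: copies_def)
    next
      case False
      then obtain q where q: "q < p" "q \<notin> B" using less(4) by auto
      have step: "\<exists>k. 2 * k \<le> p \<and> explored Gl (copies p (verts G)) k"
        if "explored Gl (B' \<times> verts G) k'" "B \<subset> B'" "B' \<subseteq> {..<p}" "2 * k' \<le> card B'" for B' k'
      proof -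
        have "card B < card B'"
          using that(2,3) finite_subset[OF that(3)] by (intro psubset_card_mono) simp_all
        moreover have "card B' \<le> p" using card_mono[OF finite_lessThan that(3)] by simp
        ultimately have "p - card B' < p - card B" by linarith
        then show ?thesis by (rule less(1)[OF _ less(2) that(1,3,4)])
      qed
      show ?thesis
      proof (cases "s q \<in> B")
        case True
        \<comment> \<open>The partner of \<open>q\<close> is complete already, so \<open>q\<close>
          is entered by gluing.\<close>
        have "explored Gl (insert (q, x q) (B \<times> verts G)) k"
          using q x[OF q(1)] y[OF q(1)] True
          by (intro glue[where u = "(s q, y q)"] less(3)) (auto simp: Gl_def copies_def)
        then have "explored Gl (B \<times> verts G \<union> {q} \<times> verts G) k"
          using q x[OF q(1)] by (intro explored_fill_copy[where S = "{x q}"]) auto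
        moreover have "B \<times> verts G \<union> {q} \<times> verts G = insert q B \<times> verts G" by auto
        ultimately show ?thesis using less(4,5) q finB by (intro step[of "insert q B" k]) auto
      next
        case False
        \<comment> \<open>Neither \<open>q\<close> nor its partner is explored: one root pays for
          both, as the partner is then entered by gluing. The two are distinct, so the invariant is
          preserved.\<close>
        have sq: "s q < p" "s q \<noteq> q" using s[OF q(1)] by auto
        have "explored Gl (insert (q, x q) (B \<times> verts G)) (Suc k)"
          using q x[OF q(1)] by (intro root less(3)) (auto simp: copies_def)
        then have *: "explored Gl (B \<times> verts G \<union> {q} \<times> verts G) (Suc k)"
          using q x[OF q(1)] by (intro explored_fill_copy[where S = "{x q}"]) auto
        have "explored Gl (insert (s q, y q) (B \<times> verts G \<union> {q} \<times> verts G)) (Suc k)"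
          using q x[OF q(1)] y[OF q(1)] False sq
          by (intro glue[where u = "(q, x q)"] *) (auto simp: Gl_def copies_def)
        then have "explored Gl ((B \<times> verts G \<union> {q} \<times> verts G) \<union> {s q} \<times> verts G) (Suc k)"
          using q y[OF q(1)] sq False by (intro explored_fill_copy[where S = "{y q}"]) auto
        moreover have "(B \<times> verts G \<union> {q} \<times> verts G) \<union> {s q} \<times> verts G = insert (s q) (insert q B) \<times> verts G"
          by auto
        ultimately show ?thesis using less(4,5) q sq False finB
          by (intro step[of "insert (s q) (insert q B)" "Suc k"]) auto
      qed
    qed
  qed
  have "\<exists>k. 2 * k \<le> p \<and> explored Gl (copies p (verts G)) k"
  proof (cases "p = 0")
    case True
    then show ?thesis using explored.empty by (auto simp: copies_def)
  next
    case False
    then show ?thesis using ne[of 0 "{}" 0] explored.empty by auto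
  qed
  then show ?thesis using that by auto
qed

end

section \<open>Products of independent entries\<close>

text \<open>Conjugation has two sources, entries below the diagonal and copies that stand for the
  conjugate trace; a Boolean records both.\<close>

definition cnj_if :: "bool \<Rightarrow> complex \<Rightarrow> complex" where
  "cnj_if s z = (if s then cnj z else z)"

lemma norm_cnj_if [simp]: "cmod (cnj_if s z) = cmod z"
  by (simp add: cnj_if_def)

lemma measurable_cnj_if [measurable]: "cnj_if s \<in> borel_measurable borel"
  by (cases s) (auto simp: cnj_if_def[abs_def] intro!: borel_measurable_continuous_onI continuous_intros)

text \<open>The product is at most the corresponding power of its largest factor. This replaces
  Hoelder's inequality: mixed moments are reduced to moments of single variables. The summand 1
  covers the empty product.\<close>

lemma prod_le_sum_power:
  fixes f :: "'a \<Rightarrow> real"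
  assumes "finite A" "\<And>x. x \<in> A \<Longrightarrow> 0 \<le> f x"
  shows "(\<Prod>x\<in>A. f x) \<le> 1 + (\<Sum>x\<in>A. f x ^ card A)"
proof (cases "A = {}")
  case False
  define c where "c = Max (f ` A)"
  have "c \<in> f ` A" unfolding c_def using assms False by (intro Max_in) auto
  then obtain a where a: "a \<in> A" "c = f a" by auto
  have "(\<Prod>x\<in>A. f x) \<le> (\<Prod>x\<in>A. c)"
    using assms by (intro prod_mono) (auto simp: c_def)
  also have "\<dots> = f a ^ card A" by (simp add: a)
  also have "\<dots> \<le> (\<Sum>x\<in>A. f x ^ card A)"
    using assms a by (intro member_le_sum) auto
  finally show ?thesis by simp
qed simp

lemma add_power_le:
  fixes a b :: real
  assumes "0 \<le> a" "0 \<le> b"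
  shows "(a + b) ^ l \<le> 2 ^ l * (a ^ l + b ^ l)"
proof -
  have "(a + b) ^ l \<le> (2 * max a b) ^ l" using assms by (intro power_mono) auto
  also have "\<dots> = 2 ^ l * max a b ^ l" by (simp add: power_mult_distrib)
  also have "max a b ^ l \<le> a ^ l + b ^ l" using assms by (auto simp: max_def)
  finally show ?thesis by simp
qed

section \<open>Random variables with all moments\<close>

context prob_space
begin

text \<open>A class closed under sums and products, which a fixed order of integrability would not
  be. Every polynomial in the entries and their conjugates is integrable by applying the closure
  rules.\<close>

definition all_moments :: "('a \<Rightarrow> complex) \<Rightarrow> bool" where
  "all_moments f \<longleftrightarrow> f \<in> borel_measurable M \<and> (\<forall>l. integrable M (\<lambda>\<omega>. cmod (f \<omega>) ^ l))"

lemma all_moments_measurable [measurable_dest]: "all_moments f \<Longrightarrow> f \<in> borel_measurable M"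
  by (simp add: all_moments_def)

lemma all_moments_power: "all_moments f \<Longrightarrow> integrable M (\<lambda>\<omega>. cmod (f \<omega>) ^ l)"
  by (simp add: all_moments_def)

lemma all_moments_integrable: "all_moments f \<Longrightarrow> integrable M f"
  using all_moments_power[of f 1] by (auto intro: integrable_norm_cancel simp: all_moments_def)

lemma all_moments_const: "all_moments (\<lambda>_. c)"
  by (simp add: all_moments_def)

lemma all_moments_cnj_if: "all_moments f \<Longrightarrow> all_moments (\<lambda>\<omega>. cnj_if s (f \<omega>))"
  by (auto simp: all_moments_def)

text \<open>By \<open>2 x y \<le> x^2 + y^2\<close>, a moment of the product is bounded by moments
  of twice the order of the factors.\<close>

lemma all_moments_mult:
  assumes "all_moments f" "all_moments g"
  shows "all_moments (\<lambda>\<omega>. f \<omega> * g \<omega>)"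
  unfolding all_moments_def
proof (intro conjI allI)
  note [measurable] = assms[THEN all_moments_measurable]
  show "(\<lambda>\<omega>. f \<omega> * g \<omega>) \<in> borel_measurable M" by measurable
  fix l
  show "integrable M (\<lambda>\<omega>. cmod (f \<omega> * g \<omega>) ^ l)"
  proof (rule Bochner_Integration.integrable_bound)
    show "integrable M (\<lambda>\<omega>. cmod (f \<omega>) ^ (2 * l) + cmod (g \<omega>) ^ (2 * l))"
      using assms by (intro Bochner_Integration.integrable_add all_moments_power)
    have "cmod (f \<omega> * g \<omega>) ^ l \<le> cmod (f \<omega>) ^ (2 * l) + cmod (g \<omega>) ^ (2 * l)" for \<omega>
    proof -
      have "2 * (cmod (f \<omega>) ^ l * cmod (g \<omega>) ^ l) \<le> (cmod (f \<omega>) ^ l)\<^sup>2 + (cmod (g \<omega>) ^ l)\<^sup>2"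
        using sum_squares_bound[of "cmod (f \<omega>) ^ l" "cmod (g \<omega>) ^ l"] by simp
      moreover have "0 \<le> cmod (f \<omega>) ^ l * cmod (g \<omega>) ^ l" by simp
      ultimately have "cmod (f \<omega>) ^ l * cmod (g \<omega>) ^ l \<le> (cmod (f \<omega>) ^ l)\<^sup>2 + (cmod (g \<omega>) ^ l)\<^sup>2"
        by linarith
      then show ?thesis
        by (simp add: norm_mult power_mult_distrib power_mult[symmetric] mult.commute)
    qed
    then show "AE \<omega> in M. norm (cmod (f \<omega> * g \<omega>) ^ l) \<le> norm (cmod (f \<omega>) ^ (2 * l) + cmod (g \<omega>) ^ (2 * l))"
      by (intro AE_I2) simp
  qed measurable
qed

lemma all_moments_add:
  assumes "all_moments f" "all_moments g"
  shows "all_moments (\<lambda>\<omega>. f \<omega> + g \<omega>)"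
  unfolding all_moments_def
proof (intro conjI allI)
  note [measurable] = assms[THEN all_moments_measurable]
  show "(\<lambda>\<omega>. f \<omega> + g \<omega>) \<in> borel_measurable M" by measurable
  fix l
  show "integrable M (\<lambda>\<omega>. cmod (f \<omega> + g \<omega>) ^ l)"
  proof (rule Bochner_Integration.integrable_bound)
    show "integrable M (\<lambda>\<omega>. 2 ^ l * (cmod (f \<omega>) ^ l + cmod (g \<omega>) ^ l))"
      using assms by (intro integrable_mult_right Bochner_Integration.integrable_add all_moments_power)
    have "cmod (f \<omega> + g \<omega>) ^ l \<le> 2 ^ l * (cmod (f \<omega>) ^ l + cmod (g \<omega>) ^ l)" for \<omega>
      by (rule order.trans[OF power_mono[OF norm_triangle_ineq] add_power_le]) auto
    then show "AE \<omega> in M. norm (cmod (f \<omega> + g \<omega>) ^ l) \<le> norm (2 ^ l * (cmod (f \<omega>) ^ l + cmod (g \<omega>) ^ l))"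
      by (intro AE_I2) simp
  qed measurable
qed

lemma all_moments_diff:
  assumes "all_moments f" "all_moments g"
  shows "all_moments (\<lambda>\<omega>. f \<omega> - g \<omega>)"
  using all_moments_add[OF assms(1) all_moments_mult[OF all_moments_const[of "-1"] assms(2)]] by simp

lemma all_moments_prod:
  "(\<And>x. x \<in> A \<Longrightarrow> all_moments (f x)) \<Longrightarrow> all_moments (\<lambda>\<omega>. \<Prod>x\<in>A. f x \<omega>)"
  by (induction A rule: infinite_finite_induct) (auto intro: all_moments_mult all_moments_const)

lemma all_moments_sum:
  "(\<And>x. x \<in> A \<Longrightarrow> all_moments (f x)) \<Longrightarrow> all_moments (\<lambda>\<omega>. \<Sum>x\<in>A. f x \<omega>)"
  by (induction A rule: infinite_finite_induct) (auto intro: all_moments_add all_moments_const)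

end

section \<open>Functions of blocks of independent entries\<close>

locale independent_entries = prob_space M for M :: "'w measure" +
  fixes K :: "'k set" and Y :: "'k \<Rightarrow> 'w \<Rightarrow> complex"
  assumes indep: "indep_vars (\<lambda>_. borel) Y K"
    and moments: "\<And>k l. k \<in> K \<Longrightarrow> integrable M (\<lambda>\<omega>. cmod (Y k \<omega>) ^ l)"
begin

lemma all_moments_entry: "k \<in> K \<Longrightarrow> all_moments (Y k)"
  using indep moments by (auto simp: all_moments_def indep_vars_def)

text \<open>Measurability with respect to the entries in \<open>A\<close>, expressed as a
  factorization through their restriction, because independence of disjoint blocks is available for
  restrictions and passes to measurable images.\<close>

definition determined :: "'k set \<Rightarrow> ('w \<Rightarrow> complex) \<Rightarrow> bool" where
  "determined A f \<longleftrightarrow> (\<exists>g\<in>borel_measurable (PiM A (\<lambda>_. borel)).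
     \<forall>\<omega>\<in>space M. f \<omega> = g (restrict (\<lambda>k. Y k \<omega>) A))"

lemma determined_const: "determined A (\<lambda>_. c)"
  unfolding determined_def by (rule bexI[of _ "\<lambda>_. c"]) auto

lemma determined_entry:
  assumes "k \<in> A"
  shows "determined A (Y k)"
  unfolding determined_def using assms by (intro bexI[of _ "\<lambda>x. x k"]) auto

lemma determined_cnj_if:
  assumes "determined A f"
  shows "determined A (\<lambda>\<omega>. cnj_if s (f \<omega>))"
proof -
  obtain g where [measurable]: "g \<in> borel_measurable (PiM A (\<lambda>_. borel))"
    and g: "\<And>\<omega>. \<omega> \<in> space M \<Longrightarrow> f \<omega> = g (restrict (\<lambda>k. Y k \<omega>) A)"
    using assms unfolding determined_def by blast
  show ?thesis unfolding determined_def
    by (rule bexI[of _ "\<lambda>x. cnj_if s (g x)"]) (auto simp: g)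
qed

lemma
  assumes "determined A f" "determined A f'"
  shows determined_mult: "determined A (\<lambda>\<omega>. f \<omega> * f' \<omega>)"
    and determined_diff: "determined A (\<lambda>\<omega>. f \<omega> - f' \<omega>)"
proof -
  obtain g where [measurable]: "g \<in> borel_measurable (PiM A (\<lambda>_. borel))"
    and g: "\<And>\<omega>. \<omega> \<in> space M \<Longrightarrow> f \<omega> = g (restrict (\<lambda>k. Y k \<omega>) A)"
    using assms unfolding determined_def by blast
  obtain g' where [measurable]: "g' \<in> borel_measurable (PiM A (\<lambda>_. borel))"
    and g': "\<And>\<omega>. \<omega> \<in> space M \<Longrightarrow> f' \<omega> = g' (restrict (\<lambda>k. Y k \<omega>) A)"
    using assms unfolding determined_def by blast
  show "determined A (\<lambda>\<omega>. f \<omega> * f' \<omega>)" unfolding determined_def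
    by (rule bexI[of _ "\<lambda>x. g x * g' x"]) (auto simp: g g')
  show "determined A (\<lambda>\<omega>. f \<omega> - f' \<omega>)" unfolding determined_def
    by (rule bexI[of _ "\<lambda>x. g x - g' x"]) (auto simp: g g')
qed

lemma determined_prod:
  "(\<And>x. x \<in> B \<Longrightarrow> determined A (f x)) \<Longrightarrow> determined A (\<lambda>\<omega>. \<Prod>x\<in>B. f x \<omega>)"
  by (induction B rule: infinite_finite_induct) (auto intro: determined_mult determined_const)

lemma expectation_mult:
  assumes "determined A f" "determined B g" "A \<inter> B = {}" "A \<subseteq> K" "B \<subseteq> K"
    "integrable M f" "integrable M g"
  shows "expectation (\<lambda>\<omega>. f \<omega> * g \<omega>) = expectation f * expectation g"
proof -
  let ?r = "\<lambda>A \<omega>. restrict (\<lambda>k. Y k \<omega>) A"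
  obtain f' where f'm: "f' \<in> borel_measurable (PiM A (\<lambda>_. borel))"
    and f': "\<And>\<omega>. \<omega> \<in> space M \<Longrightarrow> f \<omega> = f' (?r A \<omega>)"
    using assms(1) unfolding determined_def by blast
  obtain g' where g'm: "g' \<in> borel_measurable (PiM B (\<lambda>_. borel))"
    and g': "\<And>\<omega>. \<omega> \<in> space M \<Longrightarrow> g \<omega> = g' (?r B \<omega>)"
    using assms(2) unfolding determined_def by blast
  have "indep_var (PiM A (\<lambda>_. borel)) (?r A) (PiM B (\<lambda>_. borel)) (?r B)"
    using indep_var_restrict[OF indep assms(3-5)] .
  from indep_var_compose[OF this f'm g'm]
  have "indep_var borel (\<lambda>\<omega>. f' (?r A \<omega>)) borel (\<lambda>\<omega>. g' (?r B \<omega>))" by (simp add: comp_def)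
  moreover have "integrable M (\<lambda>\<omega>. f' (?r A \<omega>))" "integrable M (\<lambda>\<omega>. g' (?r B \<omega>))"
    using assms(6,7) f' g' by (auto cong: Bochner_Integration.integrable_cong)
  ultimately have "expectation (\<lambda>\<omega>. f' (?r A \<omega>) * g' (?r B \<omega>))
      = expectation (\<lambda>\<omega>. f' (?r A \<omega>)) * expectation (\<lambda>\<omega>. g' (?r B \<omega>))"
    by (rule indep_var_lebesgue_integral)
  then show ?thesis using f' g' by (simp cong: Bochner_Integration.integral_cong)
qed

lemma expectation_cnj_if:
  assumes "integrable M f"
  shows "expectation (\<lambda>\<omega>. cnj_if s (f \<omega>)) = cnj_if s (expectation f)"
  using assms by (simp add: cnj_if_def)

text \<open>The centred entry is independent of the remaining factor, and conjugation preserves a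
  zero mean. All vanishing caused by an unpaired entry goes through this fact.\<close>

lemma expectation_single_zero:
  assumes "k \<in> K" "expectation (Y k) = 0" "determined (K - {k}) f" "integrable M f"
  shows "expectation (\<lambda>\<omega>. cnj_if s (Y k \<omega>) * f \<omega>) = 0"
proof -
  have int: "integrable M (Y k)"
    using all_moments_integrable[OF all_moments_entry[OF assms(1)]] .
  have "expectation (\<lambda>\<omega>. cnj_if s (Y k \<omega>) * f \<omega>)
      = expectation (\<lambda>\<omega>. cnj_if s (Y k \<omega>)) * expectation f"
    using assms all_moments_integrable[OF all_moments_cnj_if[OF all_moments_entry[OF assms(1)]]]
    by (intro expectation_mult[of "{k}" _ "K - {k}"] determined_cnj_if determined_entry) auto
  then show ?thesis using expectation_cnj_if[OF int] assms(2) by (simp add: cnj_if_def)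
qed

end

section \<open>Expectations of products of centred monomials\<close>

locale entry_products = independent_entries M K Y
  for M :: "'w measure" and K :: "'k set" and Y :: "'k \<Rightarrow> 'w \<Rightarrow> complex" +
  fixes R :: "'r set" and E :: "'e set" and key :: "'r \<Rightarrow> 'e \<Rightarrow> 'k" and s :: "'r \<Rightarrow> 'e \<Rightarrow> bool"
  assumes finite_R: "finite R" and finite_E: "finite E"
    and key_in: "\<And>r e. r \<in> R \<Longrightarrow> e \<in> E \<Longrightarrow> key r e \<in> K"
begin

definition entry :: "'r \<Rightarrow> 'e \<Rightarrow> 'w \<Rightarrow> complex" where
  "entry r e \<omega> = cnj_if (s r e) (Y (key r e) \<omega>)"

definition monomial :: "'r \<Rightarrow> 'w \<Rightarrow> complex" where
  "monomial r \<omega> = (\<Prod>e\<in>E. entry r e \<omega>)"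

definition centered :: "'r \<Rightarrow> 'w \<Rightarrow> complex" where
  "centered r \<omega> = monomial r \<omega> - expectation (monomial r)"

lemma all_moments_entries: "r \<in> R \<Longrightarrow> e \<in> E \<Longrightarrow> all_moments (entry r e)"
  unfolding entry_def by (intro all_moments_cnj_if all_moments_entry key_in)

lemma all_moments_monomial: "r \<in> R \<Longrightarrow> all_moments (monomial r)"
  unfolding monomial_def by (intro all_moments_prod all_moments_entries)

lemma all_moments_centered: "r \<in> R \<Longrightarrow> all_moments (centered r)"
  unfolding centered_def by (intro all_moments_diff all_moments_monomial all_moments_const)

lemma determined_monomial: "key r ` E \<subseteq> A \<Longrightarrow> determined A (monomial r)"
  unfolding monomial_def entry_def by (intro determined_prod determined_cnj_if determined_entry) auto

lemma determined_centered: "key r ` E \<subseteq> A \<Longrightarrow> determined A (centered r)"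
  unfolding centered_def by (intro determined_diff determined_monomial determined_const)

text \<open>A factor that shares no entry is independent of the product of the others, and its own
  mean is zero by centring. No centredness of entries is involved, so this also covers diagonal
  ones.\<close>

lemma expectation_prod_unshared:
  assumes "r \<in> R" and "\<And>r' e e'. r' \<in> R \<Longrightarrow> r' \<noteq> r \<Longrightarrow> e \<in> E \<Longrightarrow> e' \<in> E \<Longrightarrow> key r' e' \<noteq> key r e"
  shows "expectation (\<lambda>\<omega>. \<Prod>r\<in>R. centered r \<omega>) = 0"
proof -
  let ?rest = "\<lambda>\<omega>. \<Prod>r\<in>R - {r}. centered r \<omega>"
  have m: "all_moments ?rest" by (intro all_moments_prod all_moments_centered) auto
  have "expectation (\<lambda>\<omega>. \<Prod>r\<in>R. centered r \<omega>) = expectation (\<lambda>\<omega>. centered r \<omega> * ?rest \<omega>)"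
    using assms(1) finite_R by (simp add: prod.remove)
  also have "\<dots> = expectation (centered r) * expectation ?rest"
    using assms key_in
    by (intro expectation_mult[of "key r ` E" _ "\<Union>r'\<in>R - {r}. key r' ` E"] determined_prod
        determined_centered all_moments_integrable m all_moments_centered) fastforce+
  also have "expectation (centered r) = 0"
    unfolding centered_def using all_moments_integrable[OF all_moments_monomial[OF assms(1)]]
    by (simp add: prob_space)
  finally show ?thesis by simp
qed

text \<open>An entry of mean zero that occurs only once in the whole product can be pulled out of
  it.\<close>

lemma expectation_prod_single:
  assumes "r \<in> R" "e \<in> E" "expectation (Y (key r e)) = 0"
    and "\<And>r' e'. r' \<in> R \<Longrightarrow> e' \<in> E \<Longrightarrow> (r', e') \<noteq> (r, e) \<Longrightarrow> key r' e' \<noteq> key r e"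
  shows "expectation (\<lambda>\<omega>. \<Prod>r\<in>R. centered r \<omega>) = 0"
proof -
  let ?k = "key r e"
  let ?mono = "\<lambda>\<omega>. \<Prod>e'\<in>E - {e}. entry r e' \<omega>"
  let ?rest = "\<lambda>\<omega>. \<Prod>r\<in>R - {r}. centered r \<omega>"
  have mono: "monomial r = (\<lambda>\<omega>. cnj_if (s r e) (Y ?k \<omega>) * ?mono \<omega>)"
    using assms(2) finite_E by (simp add: monomial_def fun_eq_iff prod.remove entry_def)
  have dm: "determined (K - {?k}) ?mono"
    unfolding entry_def using assms key_in
    by (intro determined_prod determined_cnj_if determined_entry) auto
  have dr: "determined (K - {?k}) ?rest"
    using assms key_in by (intro determined_prod determined_centered) auto
  have mm: "all_moments ?mono"
    using assms(1) by (intro all_moments_prod all_moments_entries) auto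
  have mr: "all_moments ?rest" by (intro all_moments_prod all_moments_centered) auto
  have k: "?k \<in> K" using key_in assms by auto
  \<comment> \<open>The lone entry already makes the monomial centred, so nothing is subtracted from
    it and the entry is a factor of the whole product.\<close>
  have "expectation (monomial r) = 0"
    unfolding mono by (intro expectation_single_zero k assms dm all_moments_integrable mm)
  then have "expectation (\<lambda>\<omega>. \<Prod>r\<in>R. centered r \<omega>)
      = expectation (\<lambda>\<omega>. cnj_if (s r e) (Y ?k \<omega>) * (?mono \<omega> * ?rest \<omega>))"
    using assms(1) finite_R by (simp add: prod.remove centered_def[of r] mono mult.assoc)
  also have "\<dots> = 0"
    by (intro expectation_single_zero k assms determined_mult dm dr all_moments_integrable all_moments_mult mm mr)
  finally show ?thesis .
qed

text \<open>\<open>K'\<close> is a set of keys with a common moment bound. It is kept apart from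
  \<open>K\<close> because moments are controlled uniformly over finitely many labels only; later it
  consists of the labels occurring in the graph.\<close>

lemma expectation_monomial_power_le:
  fixes B :: real
  assumes "r \<in> R" and B: "0 \<le> B" "\<And>k. k \<in> K' \<Longrightarrow> expectation (\<lambda>\<omega>. cmod (Y k \<omega>) ^ (l * card E)) \<le> B"
    and "key r ` E \<subseteq> K'"
  shows "expectation (\<lambda>\<omega>. cmod (monomial r \<omega>) ^ l) \<le> 1 + card E * B"
proof -
  have int: "integrable M (\<lambda>\<omega>. cmod (Y (key r e) \<omega>) ^ (l * card E))" if "e \<in> E" for e
    using moments[OF key_in[OF assms(1) that]] .
  have "expectation (\<lambda>\<omega>. cmod (monomial r \<omega>) ^ l)
     \<le> expectation (\<lambda>\<omega>. 1 + (\<Sum>e\<in>E. cmod (Y (key r e) \<omega>) ^ (l * card E)))"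
  proof (rule integral_mono)
    show "integrable M (\<lambda>\<omega>. cmod (monomial r \<omega>) ^ l)"
      by (rule all_moments_power[OF all_moments_monomial[OF assms(1)]])
    show "integrable M (\<lambda>\<omega>. 1 + (\<Sum>e\<in>E. cmod (Y (key r e) \<omega>) ^ (l * card E)))"
      using int by (intro Bochner_Integration.integrable_add Bochner_Integration.integrable_sum) auto
    fix \<omega>
    have "cmod (monomial r \<omega>) ^ l = (\<Prod>e\<in>E. cmod (Y (key r e) \<omega>) ^ l)"
      by (simp add: monomial_def entry_def prod_norm[symmetric] prod_power_distrib)
    also have "\<dots> \<le> 1 + (\<Sum>e\<in>E. (cmod (Y (key r e) \<omega>) ^ l) ^ card E)"
      by (rule prod_le_sum_power[OF finite_E]) simp
    finally show "cmod (monomial r \<omega>) ^ l \<le> 1 + (\<Sum>e\<in>E. cmod (Y (key r e) \<omega>) ^ (l * card E))"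
      by (simp add: power_mult)
  qed
  also have "\<dots> = 1 + (\<Sum>e\<in>E. expectation (\<lambda>\<omega>. cmod (Y (key r e) \<omega>) ^ (l * card E)))"
    using int by (simp add: prob_space)
  also have "\<dots> \<le> 1 + (\<Sum>e\<in>E. B)"
    using assms by (intro add_left_mono sum_mono) auto
  finally show ?thesis by simp
qed

text \<open>Two orders of moments enter: \<open>card R * card E\<close> for the power
  \<open>card R\<close> of a monomial, and \<open>card E\<close> for its mean. The bound depends on
  the sizes of \<open>R\<close> and \<open>E\<close> and on \<open>B\<close> only, hence not on the
  labelling.\<close>

lemma expectation_prod_centered_le:
  fixes B D :: real
  assumes B: "0 \<le> B" "\<And>k. k \<in> K' \<Longrightarrow> expectation (\<lambda>\<omega>. cmod (Y k \<omega>) ^ (card R * card E)) \<le> B"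
    "\<And>k. k \<in> K' \<Longrightarrow> expectation (\<lambda>\<omega>. cmod (Y k \<omega>) ^ card E) \<le> B"
    and "\<And>r. r \<in> R \<Longrightarrow> key r ` E \<subseteq> K'"
  defines "D \<equiv> 1 + card E * B"
  shows "cmod (expectation (\<lambda>\<omega>. \<Prod>r\<in>R. centered r \<omega>)) \<le> 1 + card R * (2 ^ card R * (D + D ^ card R))"
proof -
  let ?p = "card R"
  have int: "integrable M (\<lambda>\<omega>. cmod (centered r \<omega>) ^ l)" if "r \<in> R" for r l
    by (rule all_moments_power[OF all_moments_centered[OF that]])
  have each: "expectation (\<lambda>\<omega>. cmod (centered r \<omega>) ^ ?p) \<le> 2 ^ ?p * (D + D ^ ?p)" if r: "r \<in> R" for r
  proof -
    have "cmod (expectation (monomial r)) \<le> expectation (\<lambda>\<omega>. cmod (monomial r \<omega>) ^ 1)"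
      using integral_norm_bound[of M "monomial r"] by simp
    also have "\<dots> \<le> D"
      unfolding D_def using assms r by (intro expectation_monomial_power_le[where K' = K']) auto
    finally have mean: "cmod (expectation (monomial r)) \<le> D" .
    have "expectation (\<lambda>\<omega>. cmod (centered r \<omega>) ^ ?p)
        \<le> expectation (\<lambda>\<omega>. 2 ^ ?p * (cmod (monomial r \<omega>) ^ ?p + D ^ ?p))"
    proof (rule integral_mono[OF int[OF r]])
      show "integrable M (\<lambda>\<omega>. 2 ^ ?p * (cmod (monomial r \<omega>) ^ ?p + D ^ ?p))"
        using all_moments_power[OF all_moments_monomial[OF r]]
        by (intro integrable_mult_right Bochner_Integration.integrable_add) auto
      fix \<omega>
      have "cmod (centered r \<omega>) \<le> cmod (monomial r \<omega>) + D"
        unfolding centered_def by (rule order.trans[OF norm_triangle_ineq4 add_left_mono[OF mean]])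
      then have "cmod (centered r \<omega>) ^ ?p \<le> (cmod (monomial r \<omega>) + D) ^ ?p"
        by (rule power_mono) simp
      also have "\<dots> \<le> 2 ^ ?p * (cmod (monomial r \<omega>) ^ ?p + D ^ ?p)"
        using B(1) by (intro add_power_le) (auto simp: D_def)
      finally show "cmod (centered r \<omega>) ^ ?p \<le> 2 ^ ?p * (cmod (monomial r \<omega>) ^ ?p + D ^ ?p)" .
    qed
    also have "\<dots> = 2 ^ ?p * (expectation (\<lambda>\<omega>. cmod (monomial r \<omega>) ^ ?p) + D ^ ?p)"
      using all_moments_power[OF all_moments_monomial[OF r]] by (simp add: prob_space)
    also have "\<dots> \<le> 2 ^ ?p * (D + D ^ ?p)"
      unfolding D_def using assms r
      by (intro mult_left_mono add_right_mono expectation_monomial_power_le[where K' = K']) auto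
    finally show ?thesis .
  qed
  have "cmod (expectation (\<lambda>\<omega>. \<Prod>r\<in>R. centered r \<omega>)) \<le> expectation (\<lambda>\<omega>. cmod (\<Prod>r\<in>R. centered r \<omega>))"
    by (rule integral_norm_bound)
  also have "\<dots> \<le> expectation (\<lambda>\<omega>. 1 + (\<Sum>r\<in>R. cmod (centered r \<omega>) ^ ?p))"
  proof (rule integral_mono)
    have "all_moments (\<lambda>\<omega>. \<Prod>r\<in>R. centered r \<omega>)" by (intro all_moments_prod all_moments_centered)
    from all_moments_power[OF this, of 1] show "integrable M (\<lambda>\<omega>. cmod (\<Prod>r\<in>R. centered r \<omega>))" by simp
    show "integrable M (\<lambda>\<omega>. 1 + (\<Sum>r\<in>R. cmod (centered r \<omega>) ^ ?p))"
      using int by (intro Bochner_Integration.integrable_add Bochner_Integration.integrable_sum) auto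
    show "cmod (\<Prod>r\<in>R. centered r \<omega>) \<le> 1 + (\<Sum>r\<in>R. cmod (centered r \<omega>) ^ ?p)" for \<omega>
      unfolding prod_norm[symmetric] by (rule prod_le_sum_power[OF finite_R]) simp
  qed
  also have "\<dots> = 1 + (\<Sum>r\<in>R. expectation (\<lambda>\<omega>. cmod (centered r \<omega>) ^ ?p))"
    using int by (simp add: prob_space)
  also have "\<dots> \<le> 1 + (\<Sum>r\<in>R. 2 ^ ?p * (D + D ^ ?p))"
    by (intro add_left_mono sum_mono each)
  finally show ?thesis by simp
qed

end

section \<open>Labellings that survive the expectation\<close>

definition arc_slot :: "('v, 'e) pre_digraph \<Rightarrow> ('e \<Rightarrow> 'i) \<Rightarrow> ('v \<Rightarrow> nat) \<Rightarrow> 'e \<Rightarrow> 'i \<times> nat \<times> nat" where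
  "arc_slot G \<gamma> \<phi> e =
     (\<gamma> e, min (\<phi> (head G e)) (\<phi> (tail G e)), max (\<phi> (head G e)) (\<phi> (tail G e)))"

context copied_graph
begin

text \<open>Expanding a product of sums yields a family of labellings, one for each copy, whereas
  the exploration needs one labelling of the disjoint union. The restriction keeps the result
  extensional, so that the translation is injective into a function space.\<close>

definition joint_labelling :: "(nat \<Rightarrow> 'v \<Rightarrow> nat) \<Rightarrow> nat \<times> 'v \<Rightarrow> nat" where
  "joint_labelling \<Phi> = restrict (\<lambda>(r, v). \<Phi> r v) (copies p (verts G))"

lemma slot_joint_labelling:
  "r < p \<Longrightarrow> e \<in> arcs G \<Longrightarrow> slot (joint_labelling \<Phi>) (r, e) = arc_slot G \<gamma> (\<Phi> r) e"
  by (simp add: slot_def arc_slot_def joint_labelling_def copies_def)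

lemma joint_labelling_PiE:
  "\<Phi> \<in> {..<p} \<rightarrow>\<^sub>E (verts G \<rightarrow>\<^sub>E T) \<Longrightarrow> joint_labelling \<Phi> \<in> copies p (verts G) \<rightarrow>\<^sub>E T"
  by (fastforce simp: joint_labelling_def copies_def PiE_iff)

lemma inj_on_joint_labelling: "inj_on joint_labelling ({..<p} \<rightarrow>\<^sub>E (verts G \<rightarrow>\<^sub>E T))"
proof (rule inj_onI)
  fix \<Phi> \<Psi> assume \<Phi>: "\<Phi> \<in> {..<p} \<rightarrow>\<^sub>E (verts G \<rightarrow>\<^sub>E T)" and \<Psi>: "\<Psi> \<in> {..<p} \<rightarrow>\<^sub>E (verts G \<rightarrow>\<^sub>E T)"
    and eq: "joint_labelling \<Phi> = joint_labelling \<Psi>"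
  show "\<Phi> = \<Psi>"
  proof (rule PiE_ext[OF \<Phi> \<Psi>])
    fix r assume r: "r \<in> {..<p}"
    show "\<Phi> r = \<Psi> r"
    proof (rule PiE_ext)
      show "\<Phi> r \<in> verts G \<rightarrow>\<^sub>E T" "\<Psi> r \<in> verts G \<rightarrow>\<^sub>E T" using \<Phi> \<Psi> r by auto
      fix v assume "v \<in> verts G"
      then show "\<Phi> r v = \<Psi> r v"
        using fun_cong[OF eq, of "(r, v)"] r by (simp add: joint_labelling_def copies_def)
    qed
  qed
qed

text \<open>The two clauses negate the two situations in which the expectation vanishes: a copy
  sharing no entry, and an off-diagonal entry occurring only once.\<close>

definition contributing :: "(nat \<Rightarrow> 'v \<Rightarrow> nat) \<Rightarrow> bool" where
  "contributing \<Phi> \<longleftrightarrow>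
     (\<forall>r<p. \<exists>r'<p. r' \<noteq> r \<and> (\<exists>e\<in>arcs G. \<exists>e'\<in>arcs G. arc_slot G \<gamma> (\<Phi> r') e' = arc_slot G \<gamma> (\<Phi> r) e)) \<and>
     (\<forall>r<p. \<forall>e\<in>arcs G. \<not> diagonal (arc_slot G \<gamma> (\<Phi> r) e) \<longrightarrow>
        (\<exists>r'<p. \<exists>e'\<in>arcs G. (r', e') \<noteq> (r, e) \<and> arc_slot G \<gamma> (\<Phi> r') e' = arc_slot G \<gamma> (\<Phi> r) e))"

text \<open>Which vertices of different copies coincide depends on the labelling, but an exploration
  must be fixed before summing. Hence a union bound over all patterns, whose number is independent
  of \<open>n\<close>.\<close>

definition gluings :: "(nat \<Rightarrow> nat \<times> 'v \<times> 'v) set" where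
  "gluings = (\<Pi>\<^sub>E r\<in>{..<p}. ({..<p} - {r}) \<times> verts G \<times> verts G)"

definition glue_pairs :: "(nat \<Rightarrow> nat \<times> 'v \<times> 'v) \<Rightarrow> ((nat \<times> 'v) \<times> (nat \<times> 'v)) set" where
  "glue_pairs f = {((r, fst (snd (f r))), (fst (f r), snd (snd (f r)))) | r. r < p}"

text \<open>Equal slots mean equal unordered pairs of values, so the value at the head of one edge
  reappears at one end of the other.\<close>

lemma contributing_imp_glued:
  assumes "contributing \<Phi>"
  shows "\<exists>f\<in>gluings. glued (glue_pairs f) (copies p (verts G)) (joint_labelling \<Phi>)"
proof -
  have "\<exists>q. q \<in> ({..<p} - {r}) \<times> verts G \<times> verts G \<and> \<Phi> r (fst (snd q)) = \<Phi> (fst q) (snd (snd q))"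
    if "r < p" for r
  proof -
    obtain r' e e' where *: "r' < p" "r' \<noteq> r" "e \<in> arcs G" "e' \<in> arcs G"
      "arc_slot G \<gamma> (\<Phi> r') e' = arc_slot G \<gamma> (\<Phi> r) e"
      using assms \<open>r < p\<close> unfolding contributing_def by blast
    have "\<Phi> r (head G e) = \<Phi> r' (head G e') \<or> \<Phi> r (head G e) = \<Phi> r' (tail G e')"
      using *(5) by (auto simp: arc_slot_def min_def max_def split: if_splits)
    then show ?thesis
    proof
      assume "\<Phi> r (head G e) = \<Phi> r' (head G e')"
      then show ?thesis using * by (intro exI[of _ "(r', head G e, head G e')"]) auto
    next
      assume "\<Phi> r (head G e) = \<Phi> r' (tail G e')"
      then show ?thesis using * by (intro exI[of _ "(r', head G e, tail G e')"]) auto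
    qed
  qed
  then obtain g where g: "\<And>r. r < p \<Longrightarrow> g r \<in> ({..<p} - {r}) \<times> verts G \<times> verts G"
    "\<And>r. r < p \<Longrightarrow> \<Phi> r (fst (snd (g r))) = \<Phi> (fst (g r)) (snd (snd (g r)))"
    by metis
  let ?f = "restrict g {..<p}"
  have "?f \<in> gluings" unfolding gluings_def using g(1) by (intro restrict_PiE_iff[THEN iffD2]) auto
  moreover have "glued (glue_pairs ?f) (copies p (verts G)) (joint_labelling \<Phi>)"
    using g(2) by (auto simp: glued_def glue_pairs_def joint_labelling_def)
  ultimately show ?thesis by blast
qed

lemma finite_gluings: "finite gluings"
  unfolding gluings_def by (intro finite_PiE) auto

lemma sum_contributing_le:
  fixes w :: "'i \<Rightarrow> nat \<Rightarrow> nat \<Rightarrow> real" and C :: real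
  assumes T: "finite T" "T \<noteq> {}" and p: "p = 2 * m"
    and w: "\<And>i a b. 0 \<le> w i a b" "\<And>e a b. e \<in> arcs G \<Longrightarrow> w (\<gamma> e) a b \<le> 1" "\<And>i a b. w i a b = w i b a"
    and C: "\<And>e a. e \<in> arcs G \<Longrightarrow> a \<in> T \<Longrightarrow> (\<Sum>b\<in>T. (w (\<gamma> e) a b)\<^sup>2) \<le> C" "0 \<le> C"
  shows "(\<Sum>\<Phi>\<in>{..<p} \<rightarrow>\<^sub>E (verts G \<rightarrow>\<^sub>E T). of_bool (contributing \<Phi>) *
           (\<Prod>r<p. \<Prod>e\<in>arcs G. w (\<gamma> e) (\<Phi> r (head G e)) (\<Phi> r (tail G e))))
    \<le> card gluings * (real (card T) ^ m * (p * card (verts G) + C + 1) ^ (p * card (verts G)))"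
proof -
  interpret weighted_edge_system "copies p (verts G)" "copies p (arcs G)"
    "\<lambda>(r, e). (r, head G e)" "\<lambda>(r, e). (r, tail G e)" "\<lambda>(r, e). \<gamma> e" w T C
    using T w C by unfold_locales (auto simp: copies_def)
  let ?V = "copies p (verts G)"
  let ?P = "{..<p} \<rightarrow>\<^sub>E (verts G \<rightarrow>\<^sub>E T)"
  let ?D = "p * card (verts G) + C + 1"
  let ?g = "\<lambda>f \<Psi>. of_bool (glued (glue_pairs f) ?V \<Psi>) * saved_weight ?V \<Psi>"
  have cardV: "card ?V = p * card (verts G)" by (simp add: copies_def)
  have each: "of_bool (contributing \<Phi>) *
           (\<Prod>r<p. \<Prod>e\<in>arcs G. w (\<gamma> e) (\<Phi> r (head G e)) (\<Phi> r (tail G e)))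
        \<le> (\<Sum>f\<in>gluings. ?g f (joint_labelling \<Phi>))" for \<Phi>
  proof (cases "contributing \<Phi>")
    case True
    let ?\<Psi> = "joint_labelling \<Phi>"
    have "(\<Prod>r<p. \<Prod>e\<in>arcs G. w (\<gamma> e) (\<Phi> r (head G e)) (\<Phi> r (tail G e)))
        = (\<Prod>(r, e)\<in>copies p (arcs G). w (\<gamma> e) (\<Phi> r (head G e)) (\<Phi> r (tail G e)))"
      by (simp add: copies_def prod.cartesian_product)
    also have "\<dots> = (\<Prod>d\<in>copies p (arcs G). w (case d of (r, e) \<Rightarrow> \<gamma> e)
        (?\<Psi> (case d of (r, e) \<Rightarrow> (r, head G e))) (?\<Psi> (case d of (r, e) \<Rightarrow> (r, tail G e))))"
      by (intro prod.cong) (auto simp: joint_labelling_def copies_def)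
    also have "\<dots> \<le> saved_weight ?V ?\<Psi>"
    proof (rule prod_weight_le_saved_weight)
      fix d assume d: "d \<in> copies p (arcs G)" "\<not> diagonal (slot ?\<Psi> d)"
      obtain r e where re: "d = (r, e)" "r < p" "e \<in> arcs G" using d(1) by (auto simp: copies_def)
      have "\<not> diagonal (arc_slot G \<gamma> (\<Phi> r) e)"
        using d(2) re by (simp add: slot_joint_labelling)
      then obtain r' e' where "r' < p" "e' \<in> arcs G" "(r', e') \<noteq> (r, e)"
        "arc_slot G \<gamma> (\<Phi> r') e' = arc_slot G \<gamma> (\<Phi> r) e"
        using True re(2,3) unfolding contributing_def by blast
      then show "\<exists>d'\<in>copies p (arcs G). d' \<noteq> d \<and> slot ?\<Psi> d' = slot ?\<Psi> d"
        using re by (intro bexI[of _ "(r', e')"]) (auto simp: slot_joint_labelling copies_def)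
    qed
    also have "\<dots> \<le> (\<Sum>f\<in>gluings. ?g f ?\<Psi>)"
    proof -
      obtain f where f: "f \<in> gluings" "glued (glue_pairs f) ?V ?\<Psi>"
        using contributing_imp_glued[OF True] by auto
      have "?g f ?\<Psi> \<le> (\<Sum>f\<in>gluings. ?g f ?\<Psi>)"
        by (rule member_le_sum[OF f(1) _ finite_gluings]) (simp add: saved_weight_nonneg)
      then show ?thesis using f(2) by simp
    qed
    finally show ?thesis using True by simp
  qed (simp add: sum_nonneg saved_weight_nonneg)
  have bound: "(\<Sum>\<Psi>\<in>?V \<rightarrow>\<^sub>E T. ?g f \<Psi>) \<le> real (card T) ^ m * ?D ^ (p * card (verts G))"
    if f: "f \<in> gluings" for f
  proof -
    have fr: "fst (f r) < p \<and> fst (f r) \<noteq> r" "fst (snd (f r)) \<in> verts G" "snd (snd (f r)) \<in> verts G"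
      if "r < p" for r
      using PiE_mem[OF f[unfolded gluings_def], of r] that by auto
    obtain k where k: "2 * k \<le> p" "explored (glue_pairs f) ?V k"
      unfolding glue_pairs_def
      by (rule explored_copies[of "\<lambda>r. fst (f r)" "\<lambda>r. fst (snd (f r))" "\<lambda>r. snd (snd (f r))", OF fr])
    have "(\<Sum>\<Psi>\<in>?V \<rightarrow>\<^sub>E T. ?g f \<Psi>) \<le> real (card T) ^ k * ?D ^ (p * card (verts G))"
      using sum_saved_weight_le[OF k(2)] by (simp add: cardV)
    \<comment> \<open>There are at most half as many roots as copies, so \<open>k \<le> m\<close>;
      since \<open>T\<close> is nonempty, raising the exponent to \<open>m\<close> only enlarges the
      bound.\<close>
    also have "\<dots> \<le> real (card T) ^ m * ?D ^ (p * card (verts G))"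
      using k(1) p T C by (intro mult_right_mono power_increasing) (auto simp: Suc_le_eq card_gt_0_iff)
    finally show ?thesis .
  qed
  have "(\<Sum>\<Phi>\<in>?P. of_bool (contributing \<Phi>) *
           (\<Prod>r<p. \<Prod>e\<in>arcs G. w (\<gamma> e) (\<Phi> r (head G e)) (\<Phi> r (tail G e))))
      \<le> (\<Sum>\<Phi>\<in>?P. \<Sum>f\<in>gluings. ?g f (joint_labelling \<Phi>))"
    by (intro sum_mono each)
  also have "\<dots> = (\<Sum>f\<in>gluings. \<Sum>\<Phi>\<in>?P. ?g f (joint_labelling \<Phi>))" by (rule sum.swap)
  also have "\<dots> = (\<Sum>f\<in>gluings. \<Sum>\<Psi>\<in>joint_labelling ` ?P. ?g f \<Psi>)"
    by (simp add: sum.reindex[OF inj_on_joint_labelling])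
  also have "\<dots> \<le> (\<Sum>f\<in>gluings. \<Sum>\<Psi>\<in>?V \<rightarrow>\<^sub>E T. ?g f \<Psi>)"
    using T joint_labelling_PiE finite_V
    by (intro sum_mono sum_mono2 finite_PiE) (auto simp: saved_weight_nonneg)
  also have "\<dots> \<le> (\<Sum>f\<in>gluings. real (card T) ^ m * ?D ^ (p * card (verts G)))"
    by (intro sum_mono bound)
  finally show ?thesis by simp
qed

end

section \<open>The moment bound\<close>

text \<open>The matrices at a single \<open>n\<close>. Estimates are made here with explicit
  constants, so that their uniformity in \<open>n\<close> can be read off afterwards.\<close>

locale wigner_matrices = prob_space M for M :: "'w measure" +
  fixes I :: "'i set" and n :: nat and X :: "'i \<Rightarrow> 'w \<Rightarrow> cmatrix"
  assumes hermitian: "\<And>i \<omega>. i \<in> I \<Longrightarrow> \<omega> \<in> space M \<Longrightarrow> hermitian n (X i \<omega>)"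
    and indep_upper: "indep_vars (\<lambda>_. borel) (\<lambda>(i, j, k) \<omega>. X i \<omega> j k) (I \<times> upper_indices n)"
    and upper_moments: "\<And>i j k l. i \<in> I \<Longrightarrow> (j, k) \<in> upper_indices n \<Longrightarrow>
      integrable M (\<lambda>\<omega>. cmod (X i \<omega> j k) ^ l)"
    and mean_zero: "\<And>i j k. i \<in> I \<Longrightarrow> (j, k) \<in> upper_indices n \<Longrightarrow> j < k \<Longrightarrow>
      expectation (\<lambda>\<omega>. X i \<omega> j k) = 0"
    and variance_one: "\<And>i j k. i \<in> I \<Longrightarrow> (j, k) \<in> upper_indices n \<Longrightarrow> j < k \<Longrightarrow>
      expectation (\<lambda>\<omega>. (cmod (X i \<omega> j k))\<^sup>2) = 1"
begin

sublocale independent_entries M "I \<times> upper_indices n" "\<lambda>(i, j, k) \<omega>. X i \<omega> j k"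
  using indep_upper upper_moments by unfold_locales auto

lemma entry_eq_upper:
  assumes "i \<in> I" "\<omega> \<in> space M" "j \<in> {1..n}" "k \<in> {1..n}"
  shows "X i \<omega> j k = cnj_if (k < j) (X i \<omega> (min j k) (max j k))"
proof -
  have "X i \<omega> j k = cnj (X i \<omega> k j)"
    using hermitian[OF assms(1,2)] assms(3,4) unfolding hermitian_def by blast
  then show ?thesis by (cases "k < j") (simp_all add: cnj_if_def min_def max_def)
qed

lemma all_moments_matrix_entry:
  assumes "i \<in> I" "j \<in> {1..n}" "k \<in> {1..n}"
  shows "all_moments (\<lambda>\<omega>. X i \<omega> j k)"
proof -
  have "all_moments (\<lambda>\<omega>. cnj_if (k < j) ((\<lambda>(i, j, k) \<omega>. X i \<omega> j k) (i, min j k, max j k) \<omega>))"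
    using assms by (intro all_moments_cnj_if all_moments_entry) (auto simp: upper_indices_def)
  then show ?thesis
    using entry_eq_upper[OF assms(1) _ assms(2,3)]
    by (auto simp: all_moments_def cong: measurable_cong Bochner_Integration.integrable_cong)
qed

end

section \<open>Expansion of the moment over labellings\<close>

locale weighted_trace = wigner_matrices M I n X + copied_graph G \<gamma> "2 * m"
  for M :: "'w measure" and I :: "'i set" and n X
    and G :: "('v, 'e) pre_digraph" and \<gamma> :: "'e \<Rightarrow> 'i" and m +
  fixes w :: "'i \<Rightarrow> nat \<Rightarrow> nat \<Rightarrow> real"
  assumes labels: "\<gamma> \<in> arcs G \<rightarrow> I" and n_pos: "0 < n"
    and weight_nonneg: "\<And>i a b. 0 \<le> w i a b"
    and weight_le_1: "\<And>e a b. e \<in> arcs G \<Longrightarrow> w (\<gamma> e) a b \<le> 1"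
    and weight_sym: "\<And>i a b. w i a b = w i b a"
begin

definition normalized_trace :: "'w \<Rightarrow> complex" where
  "normalized_trace \<omega> = complex_of_real (1 / real n) *
     graph_trace G \<gamma> n (\<lambda>i a b. complex_of_real (w i a b) * X i \<omega> a b)"

definition labelling_weight :: "('v \<Rightarrow> nat) \<Rightarrow> real" where
  "labelling_weight \<phi> = (\<Prod>e\<in>arcs G. w (\<gamma> e) (\<phi> (head G e)) (\<phi> (tail G e)))"

text \<open>The second half of the copies carries the complex conjugate.\<close>

definition copy_monomial :: "nat \<Rightarrow> ('v \<Rightarrow> nat) \<Rightarrow> 'w \<Rightarrow> complex" where
  "copy_monomial r \<phi> \<omega> =
     (\<Prod>e\<in>arcs G. cnj_if ((m \<le> r) \<noteq> (\<phi> (tail G e) < \<phi> (head G e)))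
        ((\<lambda>(i, j, k) \<omega>. X i \<omega> j k) (arc_slot G \<gamma> \<phi> e) \<omega>))"

definition copy_centered :: "nat \<Rightarrow> ('v \<Rightarrow> nat) \<Rightarrow> 'w \<Rightarrow> complex" where
  "copy_centered r \<phi> \<omega> = copy_monomial r \<phi> \<omega> - expectation (copy_monomial r \<phi>)"

lemma arc_slot_in:
  assumes "\<phi> \<in> verts G \<rightarrow>\<^sub>E {1..n}" "e \<in> arcs G"
  shows "arc_slot G \<gamma> \<phi> e \<in> (\<gamma> ` arcs G) \<times> upper_indices n"
  using PiE_mem[OF assms(1) head_in_verts[OF assms(2)]] PiE_mem[OF assms(1) tail_in_verts[OF assms(2)]] assms(2)
  by (auto simp: arc_slot_def upper_indices_def)

lemma entry_products_labelling:
  assumes "\<Phi> \<in> {..<2 * m} \<rightarrow>\<^sub>E (verts G \<rightarrow>\<^sub>E {1..n})"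
  shows "entry_products M (I \<times> upper_indices n) (\<lambda>(i, j, k) \<omega>. X i \<omega> j k) {..<2 * m} (arcs G)
    (\<lambda>r. arc_slot G \<gamma> (\<Phi> r))"
  using arc_slot_in[OF PiE_mem[OF assms]] labels by unfold_locales fastforce+

text \<open>Conjugating twice gives back the entry, so the two reasons for conjugation combine by
  exclusive disjunction, written as \<open>\<noteq>\<close> in \<open>copy_monomial\<close>.\<close>

lemma copy_monomial_eq:
  assumes "\<phi> \<in> verts G \<rightarrow>\<^sub>E {1..n}" "\<omega> \<in> space M"
  shows "copy_monomial r \<phi> \<omega> =
    cnj_if (m \<le> r) (\<Prod>e\<in>arcs G. X (\<gamma> e) \<omega> (\<phi> (head G e)) (\<phi> (tail G e)))"
proof -
  have "(\<Prod>e\<in>arcs G. X (\<gamma> e) \<omega> (\<phi> (head G e)) (\<phi> (tail G e)))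
      = (\<Prod>e\<in>arcs G. cnj_if (\<phi> (tail G e) < \<phi> (head G e))
          ((\<lambda>(i, j, k) \<omega>. X i \<omega> j k) (arc_slot G \<gamma> \<phi> e) \<omega>))"
  proof (intro prod.cong refl)
    fix e assume e: "e \<in> arcs G"
    have "\<phi> (head G e) \<in> {1..n}" "\<phi> (tail G e) \<in> {1..n}" "\<gamma> e \<in> I"
      using assms(1) e labels by (auto simp: PiE_iff)
    then show "X (\<gamma> e) \<omega> (\<phi> (head G e)) (\<phi> (tail G e))
        = cnj_if (\<phi> (tail G e) < \<phi> (head G e)) ((\<lambda>(i, j, k) \<omega>. X i \<omega> j k) (arc_slot G \<gamma> \<phi> e) \<omega>)"
      using entry_eq_upper[OF _ assms(2)] by (simp add: arc_slot_def)
  qed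
  then show ?thesis
    by (auto simp: copy_monomial_def cnj_if_def intro!: prod.cong)
qed

lemma all_moments_copy_monomial:
  assumes "\<phi> \<in> verts G \<rightarrow>\<^sub>E {1..n}"
  shows "all_moments (copy_monomial r \<phi>)"
proof -
  have "all_moments (\<lambda>\<omega>. copy_monomial r \<phi> \<omega>)"
    unfolding copy_monomial_def using arc_slot_in[OF assms] labels
    by (intro all_moments_prod all_moments_cnj_if all_moments_entry) fastforce
  then show ?thesis by simp
qed

lemma normalized_trace_eq:
  assumes "\<omega> \<in> space M"
  shows "cnj_if (m \<le> r) (normalized_trace \<omega>) =
    complex_of_real (1 / real n) * (\<Sum>\<phi>\<in>verts G \<rightarrow>\<^sub>E {1..n}. complex_of_real (labelling_weight \<phi>) * copy_monomial r \<phi> \<omega>)"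
  using assms
  by (auto simp: normalized_trace_def graph_trace_def prod.distrib labelling_weight_def copy_monomial_eq
      cnj_if_def intro!: sum.cong)

lemma all_moments_normalized_trace: "all_moments normalized_trace"
proof -
  let ?f = "\<lambda>\<omega>. cnj_if (m \<le> m) (complex_of_real (1 / real n) * (\<Sum>\<phi>\<in>verts G \<rightarrow>\<^sub>E {1..n}. complex_of_real (labelling_weight \<phi>) * copy_monomial m \<phi> \<omega>))"
  have am: "all_moments ?f"
    by (intro all_moments_cnj_if all_moments_mult all_moments_const all_moments_sum all_moments_copy_monomial)
  have "normalized_trace \<omega> = ?f \<omega>" if "\<omega> \<in> space M" for \<omega>
    unfolding normalized_trace_eq[OF that, symmetric] by (simp add: cnj_if_def)
  then show ?thesis using am
    by (auto simp: all_moments_def cong: measurable_cong Bochner_Integration.integrable_cong)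
qed

lemma centered_trace_eq:
  assumes "\<omega> \<in> space M"
  shows "cnj_if (m \<le> r) (normalized_trace \<omega> - expectation normalized_trace) =
    complex_of_real (1 / real n) * (\<Sum>\<phi>\<in>verts G \<rightarrow>\<^sub>E {1..n}. complex_of_real (labelling_weight \<phi>) * copy_centered r \<phi> \<omega>)"
proof -
  have "cnj_if (m \<le> r) (expectation normalized_trace) = expectation (\<lambda>\<omega>. cnj_if (m \<le> r) (normalized_trace \<omega>))"
    using expectation_cnj_if all_moments_integrable[OF all_moments_normalized_trace] by simp
  also have "\<dots> = expectation (\<lambda>\<omega>. complex_of_real (1 / real n) *
      (\<Sum>\<phi>\<in>verts G \<rightarrow>\<^sub>E {1..n}. complex_of_real (labelling_weight \<phi>) * copy_monomial r \<phi> \<omega>))"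
    by (intro Bochner_Integration.integral_cong refl normalized_trace_eq)
  also have "\<dots> = complex_of_real (1 / real n) *
      (\<Sum>\<phi>\<in>verts G \<rightarrow>\<^sub>E {1..n}. complex_of_real (labelling_weight \<phi>) * expectation (copy_monomial r \<phi>))"
    using all_moments_integrable[OF all_moments_copy_monomial] by (simp add: Bochner_Integration.integral_sum)
  finally show ?thesis
    using normalized_trace_eq[OF assms, of r]
    by (simp add: cnj_if_def copy_centered_def sum_subtractf right_diff_distrib split: if_splits)
qed

lemma expectation_prod_copy_centered_zero:
  assumes \<Phi>: "\<Phi> \<in> {..<2 * m} \<rightarrow>\<^sub>E (verts G \<rightarrow>\<^sub>E {1..n})" and "\<not> contributing \<Phi>"
  shows "expectation (\<lambda>\<omega>. \<Prod>r<2 * m. copy_centered r (\<Phi> r) \<omega>) = 0"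
proof -
  interpret ep: entry_products M "I \<times> upper_indices n" "\<lambda>(i, j, k) \<omega>. X i \<omega> j k" "{..<2 * m}" "arcs G"
    "\<lambda>r. arc_slot G \<gamma> (\<Phi> r)" "\<lambda>r e. (m \<le> r) \<noteq> (\<Phi> r (tail G e) < \<Phi> r (head G e))"
    by (rule entry_products_labelling[OF \<Phi>])
  have mono: "ep.monomial r = copy_monomial r (\<Phi> r)" for r
    unfolding fun_eq_iff ep.monomial_def copy_monomial_def ep.entry_def by (intro allI refl)
  have cent: "ep.centered r = copy_centered r (\<Phi> r)" for r
    unfolding fun_eq_iff ep.centered_def copy_centered_def mono by (intro allI refl)
  have "expectation (\<lambda>\<omega>. \<Prod>r<2 * m. ep.centered r \<omega>) = 0"
    using assms(2) unfolding contributing_def de_Morgan_conj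
  proof
    assume "\<not> (\<forall>r<2 * m. \<exists>r'<2 * m. r' \<noteq> r \<and>
       (\<exists>e\<in>arcs G. \<exists>e'\<in>arcs G. arc_slot G \<gamma> (\<Phi> r') e' = arc_slot G \<gamma> (\<Phi> r) e))"
    then obtain r where r: "r < 2 * m"
      "\<And>r' e e'. r' < 2 * m \<Longrightarrow> r' \<noteq> r \<Longrightarrow> e \<in> arcs G \<Longrightarrow> e' \<in> arcs G \<Longrightarrow>
        arc_slot G \<gamma> (\<Phi> r') e' \<noteq> arc_slot G \<gamma> (\<Phi> r) e" by blast
    then show ?thesis by (intro ep.expectation_prod_unshared[of r]) auto
  next
    assume "\<not> (\<forall>r<2 * m. \<forall>e\<in>arcs G. \<not> diagonal (arc_slot G \<gamma> (\<Phi> r) e) \<longrightarrow>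
        (\<exists>r'<2 * m. \<exists>e'\<in>arcs G. (r', e') \<noteq> (r, e) \<and> arc_slot G \<gamma> (\<Phi> r') e' = arc_slot G \<gamma> (\<Phi> r) e))"
    then obtain r e where re: "r < 2 * m" "e \<in> arcs G" "\<not> diagonal (arc_slot G \<gamma> (\<Phi> r) e)"
      and single: "\<And>r' e'. r' < 2 * m \<Longrightarrow> e' \<in> arcs G \<Longrightarrow> (r', e') \<noteq> (r, e) \<Longrightarrow>
        arc_slot G \<gamma> (\<Phi> r') e' \<noteq> arc_slot G \<gamma> (\<Phi> r) e" by blast
    obtain i j k where ijk: "arc_slot G \<gamma> (\<Phi> r) e = (i, j, k)" by (rule prod_cases3)
    have "(i, j, k) \<in> I \<times> upper_indices n" using ep.key_in[of r e] re ijk by auto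
    \<comment> \<open>Upper indices satisfy \<open>j \<le> k\<close>, and a zero mean is known only
      off the diagonal.\<close>
    moreover have "j < k" using re(3) ijk calculation by (auto simp: diagonal_def upper_indices_def)
    ultimately have "expectation (\<lambda>\<omega>. X i \<omega> j k) = 0" using mean_zero by blast
    then show ?thesis
      using re single by (intro ep.expectation_prod_single[of r e]) (auto simp: ijk)
  qed
  then show ?thesis unfolding cent by simp
qed

lemma expectation_prod_copy_centered_le:
  fixes B D :: real
  assumes \<Phi>: "\<Phi> \<in> {..<2 * m} \<rightarrow>\<^sub>E (verts G \<rightarrow>\<^sub>E {1..n})" and "0 \<le> B"
    "\<And>i j k. i \<in> \<gamma> ` arcs G \<Longrightarrow> (j, k) \<in> upper_indices n \<Longrightarrow>
       expectation (\<lambda>\<omega>. cmod (X i \<omega> j k) ^ (2 * m * card (arcs G))) \<le> B"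
    "\<And>i j k. i \<in> \<gamma> ` arcs G \<Longrightarrow> (j, k) \<in> upper_indices n \<Longrightarrow>
       expectation (\<lambda>\<omega>. cmod (X i \<omega> j k) ^ card (arcs G)) \<le> B"
  defines "D \<equiv> 1 + card (arcs G) * B"
  shows "cmod (expectation (\<lambda>\<omega>. \<Prod>r<2 * m. copy_centered r (\<Phi> r) \<omega>))
    \<le> 1 + 2 * m * (2 ^ (2 * m) * (D + D ^ (2 * m)))"
proof -
  interpret ep: entry_products M "I \<times> upper_indices n" "\<lambda>(i, j, k) \<omega>. X i \<omega> j k" "{..<2 * m}" "arcs G"
    "\<lambda>r. arc_slot G \<gamma> (\<Phi> r)" "\<lambda>r e. (m \<le> r) \<noteq> (\<Phi> r (tail G e) < \<Phi> r (head G e))"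
    by (rule entry_products_labelling[OF \<Phi>])
  have mono: "ep.monomial r = copy_monomial r (\<Phi> r)" for r
    unfolding fun_eq_iff ep.monomial_def copy_monomial_def ep.entry_def by (intro allI refl)
  have cent: "ep.centered r = copy_centered r (\<Phi> r)" for r
    unfolding fun_eq_iff ep.centered_def copy_centered_def mono by (intro allI refl)
  have "cmod (expectation (\<lambda>\<omega>. \<Prod>r<2 * m. ep.centered r \<omega>))
      \<le> 1 + card {..<2 * m} * (2 ^ card {..<2 * m} * (D + D ^ card {..<2 * m}))"
    unfolding D_def
  proof (rule ep.expectation_prod_centered_le[where K' = "\<gamma> ` arcs G \<times> upper_indices n"])
    show "arc_slot G \<gamma> (\<Phi> r) ` arcs G \<subseteq> \<gamma> ` arcs G \<times> upper_indices n" if "r \<in> {..<2 * m}" for r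
      using arc_slot_in[OF PiE_mem[OF \<Phi> that]] by blast
  qed (use assms(2-4) in auto)
  then show ?thesis unfolding cent by simp
qed

text \<open>The normalization contributes \<open>n\<close> to the power \<open>- 2 * m\<close>, and
  the surviving labellings have total weight of order \<open>n\<close> to the power
  \<open>m\<close>.\<close>

lemma trace_moment_le:
  fixes B C D :: real
  assumes B: "0 \<le> B"
    "\<And>i j k. i \<in> \<gamma> ` arcs G \<Longrightarrow> (j, k) \<in> upper_indices n \<Longrightarrow>
       expectation (\<lambda>\<omega>. cmod (X i \<omega> j k) ^ (2 * m * card (arcs G))) \<le> B"
    "\<And>i j k. i \<in> \<gamma> ` arcs G \<Longrightarrow> (j, k) \<in> upper_indices n \<Longrightarrow>
       expectation (\<lambda>\<omega>. cmod (X i \<omega> j k) ^ card (arcs G)) \<le> B"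
    and C: "0 \<le> C" "\<And>e a. e \<in> arcs G \<Longrightarrow> a \<in> {1..n} \<Longrightarrow> (\<Sum>b\<in>{1..n}. (w (\<gamma> e) a b)\<^sup>2) \<le> C"
  defines "D \<equiv> 1 + card (arcs G) * B"
  shows "abs_central_moment M (2 * m) normalized_trace
    \<le> (1 + 2 * m * (2 ^ (2 * m) * (D + D ^ (2 * m)))) *
       (card gluings * ((2 * m) * card (verts G) + C + 1) ^ (2 * m * card (verts G))) * (1 / real n ^ m)"
proof -
  let ?Z = "\<lambda>\<omega>. normalized_trace \<omega> - expectation normalized_trace"
  let ?P = "{..<2 * m} \<rightarrow>\<^sub>E (verts G \<rightarrow>\<^sub>E {1..n})"
  let ?B = "1 + 2 * m * (2 ^ (2 * m) * (D + D ^ (2 * m)))"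
  let ?W = "\<lambda>\<Phi>. \<Prod>r<2 * m. labelling_weight (\<Phi> r)"
  let ?F = "\<lambda>\<Phi> \<omega>. \<Prod>r<2 * m. copy_centered r (\<Phi> r) \<omega>"
  have W_nonneg: "0 \<le> ?W \<Phi>" for \<Phi>
    by (intro prod_nonneg) (auto simp: labelling_weight_def intro!: prod_nonneg weight_nonneg)
  have expand: "complex_of_real (cmod (?Z \<omega>) ^ (2 * m))
     = (\<Sum>\<Phi>\<in>?P. complex_of_real ((1 / real n) ^ (2 * m) * ?W \<Phi>) * ?F \<Phi> \<omega>)" if \<omega>: "\<omega> \<in> space M" for \<omega>
  proof -
    have "complex_of_real (cmod (?Z \<omega>) ^ (2 * m)) = complex_of_real ((cmod (?Z \<omega>))\<^sup>2) ^ m"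
      by (simp add: power_mult)
    also have "\<dots> = (?Z \<omega> * cnj (?Z \<omega>)) ^ m"
      by (simp only: complex_norm_square)
    \<comment> \<open>One half of the factors is the centred trace and the other half its conjugate;
      this is why copies from \<open>m\<close> on are conjugated. The absolute value thereby becomes
      a polynomial that can be expanded.\<close>
    also have "\<dots> = (\<Prod>r<m. ?Z \<omega>) * (\<Prod>r=m..<2*m. cnj (?Z \<omega>))"
      by (simp add: power_mult_distrib)
    also have "\<dots> = (\<Prod>r<m. cnj_if (m \<le> r) (?Z \<omega>)) * (\<Prod>r=m..<2*m. cnj_if (m \<le> r) (?Z \<omega>))"
      by (intro arg_cong2[where f = "(*)"] prod.cong) (auto simp: cnj_if_def)
    also have "\<dots> = (\<Prod>r<2*m. cnj_if (m \<le> r) (?Z \<omega>))"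
      unfolding lessThan_atLeast0 by (rule prod.atLeastLessThan_concat) auto
    also have "\<dots> = (\<Prod>r<2*m. \<Sum>\<phi>\<in>verts G \<rightarrow>\<^sub>E {1..n}.
        complex_of_real (1 / real n) * (complex_of_real (labelling_weight \<phi>) * copy_centered r \<phi> \<omega>))"
      by (simp add: centered_trace_eq[OF \<omega>] sum_distrib_left)
    also have "\<dots> = (\<Sum>\<Phi>\<in>?P. \<Prod>r<2*m.
        complex_of_real (1 / real n) * (complex_of_real (labelling_weight (\<Phi> r)) * copy_centered r (\<Phi> r) \<omega>))"
      by (rule prod_sum_PiE) (auto intro!: finite_PiE)
    also have "\<dots> = (\<Sum>\<Phi>\<in>?P. complex_of_real ((1 / real n) ^ (2 * m) * ?W \<Phi>) * ?F \<Phi> \<omega>)"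
      by (intro sum.cong refl) (simp add: prod.distrib prod_dividef power_divide)
    finally show ?thesis .
  qed
  have F_int: "integrable M (?F \<Phi>)" if "\<Phi> \<in> ?P" for \<Phi>
  proof -
    have "all_moments (copy_centered r (\<Phi> r))" if "r < 2 * m" for r
      unfolding copy_centered_def using that \<open>\<Phi> \<in> ?P\<close>
      by (intro all_moments_diff all_moments_const all_moments_copy_monomial) auto
    then show ?thesis by (intro all_moments_integrable all_moments_prod) auto
  qed
  \<comment> \<open>A bound uniform over labellings separates the probability from the
    combinatorics: only the weights remain to be summed.\<close>
  have F_le: "cmod (expectation (?F \<Phi>)) \<le> of_bool (contributing \<Phi>) * ?B" if "\<Phi> \<in> ?P" for \<Phi>
    using expectation_prod_copy_centered_zero[OF that] expectation_prod_copy_centered_le[OF that B]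
    by (cases "contributing \<Phi>") (auto simp: D_def)
  have "complex_of_real (abs_central_moment M (2 * m) normalized_trace)
      = expectation (\<lambda>\<omega>. complex_of_real (cmod (?Z \<omega>) ^ (2 * m)))"
    unfolding abs_central_moment_def by (rule integral_complex_of_real[symmetric])
  also have "\<dots> = expectation (\<lambda>\<omega>. \<Sum>\<Phi>\<in>?P. complex_of_real ((1 / real n) ^ (2 * m) * ?W \<Phi>) * ?F \<Phi> \<omega>)"
    by (intro Bochner_Integration.integral_cong refl expand)
  also have "\<dots> = (\<Sum>\<Phi>\<in>?P. complex_of_real ((1 / real n) ^ (2 * m) * ?W \<Phi>) * expectation (?F \<Phi>))"
    using F_int by (simp add: Bochner_Integration.integral_sum)
  finally have eq: "complex_of_real (abs_central_moment M (2 * m) normalized_trace) = \<dots>" .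
  \<comment> \<open>The expansion is an identity between complex numbers, so the real moment is
    embedded before norms are taken termwise.\<close>
  have "abs_central_moment M (2 * m) normalized_trace
      \<le> cmod (complex_of_real (abs_central_moment M (2 * m) normalized_trace))" by simp
  also have "\<dots> \<le> (\<Sum>\<Phi>\<in>?P. cmod (complex_of_real ((1 / real n) ^ (2 * m) * ?W \<Phi>) * expectation (?F \<Phi>)))"
    unfolding eq by (rule norm_sum)
  also have "\<dots> = (\<Sum>\<Phi>\<in>?P. ((1 / real n) ^ (2 * m) * ?W \<Phi>) * cmod (expectation (?F \<Phi>)))"
    using W_nonneg by (intro sum.cong refl) (simp add: norm_mult del: of_real_mult)
  also have "\<dots> \<le> (\<Sum>\<Phi>\<in>?P. ((1 / real n) ^ (2 * m) * ?W \<Phi>) * (of_bool (contributing \<Phi>) * ?B))"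
    by (intro sum_mono mult_left_mono F_le mult_nonneg_nonneg W_nonneg) auto
  also have "\<dots> = (1 / real n) ^ (2 * m) * ?B * (\<Sum>\<Phi>\<in>?P. of_bool (contributing \<Phi>) * ?W \<Phi>)"
    unfolding sum_distrib_left by (intro sum.cong refl) (simp only: mult_ac)
  also have "\<dots> \<le> (1 / real n) ^ (2 * m) * ?B *
      (card gluings * (real (card {1..n}) ^ m * ((2 * m) * card (verts G) + C + 1) ^ (2 * m * card (verts G))))"
    unfolding labelling_weight_def
    using n_pos C B weight_nonneg weight_le_1 weight_sym
    by (intro mult_left_mono sum_contributing_le mult_nonneg_nonneg) (auto simp: D_def)
  also have "\<dots> = ?B * (card gluings * ((2 * m) * card (verts G) + C + 1) ^ (2 * m * card (verts G)))
      * ((1 / real n) ^ (2 * m) * real n ^ m)"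
    by (simp only: card_atLeastAtMost mult_ac) simp
  also have "(1 / real n) ^ (2 * m) * real n ^ m = 1 / real n ^ m"
    using n_pos by (simp add: power_divide mult_2 power_add)
  finally show ?thesis .
qed

end

section \<open>A lower bound for the variance\<close>

text \<open>A convex power lies above its tangent at \<open>a\<close>. Multiplying the induction
  hypothesis by \<open>x\<close> produces the next tangent up to a nonnegative multiple of
  \<open>(x - a)^2\<close>.\<close>

lemma power_ge_tangent:
  fixes x a :: real
  assumes "0 \<le> x" "0 \<le> a"
  shows "a ^ Suc m + real (Suc m) * a ^ m * (x - a) \<le> x ^ Suc m"
proof (induction m)
  case (Suc m)
  have "a ^ Suc (Suc m) + real (Suc (Suc m)) * a ^ Suc m * (x - a)
      = x * (a ^ Suc m + real (Suc m) * a ^ m * (x - a)) - real (Suc m) * a ^ m * (x - a)\<^sup>2"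
    by (simp add: algebra_simps power2_eq_square)
  also have "\<dots> \<le> x * (a ^ Suc m + real (Suc m) * a ^ m * (x - a))"
    using assms by simp
  also have "\<dots> \<le> x * x ^ Suc m"
    using assms(1) by (intro mult_left_mono Suc.IH)
  finally show ?case by simp
qed simp

text \<open>Jensen's inequality, by integrating the tangent at the mean: its linear part has
  expectation zero.\<close>

lemma (in prob_space) expectation_power_ge:
  fixes f :: "'a \<Rightarrow> real"
  assumes "\<And>\<omega>. 0 \<le> f \<omega>" "integrable M f" "integrable M (\<lambda>\<omega>. f \<omega> ^ m)" "m \<ge> 1"
  shows "(expectation f) ^ m \<le> expectation (\<lambda>\<omega>. f \<omega> ^ m)"
proof -
  obtain k where m: "m = Suc k" using assms(4) by (cases m) auto
  let ?a = "expectation f"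
  have a: "0 \<le> ?a" using assms(1) by simp
  have "?a ^ m = expectation (\<lambda>\<omega>. ?a ^ Suc k + real (Suc k) * ?a ^ k * (f \<omega> - ?a))"
    using assms(2) by (simp add: prob_space m)
  also have "\<dots> \<le> expectation (\<lambda>\<omega>. f \<omega> ^ m)"
    using assms(2,3) power_ge_tangent[OF assms(1) a] by (intro integral_mono) (auto simp: m)
  finally show ?thesis .
qed

section \<open>Wedges as an orthonormal system\<close>

context wigner_matrices
begin

lemma determined_matrix_entry:
  assumes "i \<in> I" "j \<in> {1..n}" "k \<in> {1..n}" "(i, min j k, max j k) \<in> A"
  shows "determined A (\<lambda>\<omega>. X i \<omega> j k)"
proof -
  have "determined A (\<lambda>\<omega>. cnj_if (k < j) ((\<lambda>(i, j, k) \<omega>. X i \<omega> j k) (i, min j k, max j k) \<omega>))"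
    using assms(4) by (intro determined_cnj_if determined_entry)
  then show ?thesis
    unfolding determined_def using entry_eq_upper[OF assms(1) _ assms(2,3)] by simp
qed

definition wedge :: "'i \<Rightarrow> nat \<times> nat \<times> nat \<Rightarrow> 'w \<Rightarrow> complex" where
  "wedge i = (\<lambda>(j, k, l) \<omega>. X i \<omega> k j * X i \<omega> l j)"

lemma all_moments_wedge:
  assumes "i \<in> I" "j \<in> {1..n}" "k \<in> {1..n}" "l \<in> {1..n}"
  shows "all_moments (wedge i (j, k, l))"
  unfolding wedge_def prod.case using assms by (intro all_moments_mult all_moments_matrix_entry)

lemma all_moments_cnj: "all_moments f \<Longrightarrow> all_moments (\<lambda>\<omega>. cnj (f \<omega>))"
  using all_moments_cnj_if[of f True] by (simp add: cnj_if_def)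

lemma determined_cnj: "determined A f \<Longrightarrow> determined A (\<lambda>\<omega>. cnj (f \<omega>))"
  using determined_cnj_if[of A f True] by (simp add: cnj_if_def)

text \<open>With \<open>j < k\<close>, conjugating the leg at \<open>k\<close> gives exactly the
  upper entry at \<open>(j, k)\<close>. Neither \<open>f\<close> nor the other leg involves this
  entry, the latter because \<open>k \<noteq> l\<close>, so it is a lone centred factor.\<close>

lemma expectation_wedge_zero:
  assumes "i \<in> I" "j \<in> {1..n}" "k \<in> {1..n}" "l \<in> {1..n}" "j < k" "j < l" "k \<noteq> l"
    and f: "all_moments f" "determined (I \<times> upper_indices n - {(i, j, k)}) f"
  shows "expectation (\<lambda>\<omega>. f \<omega> * cnj (wedge i (j, k, l) \<omega>)) = 0"
proof -
  let ?Y = "\<lambda>(i, j, k) \<omega>. X i \<omega> j k"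
  let ?g = "\<lambda>\<omega>. cnj (X i \<omega> l j) * f \<omega>"
  have "expectation (\<lambda>\<omega>. cnj_if False (?Y (i, j, k) \<omega>) * ?g \<omega>) = 0"
  proof (rule expectation_single_zero)
    show "(i, j, k) \<in> I \<times> upper_indices n" using assms by (auto simp: upper_indices_def)
    show "expectation (?Y (i, j, k)) = 0"
      unfolding prod.case using assms by (intro mean_zero) (auto simp: upper_indices_def)
    show "determined (I \<times> upper_indices n - {(i, j, k)}) ?g"
      using assms
      by (intro determined_mult determined_cnj determined_matrix_entry f)
        (auto simp: upper_indices_def min_def max_def)
    show "integrable M ?g"
      using assms by (intro all_moments_integrable all_moments_mult all_moments_cnj all_moments_matrix_entry f)
  qed
  moreover have "expectation (\<lambda>\<omega>. f \<omega> * cnj (wedge i (j, k, l) \<omega>))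
      = expectation (\<lambda>\<omega>. cnj_if False (?Y (i, j, k) \<omega>) * ?g \<omega>)"
  proof (intro Bochner_Integration.integral_cong refl)
    fix \<omega> assume "\<omega> \<in> space M"
    then show "f \<omega> * cnj (wedge i (j, k, l) \<omega>) = cnj_if False (?Y (i, j, k) \<omega>) * ?g \<omega>"
      using entry_eq_upper[OF assms(1) _ assms(3,2), of \<omega>] assms(5)
      by (simp add: wedge_def cnj_if_def min_def max_def)
  qed
  ultimately show ?thesis by simp
qed

lemma wedge_swap: "wedge i (j, k, l) = wedge i (j, l, k)"
  by (simp add: wedge_def fun_eq_iff)

lemma expectation_wedge_mean_zero:
  assumes "i \<in> I" "j \<in> {1..n}" "k \<in> {1..n}" "l \<in> {1..n}" "j < k" "j < l" "k \<noteq> l"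
  shows "expectation (\<lambda>\<omega>. cnj (wedge i (j, k, l) \<omega>)) = 0"
  using expectation_wedge_zero[OF assms all_moments_const[of 1] determined_const] by simp

text \<open>The legs are distinct entries, so the mean of the squared modulus factors into two
  variances.\<close>

lemma expectation_wedge_norm:
  assumes "i \<in> I" "j \<in> {1..n}" "k \<in> {1..n}" "l \<in> {1..n}" "j < k" "j < l" "k \<noteq> l"
  shows "expectation (\<lambda>\<omega>. wedge i (j, k, l) \<omega> * cnj (wedge i (j, k, l) \<omega>)) = 1"
proof -
  let ?sq = "\<lambda>a \<omega>. X i \<omega> a j * cnj (X i \<omega> a j)"
  have one: "expectation (?sq a) = 1" if "a \<in> {1..n}" "j < a" for a
  proof -
    have "expectation (?sq a) = expectation (\<lambda>\<omega>. complex_of_real ((cmod (X i \<omega> j a))\<^sup>2))"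
    proof (intro Bochner_Integration.integral_cong refl)
      fix \<omega> assume "\<omega> \<in> space M"
      then show "?sq a \<omega> = complex_of_real ((cmod (X i \<omega> j a))\<^sup>2)"
        unfolding complex_norm_square
        using entry_eq_upper[OF assms(1) _ that(1) assms(2), of \<omega>] that(2)
        by (simp add: cnj_if_def min_def max_def)
    qed
    also have "\<dots> = complex_of_real (expectation (\<lambda>\<omega>. (cmod (X i \<omega> j a))\<^sup>2))"
      by (rule integral_complex_of_real)
    also have "\<dots> = 1"
      using variance_one[OF assms(1), of j a] assms(2) that by (simp add: upper_indices_def)
    finally show ?thesis .
  qed
  have "expectation (\<lambda>\<omega>. wedge i (j, k, l) \<omega> * cnj (wedge i (j, k, l) \<omega>))
      = expectation (\<lambda>\<omega>. ?sq k \<omega> * ?sq l \<omega>)"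
    by (simp add: wedge_def mult_ac)
  also have "\<dots> = expectation (?sq k) * expectation (?sq l)"
    using assms
    by (intro expectation_mult[of "{(i, j, k)}" _ "{(i, j, l)}"] determined_mult determined_cnj
        determined_matrix_entry all_moments_integrable all_moments_mult all_moments_cnj
        all_moments_matrix_entry) (auto simp: upper_indices_def min_def max_def)
  finally show ?thesis using one assms by simp
qed

text \<open>A wedge is determined by its two edges, since its centre is their common endpoint.\<close>

lemma expectation_wedge_wedge:
  assumes "i \<in> I" "j \<in> {1..n}" "k \<in> {1..n}" "l \<in> {1..n}" "j < k" "j < l" "k \<noteq> l"
    and "a \<in> {1..n}" "b \<in> {1..n}" "c \<in> {1..n}"
  shows "expectation (\<lambda>\<omega>. wedge i (a, b, c) \<omega> * cnj (wedge i (j, k, l) \<omega>))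
    = of_bool ((a, b, c) = (j, k, l) \<or> (a, b, c) = (j, l, k))"
proof -
  let ?s = "\<lambda>x y. (i, min x y, max x y)"
  note am = all_moments_wedge[OF assms(1,8,9,10)]
  have det: "determined (I \<times> upper_indices n - {q}) (wedge i (a, b, c))"
    if "q \<noteq> ?s b a" "q \<noteq> ?s c a" for q
    unfolding wedge_def prod.case using assms that
    by (intro determined_mult determined_matrix_entry) (auto simp: upper_indices_def)
  \<comment> \<open>If the other wedge misses one of the two entries, that entry stands alone and
    the mean vanishes; otherwise both wedges consist of the same two entries.\<close>
  consider "(i, j, k) \<notin> {?s b a, ?s c a}" | "(i, j, l) \<notin> {?s b a, ?s c a}"
    | "(i, j, k) \<in> {?s b a, ?s c a}" "(i, j, l) \<in> {?s b a, ?s c a}" by blast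
  then show ?thesis
  proof cases
    case 1
    then have "(a, b, c) \<noteq> (j, k, l)" "(a, b, c) \<noteq> (j, l, k)"
      using assms by (auto simp: min_def max_def)
    then show ?thesis
      using expectation_wedge_zero[OF assms(1-7) am det] 1 by simp
  next
    case 2
    then have "(a, b, c) \<noteq> (j, k, l)" "(a, b, c) \<noteq> (j, l, k)"
      using assms by (auto simp: min_def max_def)
    moreover have "expectation (\<lambda>\<omega>. wedge i (a, b, c) \<omega> * cnj (wedge i (j, l, k) \<omega>)) = 0"
      using assms 2 by (intro expectation_wedge_zero am det) auto
    ultimately show ?thesis by (simp add: wedge_swap[of i j k l])
  next
    case 3
    have "(a, b, c) = (j, k, l) \<or> (a, b, c) = (j, l, k)"
      using 3 assms(5-7) by (auto simp: min_def max_def split: if_splits)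
    then show ?thesis
    proof
      assume "(a, b, c) = (j, k, l)"
      then show ?thesis using expectation_wedge_norm[OF assms(1-7)] by simp
    next
      assume "(a, b, c) = (j, l, k)"
      then show ?thesis using expectation_wedge_norm[OF assms(1-7)] by (simp add: wedge_swap[of i j l k])
    qed
  qed
qed

definition wedge_sum :: "(nat \<Rightarrow> nat \<Rightarrow> real) \<Rightarrow> 'i \<Rightarrow> (nat \<times> nat \<times> nat) set \<Rightarrow> 'w \<Rightarrow> complex" where
  "wedge_sum w i S \<omega> = (\<Sum>(j, k, l)\<in>S. complex_of_real (w k j * w l j) * wedge i (j, k, l) \<omega>)"

lemma all_moments_wedge_sum:
  assumes "i \<in> I" "S \<subseteq> {1..n} \<times> {1..n} \<times> {1..n}"
  shows "all_moments (wedge_sum w i S)"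
proof -
  have "all_moments (\<lambda>\<omega>. wedge_sum w i S \<omega>)"
    unfolding wedge_sum_def case_prod_beta using assms
    by (intro all_moments_sum all_moments_mult all_moments_const all_moments_wedge)
      (auto simp: prod.collapse intro: all_moments_wedge)
  then show ?thesis by simp
qed

text \<open>Only \<open>S'\<close> consists of ordered triples. A triple of \<open>S\<close> with
  its legs exchanged is the same random variable with the same weight, so it pairs with the ordered
  triple as well.\<close>

lemma expectation_wedge_sum_mult:
  fixes w :: "nat \<Rightarrow> nat \<Rightarrow> real"
  assumes i: "i \<in> I" and S: "S \<subseteq> {1..n} \<times> {1..n} \<times> {1..n}" "S' \<subseteq> {1..n} \<times> {1..n} \<times> {1..n}"
    and lt: "\<And>j k l. (j, k, l) \<in> S' \<Longrightarrow> j < k \<and> k < l"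
  shows "expectation (\<lambda>\<omega>. wedge_sum w i S \<omega> * cnj (wedge_sum w i S' \<omega>))
    = (\<Sum>(j, k, l)\<in>S'. \<Sum>t\<in>S. of_bool (t = (j, k, l) \<or> t = (j, l, k)) * complex_of_real ((w k j * w l j)\<^sup>2))"
proof -
  let ?q = "\<lambda>(j, k, l). w k j * w l j"
  have fin: "finite S" "finite S'" using S by (auto intro: finite_subset)
  have int: "integrable M (\<lambda>\<omega>. complex_of_real (?q t * ?q s) * (wedge i t \<omega> * cnj (wedge i s \<omega>)))"
    if "t \<in> S" "s \<in> S'" for s t
  proof -
    have "all_moments (wedge i t)" "all_moments (wedge i s)"
      using all_moments_wedge[OF i] that S by (cases t; cases s; blast)+
    then show ?thesis by (intro all_moments_integrable all_moments_mult all_moments_const all_moments_cnj)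
  qed
  have "expectation (\<lambda>\<omega>. wedge_sum w i S \<omega> * cnj (wedge_sum w i S' \<omega>))
     = expectation (\<lambda>\<omega>. \<Sum>s\<in>S'. \<Sum>t\<in>S. complex_of_real (?q t * ?q s) * (wedge i t \<omega> * cnj (wedge i s \<omega>)))"
  proof (intro Bochner_Integration.integral_cong refl)
    fix \<omega>
    have "wedge_sum w i S \<omega> * cnj (wedge_sum w i S' \<omega>)
      = (\<Sum>t\<in>S. complex_of_real (?q t) * wedge i t \<omega>) * (\<Sum>s\<in>S'. complex_of_real (?q s) * cnj (wedge i s \<omega>))"
      by (simp add: wedge_sum_def case_prod_beta)
    also have "\<dots> = (\<Sum>s\<in>S'. \<Sum>t\<in>S. (complex_of_real (?q t) * wedge i t \<omega>) * (complex_of_real (?q s) * cnj (wedge i s \<omega>)))"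
      by (subst sum_product) (rule sum.swap)
    finally show "wedge_sum w i S \<omega> * cnj (wedge_sum w i S' \<omega>)
      = (\<Sum>s\<in>S'. \<Sum>t\<in>S. complex_of_real (?q t * ?q s) * (wedge i t \<omega> * cnj (wedge i s \<omega>)))"
      by (simp add: mult_ac)
  qed
  also have "\<dots> = (\<Sum>s\<in>S'. expectation (\<lambda>\<omega>. \<Sum>t\<in>S. complex_of_real (?q t * ?q s) * (wedge i t \<omega> * cnj (wedge i s \<omega>))))"
    by (intro Bochner_Integration.integral_sum Bochner_Integration.integrable_sum int)
  also have "\<dots> = (\<Sum>s\<in>S'. \<Sum>t\<in>S. expectation (\<lambda>\<omega>. complex_of_real (?q t * ?q s) * (wedge i t \<omega> * cnj (wedge i s \<omega>))))"
    by (intro sum.cong refl Bochner_Integration.integral_sum int)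
  also have "\<dots> = (\<Sum>s\<in>S'. \<Sum>t\<in>S. complex_of_real (?q t * ?q s) * expectation (\<lambda>\<omega>. wedge i t \<omega> * cnj (wedge i s \<omega>)))"
    by (simp only: integral_mult_right_zero)
  also have "\<dots> = (\<Sum>(j, k, l)\<in>S'. \<Sum>t\<in>S. of_bool (t = (j, k, l) \<or> t = (j, l, k)) * complex_of_real ((w k j * w l j)\<^sup>2))"
  proof (rule sum.cong[OF refl])
    fix s assume s: "s \<in> S'"
    obtain j k l where jkl: "s = (j, k, l)" by (rule prod_cases3)
    have "complex_of_real (?q t * ?q s) * expectation (\<lambda>\<omega>. wedge i t \<omega> * cnj (wedge i s \<omega>))
        = of_bool (t = (j, k, l) \<or> t = (j, l, k)) * complex_of_real ((w k j * w l j)\<^sup>2)" if t: "t \<in> S" for t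
    proof -
      obtain a b c where abc: "t = (a, b, c)" by (rule prod_cases3)
      have mem: "j \<in> {1..n}" "k \<in> {1..n}" "l \<in> {1..n}" "a \<in> {1..n}" "b \<in> {1..n}" "c \<in> {1..n}"
        using s t S abc jkl by auto
      have "expectation (\<lambda>\<omega>. wedge i t \<omega> * cnj (wedge i s \<omega>)) = of_bool (t = (j, k, l) \<or> t = (j, l, k))"
        unfolding abc jkl using lt[of j k l] s jkl by (intro expectation_wedge_wedge i mem) auto
      then show ?thesis by (auto simp: power2_eq_square mult_ac jkl)
    qed
    then show "(\<Sum>t\<in>S. complex_of_real (?q t * ?q s) * expectation (\<lambda>\<omega>. wedge i t \<omega> * cnj (wedge i s \<omega>)))
      = (case s of (j, k, l) \<Rightarrow> \<Sum>t\<in>S. of_bool (t = (j, k, l) \<or> t = (j, l, k)) * complex_of_real ((w k j * w l j)\<^sup>2))"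
      unfolding jkl prod.case by (rule sum.cong[OF refl])
  qed
  finally show ?thesis .
qed

text \<open>Every wedge in \<open>S\<close> occurs twice in \<open>Z\<close>, so the claim amounts to \<open>\<bar>W - 2 U\<bar>\<^sup>2\<close> having
  nonnegative mean, where \<open>W\<close> is \<open>Z\<close> centred and \<open>U\<close> is the sum over \<open>S\<close>.\<close>

lemma wedge_sum_variance_ge:
  fixes w :: "nat \<Rightarrow> nat \<Rightarrow> real"
  assumes i: "i \<in> I" and S: "S \<subseteq> {1..n} \<times> {1..n} \<times> {1..n}"
    and lt: "\<And>j k l. (j, k, l) \<in> S \<Longrightarrow> j < k \<and> k < l"
  defines "Z \<equiv> wedge_sum w i ({1..n} \<times> {1..n} \<times> {1..n})"
  shows "4 * (\<Sum>(j, k, l)\<in>S. (w k j * w l j)\<^sup>2) \<le> abs_central_moment M 2 Z"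
proof -
  let ?N = "{1..n} \<times> {1..n} \<times> {1..n}"
  let ?\<sigma> = "\<Sum>(j, k, l)\<in>S. (w k j * w l j)\<^sup>2"
  let ?U = "wedge_sum w i S"
  let ?W = "\<lambda>\<omega>. Z \<omega> - expectation Z"
  have fin: "finite S" using S by (auto intro: finite_subset)
  have am: "all_moments Z" "all_moments ?U" "all_moments ?W"
    unfolding Z_def using S by (auto intro!: all_moments_wedge_sum i all_moments_diff all_moments_const)
  have int: "integrable M (\<lambda>\<omega>. ?W \<omega> * cnj (?U \<omega>))" "integrable M (\<lambda>\<omega>. Z \<omega> * cnj (?U \<omega>))"
    "integrable M (\<lambda>\<omega>. ?U \<omega> * cnj (?U \<omega>))" "integrable M (\<lambda>\<omega>. cnj (?U \<omega>))"
    by (intro all_moments_integrable all_moments_mult all_moments_cnj am)+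
  have int2: "integrable M (\<lambda>\<omega>. (cmod (?W \<omega>))\<^sup>2)" "integrable M (\<lambda>\<omega>. (cmod (?U \<omega>))\<^sup>2)"
    "integrable M (\<lambda>\<omega>. (cmod (?W \<omega> - 2 * ?U \<omega>))\<^sup>2)"
    by (intro all_moments_power all_moments_diff all_moments_mult all_moments_const am)+
  \<comment> \<open>As \<open>?U\<close> has mean zero, centring \<open>Z\<close> leaves its inner
    product with \<open>?U\<close> unchanged.\<close>
  have U_mean: "expectation (\<lambda>\<omega>. cnj (?U \<omega>)) = 0"
  proof -
    have zero: "expectation (\<lambda>\<omega>. cnj (wedge i t \<omega>)) = 0" "integrable M (\<lambda>\<omega>. cnj (wedge i t \<omega>))"
      if t: "t \<in> S" for t
    proof -
      obtain j k l where jkl: "t = (j, k, l)" by (rule prod_cases3)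
      then have mem: "j \<in> {1..n}" "k \<in> {1..n}" "l \<in> {1..n}" "j < k" "k < l" using t S lt by auto
      show "expectation (\<lambda>\<omega>. cnj (wedge i t \<omega>)) = 0"
        unfolding jkl using mem by (intro expectation_wedge_mean_zero i) auto
      show "integrable M (\<lambda>\<omega>. cnj (wedge i t \<omega>))"
        unfolding jkl using mem by (intro all_moments_integrable all_moments_cnj all_moments_wedge i)
    qed
    have "expectation (\<lambda>\<omega>. cnj (?U \<omega>)) = expectation (\<lambda>\<omega>. \<Sum>t\<in>S. complex_of_real (case t of (j, k, l) \<Rightarrow> w k j * w l j) * cnj (wedge i t \<omega>))"
      by (simp add: wedge_sum_def case_prod_beta)
    also have "\<dots> = 0" using zero by (subst Bochner_Integration.integral_sum) auto
    finally show ?thesis .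
  qed
  have ZU: "expectation (\<lambda>\<omega>. Z \<omega> * cnj (?U \<omega>)) = complex_of_real (2 * ?\<sigma>)"
  proof -
    have "expectation (\<lambda>\<omega>. Z \<omega> * cnj (?U \<omega>))
      = (\<Sum>(j, k, l)\<in>S. \<Sum>t\<in>?N. of_bool (t = (j, k, l) \<or> t = (j, l, k)) * complex_of_real ((w k j * w l j)\<^sup>2))"
      unfolding Z_def by (rule expectation_wedge_sum_mult[OF i order.refl S lt])
    also have "\<dots> = (\<Sum>(j, k, l)\<in>S. complex_of_real (2 * (w k j * w l j)\<^sup>2))"
    proof (intro sum.cong refl, clarify)
      fix j k l assume s: "(j, k, l) \<in> S"
      have "(\<Sum>t\<in>?N. of_bool (t = (j, k, l) \<or> t = (j, l, k)) :: complex)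
          = of_nat (card {t \<in> ?N. t = (j, k, l) \<or> t = (j, l, k)})" by (simp add: Int_def)
      also have "{t \<in> ?N. t = (j, k, l) \<or> t = (j, l, k)} = {(j, k, l), (j, l, k)}"
        using s S by auto
      also have "card \<dots> = 2" using lt[OF s] by simp
      finally have "(\<Sum>t\<in>?N. of_bool (t = (j, k, l) \<or> t = (j, l, k)) :: complex) = 2" by simp
      then show "(\<Sum>t\<in>?N. of_bool (t = (j, k, l) \<or> t = (j, l, k)) * complex_of_real ((w k j * w l j)\<^sup>2))
          = complex_of_real (2 * (w k j * w l j)\<^sup>2)"
        unfolding sum_distrib_right[symmetric] by simp
    qed
    finally show ?thesis by (simp add: case_prod_beta sum_distrib_left)
  qed
  have UU: "expectation (\<lambda>\<omega>. ?U \<omega> * cnj (?U \<omega>)) = complex_of_real ?\<sigma>"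
  proof -
    have "expectation (\<lambda>\<omega>. ?U \<omega> * cnj (?U \<omega>))
      = (\<Sum>(j, k, l)\<in>S. \<Sum>t\<in>S. of_bool (t = (j, k, l) \<or> t = (j, l, k)) * complex_of_real ((w k j * w l j)\<^sup>2))"
      by (rule expectation_wedge_sum_mult[OF i S S lt])
    also have "\<dots> = (\<Sum>(j, k, l)\<in>S. complex_of_real ((w k j * w l j)\<^sup>2))"
    proof (intro sum.cong refl, clarify)
      fix j k l assume s: "(j, k, l) \<in> S"
      have "(\<Sum>t\<in>S. of_bool (t = (j, k, l) \<or> t = (j, l, k)) :: complex)
          = of_nat (card {t \<in> S. t = (j, k, l) \<or> t = (j, l, k)})" using fin by (simp add: Int_def)
      \<comment> \<open>Triples in \<open>S\<close> satisfy \<open>k < l\<close>, so the exchanged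
        triple is absent, in contrast to the sum over all triples.\<close>
      also have "{t \<in> S. t = (j, k, l) \<or> t = (j, l, k)} = {(j, k, l)}"
        using s lt[OF s] lt[of j l k] by auto
      finally have "(\<Sum>t\<in>S. of_bool (t = (j, k, l) \<or> t = (j, l, k)) :: complex) = 1" by simp
      then show "(\<Sum>t\<in>S. of_bool (t = (j, k, l) \<or> t = (j, l, k)) * complex_of_real ((w k j * w l j)\<^sup>2))
          = complex_of_real ((w k j * w l j)\<^sup>2)"
        unfolding sum_distrib_right[symmetric] by simp
    qed
    finally show ?thesis by (simp add: case_prod_beta)
  qed
  have WU: "expectation (\<lambda>\<omega>. ?W \<omega> * cnj (?U \<omega>)) = complex_of_real (2 * ?\<sigma>)"
    using int U_mean by (simp add: left_diff_distrib ZU[simplified])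
  have "expectation (\<lambda>\<omega>. Re (?W \<omega> * cnj (?U \<omega>))) = Re (expectation (\<lambda>\<omega>. ?W \<omega> * cnj (?U \<omega>)))"
    by (rule integral_Re[OF int(1)])
  then have re: "expectation (\<lambda>\<omega>. Re (?W \<omega> * cnj (?U \<omega>))) = 2 * ?\<sigma>" unfolding WU by simp
  have "complex_of_real (expectation (\<lambda>\<omega>. (cmod (?U \<omega>))\<^sup>2)) = complex_of_real ?\<sigma>"
    unfolding integral_complex_of_real[symmetric] complex_norm_square UU ..
  then have U2: "expectation (\<lambda>\<omega>. (cmod (?U \<omega>))\<^sup>2) = ?\<sigma>" by (rule of_real_eq_iff[THEN iffD1])
  have comb: "expectation (\<lambda>\<omega>. f \<omega> - 4 * g \<omega> + 4 * h \<omega>) = expectation f - 4 * expectation g + 4 * expectation h"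
    if "integrable M f" "integrable M g" "integrable M h" for f g h :: "'w \<Rightarrow> real"
    using that by simp
  \<comment> \<open>The coefficient 2 is the inner product of \<open>?W\<close> and
    \<open>?U\<close> divided by the squared norm of \<open>?U\<close>, as in an orthogonal
    projection. The mixed term contributes \<open>- 8\<close> and the last one \<open>+ 4\<close>
    times \<open>?\<sigma>\<close>.\<close>
  have "0 \<le> expectation (\<lambda>\<omega>. (cmod (?W \<omega> - 2 * ?U \<omega>))\<^sup>2)" by simp
  also have "\<dots> = expectation (\<lambda>\<omega>. (cmod (?W \<omega>))\<^sup>2 - 4 * Re (?W \<omega> * cnj (?U \<omega>)) + 4 * (cmod (?U \<omega>))\<^sup>2)"
  proof (intro Bochner_Integration.integral_cong refl)
    have "(cmod (x - 2 * y))\<^sup>2 = (cmod x)\<^sup>2 - 4 * Re (x * cnj y) + 4 * (cmod y)\<^sup>2" for x y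
      unfolding cmod_power2 by (simp add: power2_eq_square algebra_simps)
    then show "(cmod (?W \<omega> - 2 * ?U \<omega>))\<^sup>2 = (cmod (?W \<omega>))\<^sup>2 - 4 * Re (?W \<omega> * cnj (?U \<omega>)) + 4 * (cmod (?U \<omega>))\<^sup>2" for \<omega> .
  qed
  also have "\<dots> = expectation (\<lambda>\<omega>. (cmod (?W \<omega>))\<^sup>2) - 4 * expectation (\<lambda>\<omega>. Re (?W \<omega> * cnj (?U \<omega>)))
      + 4 * expectation (\<lambda>\<omega>. (cmod (?U \<omega>))\<^sup>2)"
    by (rule comb[OF int2(1) integrable_Re[OF int(1)] int2(2)])
  finally show ?thesis unfolding re U2 abs_central_moment_def by simp
qed

end

section \<open>Band weights\<close>

text \<open>Rounding down loses at most a factor 2 once the quotient is at least 1.\<close>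

lemma half_le_div:
  fixes x q :: nat
  assumes "1 \<le> q" "q \<le> x"
  shows "real x / (2 * real q) \<le> real (x div q)"
proof -
  have "1 \<le> x div q" using assms by (simp add: Suc_le_eq div_greater_zero_iff)
  then have "q \<le> x div q * q" by simp
  moreover have "x = x div q * q + x mod q" by simp
  moreover have "x mod q < q" using assms by simp
  ultimately have "x \<le> 2 * q * (x div q)" by (simp only: mult_ac)
  then have "real x \<le> 2 * real q * real (x div q)" by (metis of_nat_le_iff of_nat_mult of_nat_numeral)
  then show ?thesis using assms by (simp add: field_simps)
qed

locale mixed_band_widths =
  fixes I1 I2 I3 I4 :: "'i set" and c :: "'i \<Rightarrow> real" and b :: "'i \<Rightarrow> nat \<Rightarrow> nat"
  assumes disjoint: "I1 \<inter> I2 = {}" "(I1 \<union> I2) \<inter> I3 = {}" "(I1 \<union> I2 \<union> I3) \<inter> I4 = {}"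
    and periodic: "\<And>i. i \<in> I1 \<Longrightarrow> filterlim (b i) at_top at_top"
    and slow: "\<And>i. i \<in> I2 \<Longrightarrow> slow_growth (b i)"
    and full: "\<And>i. i \<in> I3 \<Longrightarrow> proportional_growth (b i) 1"
    and proper: "\<And>i. i \<in> I4 \<Longrightarrow> c i < 1 \<and> proportional_growth (b i) (c i)"
begin

text \<open>For full proportion the constant is 1 by definition, and the values of \<open>c\<close>
  at such labels are unconstrained.\<close>

definition proportion :: "'i \<Rightarrow> real" where
  "proportion i = (if i \<in> I3 then 1 else c i)"

text \<open>The absolute value matters only for labels outside of the index set.\<close>

definition band_factor :: "nat \<Rightarrow> 'i \<Rightarrow> real" where
  "band_factor n i = (if i \<in> I1 \<union> I2 then 1 / sqrt (2 * real (b i n))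
     else 1 / (sqrt \<bar>2 * proportion i - (proportion i)\<^sup>2\<bar> * sqrt (real n)))"

definition in_band :: "nat \<Rightarrow> 'i \<Rightarrow> nat \<Rightarrow> nat \<Rightarrow> bool" where
  "in_band n i j k \<longleftrightarrow>
     (if i \<in> I1 then periodic_dist n j k else \<bar>int j - int k\<bar>) \<le> int (b i n)"

definition band_weight :: "nat \<Rightarrow> 'i \<Rightarrow> nat \<Rightarrow> nat \<Rightarrow> real" where
  "band_weight n i j k = (if in_band n i j k then band_factor n i else 0)"

lemma band_factor_nonneg: "0 \<le> band_factor n i"
  by (simp add: band_factor_def)

lemma band_weight_nonneg: "0 \<le> band_weight n i j k"
  by (simp add: band_weight_def band_factor_nonneg)

lemma band_weight_le: "band_weight n i j k \<le> band_factor n i"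
  by (simp add: band_weight_def band_factor_nonneg)

lemma band_weight_sym: "band_weight n i j k = band_weight n i k j"
  by (simp add: band_weight_def in_band_def periodic_dist_def abs_minus_commute)

lemma proportional:
  assumes "i \<in> I3 \<union> I4"
  shows "i \<notin> I1 \<union> I2" "0 < proportion i" "proportion i \<le> 1"
    "(\<lambda>n. real (b i n) / real n) \<longlonglongrightarrow> proportion i" "0 < 2 * proportion i - (proportion i)\<^sup>2"
proof -
  show "i \<notin> I1 \<union> I2" using assms disjoint by auto
  have *: "proportional_growth (b i) (proportion i)"
    using assms disjoint full[of i] proper[of i] by (auto simp: proportion_def)
  then show p: "0 < proportion i" "proportion i \<le> 1"
    and "(\<lambda>n. real (b i n) / real n) \<longlonglongrightarrow> proportion i"
    by (auto simp: proportional_growth_def)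
  have "0 < proportion i * (2 - proportion i)" using p by (intro mult_pos_pos) auto
  then show "0 < 2 * proportion i - (proportion i)\<^sup>2" by (simp add: algebra_simps power2_eq_square)
qed

text \<open>Brings all kinds of bands into the common form of a real symmetric weight times a Wigner
  entry, which the moment bound is stated for.\<close>

lemma mixed_band_family_eq:
  assumes "i \<in> I1 \<union> I2 \<union> I3 \<union> I4"
  shows "mixed_band_family I1 I2 I3 c b X n i \<omega> j k = complex_of_real (band_weight n i j k) * X n i \<omega> j k"
  using assms disjoint proportional[of i]
  by (auto simp: mixed_band_family_def periodic_band_matrix_def slow_band_matrix_def
      proportional_band_matrix_def band_matrix_def band_weight_def in_band_def band_factor_def proportion_def)

lemma width_at_top:
  assumes "i \<in> I1 \<union> I2"
  shows "filterlim (b i) at_top sequentially"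
  using assms periodic slow by (auto simp: slow_growth_def)

lemma eventually_band_factor_le_1:
  assumes "i \<in> I1 \<union> I2 \<union> I3 \<union> I4"
  shows "eventually (\<lambda>n. band_factor n i \<le> 1) sequentially"
proof (cases "i \<in> I1 \<union> I2")
  case True
  have "eventually (\<lambda>n. 1 \<le> b i n) sequentially"
    using width_at_top[OF True] by (simp add: filterlim_at_top)
  then show ?thesis
  proof eventually_elim
    case (elim n)
    have "1 \<le> sqrt (2 * real (b i n))" using elim by (intro real_le_rsqrt) simp
    then show ?case using True by (simp add: band_factor_def)
  qed
next
  case False
  define \<delta> where "\<delta> = 2 * proportion i - (proportion i)\<^sup>2"
  have \<delta>: "0 < \<delta>" unfolding \<delta>_def using proportional[of i] assms False by auto
  have "eventually (\<lambda>n. 1 / \<delta> \<le> real n) sequentially"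
    using filterlim_real_sequentially by (simp add: filterlim_at_top)
  then show ?thesis
  proof eventually_elim
    case (elim n)
    then have "1 \<le> \<delta> * real n" using \<delta> by (simp add: field_simps)
    then have "1 \<le> sqrt (\<delta> * real n)" by (intro real_le_rsqrt) simp
    then show ?case using False \<delta> by (simp add: band_factor_def \<delta>_def real_sqrt_mult)
  qed
qed

text \<open>The window around \<open>j\<close> has at most \<open>2 * b i n + 1\<close> members, and
  each of the two windows wrapped around the ends at most \<open>b i n\<close>. The width being
  positive, the total is at most \<open>5 * b i n\<close>, also for widths exceeding
  \<open>n\<close>.\<close>

lemma card_in_band_le:
  assumes "1 \<le> b i n" "j \<in> {1..n}"
  shows "card {k \<in> {1..n}. in_band n i j k} \<le> 5 * b i n"
proof -
  let ?b = "b i n"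
  have "{k \<in> {1..n}. in_band n i j k} \<subseteq> {j - ?b..j + ?b} \<union> ({j + n - ?b..n} \<union> {1..j + ?b - n})"
    using assms by (auto simp: in_band_def periodic_dist_def min_def split: if_splits)
  then have "card {k \<in> {1..n}. in_band n i j k}
      \<le> card ({j - ?b..j + ?b} \<union> ({j + n - ?b..n} \<union> {1..j + ?b - n}))"
    by (intro card_mono) auto
  also have "\<dots> \<le> card {j - ?b..j + ?b} + (card {j + n - ?b..n} + card {1..j + ?b - n})"
    by (intro order.trans[OF card_Un_le] add_left_mono card_Un_le)
  also have "\<dots> \<le> 5 * ?b" using assms by simp arith
  finally show ?thesis .
qed

text \<open>The normalization compensates the number of entries in a row of the band: for periodic
  and slow bands this number is of the order of the width, and for proportional ones the trivial
  bound \<open>n\<close> suffices.\<close>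

lemma eventually_band_weight_sum_le:
  assumes "i \<in> I1 \<union> I2 \<union> I3 \<union> I4"
  shows "\<exists>C\<ge>0. eventually (\<lambda>n. \<forall>j\<in>{1..n}. (\<Sum>k\<in>{1..n}. (band_weight n i j k)\<^sup>2) \<le> C) sequentially"
proof -
  have sum_eq: "(\<Sum>k\<in>{1..n}. (band_weight n i j k)\<^sup>2)
      = (band_factor n i)\<^sup>2 * card {k \<in> {1..n}. in_band n i j k}" for n j
  proof -
    have "(\<Sum>k\<in>{1..n}. (band_weight n i j k)\<^sup>2) = (\<Sum>k\<in>{k \<in> {1..n}. in_band n i j k}. (band_factor n i)\<^sup>2)"
      by (rule sum.mono_neutral_cong_right) (auto simp: band_weight_def)
    then show ?thesis by simp
  qed
  show ?thesis
  proof (cases "i \<in> I1 \<union> I2")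
    case True
    have "eventually (\<lambda>n. 1 \<le> b i n) sequentially"
      using width_at_top[OF True] by (simp add: filterlim_at_top)
    then have "eventually (\<lambda>n. \<forall>j\<in>{1..n}. (\<Sum>k\<in>{1..n}. (band_weight n i j k)\<^sup>2) \<le> 5 / 2) sequentially"
    proof eventually_elim
      case (elim n)
      show ?case
      proof
        fix j assume j: "j \<in> {1..n}"
        have "(\<Sum>k\<in>{1..n}. (band_weight n i j k)\<^sup>2) \<le> (band_factor n i)\<^sup>2 * (5 * b i n)"
          unfolding sum_eq using card_in_band_le[OF elim j] by (intro mult_left_mono) auto
        also have "\<dots> = 5 / 2"
          using True elim by (simp add: band_factor_def power_divide)
        finally show "(\<Sum>k\<in>{1..n}. (band_weight n i j k)\<^sup>2) \<le> 5 / 2" .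
      qed
    qed
    then show ?thesis by (intro exI[of _ "5 / 2"]) simp
  next
    case False
    define \<delta> where "\<delta> = 2 * proportion i - (proportion i)\<^sup>2"
    have \<delta>: "0 < \<delta>" unfolding \<delta>_def using proportional[of i] assms False by auto
    have "(\<Sum>k\<in>{1..n}. (band_weight n i j k)\<^sup>2) \<le> 1 / \<delta>" if "j \<in> {1..n}" for n j
    proof -
      have "card {k \<in> {1..n}. in_band n i j k} \<le> card {1..n}" by (intro card_mono) auto
      then have "(\<Sum>k\<in>{1..n}. (band_weight n i j k)\<^sup>2) \<le> (band_factor n i)\<^sup>2 * n"
        unfolding sum_eq by (intro mult_left_mono) auto
      also have "\<dots> = 1 / \<delta>"
        using False \<delta> that by (simp add: band_factor_def \<delta>_def[symmetric] power_divide power_mult_distrib)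
      finally show ?thesis .
    qed
    then show ?thesis using \<delta> by (intro exI[of _ "1 / \<delta>"]) simp
  qed
qed

text \<open>Provides one parametrization for all kinds of bands. \<open>A\<close> is a natural
  number because the width is later divided by \<open>4 * A\<close>. The product bounded by
  \<open>\<kappa>\<close> is eventually 1/2 for periodic and slow bands, and for proportional ones
  it tends to the proportion divided by the constant of the normalization.\<close>

lemma width_linear:
  assumes i: "i \<in> I1 \<union> I2 \<union> I3 \<union> I4" and lin: "i \<in> I1 \<longrightarrow> (\<lambda>n. real (b i n)) \<in> O(\<lambda>n. real n)"
  obtains A :: nat and \<kappa> :: real where "1 \<le> A" "0 < \<kappa>"
    "eventually (\<lambda>n. b i n \<le> A * n) sequentially"
    "eventually (\<lambda>n. \<kappa> \<le> (band_factor n i)\<^sup>2 * b i n) sequentially"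
    "filterlim (b i) at_top sequentially"
proof (cases "i \<in> I1 \<union> I2")
  case True
  have O: "(\<lambda>n. real (b i n)) \<in> O(\<lambda>n. real n)"
  proof (cases "i \<in> I1")
    case False
    then have "(\<lambda>n. real (b i n)) \<in> o(\<lambda>n. real n)" using True slow by (auto simp: slow_growth_def)
    then show ?thesis by (rule landau_o.small_imp_big)
  qed (use lin in simp)
  then obtain a where a: "a > 0" "eventually (\<lambda>n. norm (real (b i n)) \<le> a * norm (real n)) sequentially"
    by (rule landau_o.bigE)
  define A where "A = nat \<lceil>a\<rceil>"
  have aA: "a \<le> real A" "1 \<le> A" using a(1) by (auto simp: A_def of_nat_ceiling) linarith
  have "eventually (\<lambda>n. b i n \<le> A * n) sequentially"
    using a(2)
  proof eventually_elim
    case (elim n)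
    have "real (b i n) \<le> a * real n" using elim by simp
    also have "\<dots> \<le> real A * real n" using aA by (intro mult_right_mono) auto
    finally have "real (b i n) \<le> real (A * n)" by simp
    then show ?case by (simp only: of_nat_le_iff)
  qed
  moreover have "eventually (\<lambda>n. 1 \<le> b i n) sequentially"
    using width_at_top[OF True] by (simp add: filterlim_at_top)
  then have "eventually (\<lambda>n. 1 / 2 \<le> (band_factor n i)\<^sup>2 * b i n) sequentially"
    by eventually_elim (use True in \<open>simp add: band_factor_def power_divide\<close>)
  ultimately show ?thesis using that[of A "1 / 2"] aA width_at_top[OF True] by simp
next
  case False
  then have i34: "i \<in> I3 \<union> I4" using i by auto
  note p = proportional[OF i34]
  define \<delta> where "\<delta> = 2 * proportion i - (proportion i)\<^sup>2"
  have \<delta>: "0 < \<delta>" unfolding \<delta>_def by (rule p)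
  \<comment> \<open>The limit lies in the interval from 0 (excluded) to 1, so half of it and 2 bound
    the ratio with room to spare.\<close>
  have ev: "eventually (\<lambda>n. proportion i / 2 < real (b i n) / real n \<and> real (b i n) / real n < 2 \<and> 0 < n) sequentially"
    using order_tendstoD(1)[OF p(4), of "proportion i / 2"] order_tendstoD(2)[OF p(4), of 2] p(2,3)
    by (intro eventually_conj eventually_gt_at_top) auto
  have "eventually (\<lambda>n. b i n \<le> 2 * n) sequentially"
    using ev
  proof eventually_elim
    case (elim n)
    then have "0 < real n" "real (b i n) / real n < 2" by auto
    then have "real (b i n) < 2 * real n" by (simp only: pos_divide_less_eq)
    then show ?case by linarith
  qed
  moreover have "eventually (\<lambda>n. proportion i / (2 * \<delta>) \<le> (band_factor n i)\<^sup>2 * b i n) sequentially"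
    using ev
  proof eventually_elim
    case (elim n)
    have "(band_factor n i)\<^sup>2 * b i n = (real (b i n) / real n) / \<delta>"
      using False \<delta> elim by (simp add: band_factor_def \<delta>_def[symmetric] power_divide power_mult_distrib)
    moreover have "(proportion i / 2) / \<delta> \<le> (real (b i n) / real n) / \<delta>"
      using elim \<delta> by (intro divide_right_mono) auto
    ultimately show ?case by simp
  qed
  moreover have "filterlim (\<lambda>n. real (b i n)) at_top sequentially"
  proof (rule filterlim_at_top_mono)
    show "filterlim (\<lambda>n. proportion i / 2 * real n) at_top sequentially"
      using p(2) by (intro filterlim_tendsto_pos_mult_at_top[OF tendsto_const] filterlim_real_sequentially) auto
    show "eventually (\<lambda>n. proportion i / 2 * real n \<le> real (b i n)) sequentially"
      using ev by eventually_elim (auto simp: field_simps)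
  qed
  then have "filterlim (b i) at_top sequentially"
    unfolding filterlim_at_top by (metis (mono_tags, lifting) eventually_mono of_nat_le_iff)
  ultimately show ?thesis using that[of 2 "proportion i / (2 * \<delta>)"] p(2) \<delta> by simp
qed

text \<open>The wedges \<open>(j, k, l)\<close> with \<open>j < k \<le> j + D < l \<le> j + 2 D\<close> for \<open>D\<close> of the order of the
  band width suffice: there are about \<open>n D\<^sup>2\<close> of them, each of squared weight about \<open>1 / D\<^sup>2\<close>.\<close>

lemma eventually_wedge_weight_ge:
  assumes i: "i \<in> I1 \<union> I2 \<union> I3 \<union> I4" and lin: "i \<in> I1 \<longrightarrow> (\<lambda>n. real (b i n)) \<in> O(\<lambda>n. real n)"
  obtains \<epsilon> where "0 < \<epsilon>" "eventually (\<lambda>n. \<exists>S \<subseteq> {1..n} \<times> {1..n} \<times> {1..n}.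
      (\<forall>(j, k, l)\<in>S. j < k \<and> k < l) \<and>
      \<epsilon> * real n \<le> (\<Sum>(j, k, l)\<in>S. (band_weight n i k j * band_weight n i l j)\<^sup>2)) sequentially"
proof -
  obtain A :: nat and \<kappa> :: real where A: "1 \<le> A" "0 < \<kappa>"
    "eventually (\<lambda>n. b i n \<le> A * n) sequentially"
    "eventually (\<lambda>n. \<kappa> \<le> (band_factor n i)\<^sup>2 * b i n) sequentially"
    "filterlim (b i) at_top sequentially"
    using width_linear[OF i lin] by blast
  have "eventually (\<lambda>n. 4 * A \<le> b i n) sequentially"
    using A(5) by (simp add: filterlim_at_top)
  with A(3,4) have "eventually (\<lambda>n. \<exists>S \<subseteq> {1..n} \<times> {1..n} \<times> {1..n}.
      (\<forall>(j, k, l)\<in>S. j < k \<and> k < l) \<and>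
      \<kappa>\<^sup>2 / (128 * (real A)\<^sup>2) * real n \<le> (\<Sum>(j, k, l)\<in>S. (band_weight n i k j * band_weight n i l j)\<^sup>2)) sequentially"
  proof eventually_elim
    case (elim n)
    \<comment> \<open>The divisor serves two purposes: \<open>2 * D \<le> b i n\<close> keeps both
      legs inside the band, and \<open>4 * D \<le> n\<close>, which follows from
      \<open>b i n \<le> A * n\<close>, leaves at least half of the indices as centres.\<close>
    define D where "D = b i n div (4 * A)"
    let ?S = "SIGMA j:{1..n - 2 * D}. {j<..j + D} \<times> {j + D<..j + 2 * D}"
    have "4 * (A * D) \<le> b i n" unfolding D_def using div_times_less_eq_dividend[of "b i n" "4 * A"] by (simp add: mult_ac)
    moreover have "D \<le> A * D" using A(1) by simp
    moreover have "4 * D \<le> n"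
    proof -
      have "A * (4 * D) \<le> A * n" using order.trans[OF calculation(1) elim(1)] by (simp only: mult.left_commute)
      then show ?thesis using A(1) by simp
    qed
    ultimately have D: "2 * D \<le> b i n" "4 * D \<le> n" by linarith+
    have D_ge: "real (b i n) / (8 * real A) \<le> real D"
      using half_le_div[of "4 * A" "b i n"] elim(3) A(1) by (simp add: D_def)
    have sub: "?S \<subseteq> {1..n} \<times> {1..n} \<times> {1..n}" "\<forall>(j, k, l)\<in>?S. j < k \<and> k < l" by auto
    \<comment> \<open>The periodic distance never exceeds the ordinary one, so the same wedges serve
      every kind of band.\<close>
    have weight: "band_weight n i k j = band_factor n i" if "j < k" "k \<le> j + 2 * D" for j k
      using that D(1) by (auto simp: band_weight_def in_band_def periodic_dist_def min_le_iff_disj)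
    have "(\<Sum>(j, k, l)\<in>?S. (band_weight n i k j * band_weight n i l j)\<^sup>2)
        = (\<Sum>t\<in>?S. (band_factor n i)\<^sup>2 * (band_factor n i)\<^sup>2)"
      by (intro sum.cong refl) (auto simp: weight power_mult_distrib)
    also have "\<dots> = real (card ?S) * ((band_factor n i)\<^sup>2 * (band_factor n i)\<^sup>2)" by simp
    also have "card ?S = (n - 2 * D) * (D * D)" by (simp add: card_SigmaI)
    finally have total: "(\<Sum>(j, k, l)\<in>?S. (band_weight n i k j * band_weight n i l j)\<^sup>2)
        = real (n - 2 * D) * ((band_factor n i)\<^sup>2 * real D)\<^sup>2"
      by (simp add: power2_eq_square mult_ac)
    have "\<kappa> / (8 * real A) \<le> (band_factor n i)\<^sup>2 * (real (b i n) / (8 * real A))"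
      using elim(2) A(1) by (simp add: divide_right_mono)
    also have "\<dots> \<le> (band_factor n i)\<^sup>2 * real D" using D_ge by (intro mult_left_mono) auto
    finally have "(\<kappa> / (8 * real A))\<^sup>2 \<le> ((band_factor n i)\<^sup>2 * real D)\<^sup>2"
      using A(2) by (intro power_mono) auto
    then have "real n / 2 * (\<kappa> / (8 * real A))\<^sup>2 \<le> real (n - 2 * D) * ((band_factor n i)\<^sup>2 * real D)\<^sup>2"
      using D(2) by (intro mult_mono) (auto simp: of_nat_diff)
    \<comment> \<open>The constant 128 is twice the square of 8: the 2 comes from the number of
      centres, and each of the two legs contributes \<open>8 * A\<close> from comparing
      \<open>D\<close> with the band width.\<close>
    moreover have "\<kappa>\<^sup>2 / (128 * (real A)\<^sup>2) * real n = real n / 2 * (\<kappa> / (8 * real A))\<^sup>2"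
      by (simp add: power_divide power_mult_distrib)
    ultimately have "\<kappa>\<^sup>2 / (128 * (real A)\<^sup>2) * real n
        \<le> (\<Sum>(j, k, l)\<in>?S. (band_weight n i k j * band_weight n i l j)\<^sup>2)"
      unfolding total by (simp only:)
    with sub show ?case by blast
  qed
  then show ?thesis using that[of "\<kappa>\<^sup>2 / (128 * (real A)\<^sup>2)"] A(1,2) by simp
qed

end

section \<open>Test graphs of band matrices\<close>

lemma wigner_familyD:
  assumes "wigner_family M I \<beta> X"
  shows "prob_space (M n)"
    and "i \<in> I \<Longrightarrow> \<omega> \<in> space (M n) \<Longrightarrow> hermitian n (X n i \<omega>)"
    and "prob_space.indep_vars (M n) (\<lambda>_. borel) (\<lambda>(i, j, k) \<omega>. X n i \<omega> j k) (I \<times> upper_indices n)"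
    and "i \<in> I \<Longrightarrow> (j, k) \<in> upper_indices n \<Longrightarrow> j < k \<Longrightarrow> (\<integral>\<omega>. X n i \<omega> j k \<partial>M n) = 0"
    and "i \<in> I \<Longrightarrow> (j, k) \<in> upper_indices n \<Longrightarrow> j < k \<Longrightarrow> (\<integral>\<omega>. (cmod (X n i \<omega> j k))\<^sup>2 \<partial>M n) = 1"
    and "finite I0 \<Longrightarrow> I0 \<subseteq> I \<Longrightarrow> (SUP n. SUP i\<in>I0. SUP (j, k)\<in>upper_indices n.
           \<integral>\<^sup>+\<omega>. ennreal (cmod (X n i \<omega> j k) ^ l) \<partial>M n) < \<infinity>"
proof -
  note W = assms[unfolded wigner_family_def]
  note W2 = W[THEN conjunct2] and W3 = W[THEN conjunct2, THEN conjunct2]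
  note W4 = W3[THEN conjunct2]
  note W5 = W4[THEN conjunct2]
  show "prob_space (M n)" by (rule W[THEN conjunct1, rule_format])
  show "hermitian n (X n i \<omega>)" if "i \<in> I" "\<omega> \<in> space (M n)"
    by (rule W2[THEN conjunct1, rule_format, OF that])
  show "prob_space.indep_vars (M n) (\<lambda>_. borel) (\<lambda>(i, j, k) \<omega>. X n i \<omega> j k) (I \<times> upper_indices n)"
    by (rule W3[THEN conjunct1, rule_format])
  show "(SUP n. SUP i\<in>I0. SUP (j, k)\<in>upper_indices n.
      \<integral>\<^sup>+\<omega>. ennreal (cmod (X n i \<omega> j k) ^ l) \<partial>M n) < \<infinity>" if "finite I0" "I0 \<subseteq> I"
    by (rule W5[rule_format, OF conjI, OF that])
  show "(\<integral>\<omega>. X n i \<omega> j k \<partial>M n) = 0" "(\<integral>\<omega>. (cmod (X n i \<omega> j k))\<^sup>2 \<partial>M n) = 1"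
    if "i \<in> I" "(j, k) \<in> upper_indices n" "j < k"
    using W4[THEN conjunct1, THEN spec, THEN bspec, OF that(1), THEN bspec, OF that(2)] that(3)
    by simp_all
qed

text \<open>A single finite extended value serves twice: it gives integrability at each
  \<open>n\<close> and a bound on moments that is independent of \<open>n\<close>.\<close>

lemma wigner_family_nn_integral_bound:
  assumes W: "wigner_family M I \<beta> X" and I0: "finite I0" "I0 \<subseteq> I"
  obtains S where "S < (\<infinity> :: ennreal)"
    "\<forall>n. \<forall>i\<in>I0. \<forall>j k. (j, k) \<in> upper_indices n \<longrightarrow>
       (\<integral>\<^sup>+\<omega>. ennreal (cmod (X n i \<omega> j k) ^ l) \<partial>M n) \<le> S"
proof (rule that[OF wigner_familyD(6)[OF W I0]], intro allI ballI impI)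
  fix n i j k assume ijk: "i \<in> I0" "(j, k) \<in> upper_indices n"
  let ?f = "\<lambda>n i (j, k). \<integral>\<^sup>+\<omega>. ennreal (cmod (X n i \<omega> j k) ^ l) \<partial>M n"
  have "?f n i (j, k) \<le> (SUP q\<in>upper_indices n. ?f n i q)" using ijk(2) by (rule SUP_upper)
  also have "\<dots> \<le> (SUP i\<in>I0. SUP q\<in>upper_indices n. ?f n i q)" using ijk(1) by (rule SUP_upper)
  also have "\<dots> \<le> (SUP n. SUP i\<in>I0. SUP q\<in>upper_indices n. ?f n i q)" by (rule SUP_upper[OF UNIV_I])
  finally show "(\<integral>\<^sup>+\<omega>. ennreal (cmod (X n i \<omega> j k) ^ l) \<partial>M n)
      \<le> (SUP n. SUP i\<in>I0. SUP q\<in>upper_indices n. ?f n i q)" by simp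
qed

lemma wigner_family_measurable:
  assumes W: "wigner_family M I \<beta> X" and "i \<in> I" "(j, k) \<in> upper_indices n"
  shows "(\<lambda>\<omega>. X n i \<omega> j k) \<in> borel_measurable (M n)"
proof -
  interpret prob_space "M n" by (rule wigner_familyD(1)[OF W])
  have "\<forall>q\<in>I \<times> upper_indices n. (\<lambda>(i, j, k) \<omega>. X n i \<omega> j k) q \<in> borel_measurable (M n)"
    using wigner_familyD(3)[OF W, of n] unfolding indep_vars_def by (elim conjE)
  from bspec[OF this, of "(i, j, k)"] show ?thesis using assms(2,3) by simp
qed

lemma wigner_family_integrable:
  assumes W: "wigner_family M I \<beta> X" and ijk: "i \<in> I" "(j, k) \<in> upper_indices n"
  shows "integrable (M n) (\<lambda>\<omega>. cmod (X n i \<omega> j k) ^ l)"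
proof -
  note [measurable] = wigner_family_measurable[OF assms]
  have i: "finite {i}" "{i} \<subseteq> I" using ijk by auto
  obtain S where S: "S < (\<infinity> :: ennreal)" "\<forall>n. \<forall>i'\<in>{i}. \<forall>j k. (j, k) \<in> upper_indices n \<longrightarrow>
       (\<integral>\<^sup>+\<omega>. ennreal (cmod (X n i' \<omega> j k) ^ l) \<partial>M n) \<le> S"
    by (rule wigner_family_nn_integral_bound[OF W i, where l = l])
  show ?thesis
    using S(2)[rule_format, OF singletonI ijk(2)] S(1) by (intro integrableI_bounded) auto
qed

lemma wigner_family_moment_bound:
  assumes W: "wigner_family M I \<beta> X" and I0: "finite I0" "I0 \<subseteq> I"
  obtains B :: real where "0 \<le> B"
    "\<forall>n. \<forall>i\<in>I0. \<forall>j k. (j, k) \<in> upper_indices n \<longrightarrow>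
       (\<integral>\<omega>. cmod (X n i \<omega> j k) ^ l \<partial>M n) \<le> B"
proof -
  obtain S where S: "S < (\<infinity> :: ennreal)" "\<forall>n. \<forall>i\<in>I0. \<forall>j k. (j, k) \<in> upper_indices n \<longrightarrow>
       (\<integral>\<^sup>+\<omega>. ennreal (cmod (X n i \<omega> j k) ^ l) \<partial>M n) \<le> S"
    by (rule wigner_family_nn_integral_bound[OF W I0, where l = l])
  show ?thesis
  proof (rule that[of "enn2real S"], simp, intro allI ballI impI)
    fix n i j k assume ijk: "i \<in> I0" "(j, k) \<in> upper_indices n"
    have [measurable]: "(\<lambda>\<omega>. X n i \<omega> j k) \<in> borel_measurable (M n)"
      by (rule wigner_family_measurable[OF W subsetD[OF I0(2) ijk(1)] ijk(2)])
    have "(\<integral>\<omega>. cmod (X n i \<omega> j k) ^ l \<partial>M n)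
        = enn2real (\<integral>\<^sup>+\<omega>. ennreal (cmod (X n i \<omega> j k) ^ l) \<partial>M n)"
      by (rule integral_eq_nn_integral) auto
    also have "\<dots> \<le> enn2real S" using S(2)[rule_format, OF ijk] S(1) by (intro enn2real_mono) auto
    finally show "(\<integral>\<omega>. cmod (X n i \<omega> j k) ^ l \<partial>M n) \<le> enn2real S" .
  qed
qed

lemma wigner_family_imp_wigner_matrices:
  assumes W: "wigner_family M I \<beta> X"
  shows "wigner_matrices (M n) I n (X n)"
proof -
  interpret prob_space "M n" by (rule wigner_familyD(1)[OF W])
  show ?thesis
    by unfold_locales
      (fact wigner_familyD(2-5)[OF W] wigner_family_integrable[OF W])+
qed

lemma abs_central_moment_cmult:
  "abs_central_moment M p (\<lambda>\<omega>. a * Z \<omega>) = cmod a ^ p * abs_central_moment M p Z"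
  by (simp add: abs_central_moment_def right_diff_distrib[symmetric] norm_mult power_mult_distrib)

text \<open>Jensen's inequality for the squared distance to the mean, so that tightness of the
  variance carries over to all even moments.\<close>

lemma (in prob_space) abs_central_moment_power_ge:
  assumes "all_moments Z" "m \<ge> 1"
  shows "abs_central_moment M 2 Z ^ m \<le> abs_central_moment M (2 * m) Z"
proof -
  have am: "all_moments (\<lambda>\<omega>. Z \<omega> - expectation Z)"
    by (intro all_moments_diff assms all_moments_const)
  show ?thesis
    unfolding abs_central_moment_def power_mult
    using all_moments_power[OF am, of 2] all_moments_power[OF am, of "2 * m"] assms(2)
    by (intro expectation_power_ge) (auto simp: power_mult)
qed

section \<open>The test graph for tightness\<close>

definition wedge_graph :: "(nat, nat) pre_digraph" where
  "wedge_graph = \<lparr>verts = {0, 1, 2}, arcs = {0, 1}, tail = \<lambda>_. 0, head = Suc\<rparr>"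

lemma test_graph_wedge_graph:
  assumes "i \<in> I"
  shows "test_graph I wedge_graph (\<lambda>_. i)"
proof -
  interpret fin_digraph wedge_graph
    by unfold_locales (auto simp: wedge_graph_def)
  interpret S: pair_fin_digraph "mk_symmetric wedge_graph" by (rule pair_fin_digraph_mk_symmetric)
  have arcs: "(0, 1) \<in> parcs (mk_symmetric wedge_graph)" "(1, 0) \<in> parcs (mk_symmetric wedge_graph)"
    "(0, 2) \<in> parcs (mk_symmetric wedge_graph)" "(2, 0) \<in> parcs (mk_symmetric wedge_graph)"
    by (auto simp: parcs_mk_symmetric wedge_graph_def numeral_2_eq_2)
  have center: "0 \<rightarrow>\<^sup>*\<^bsub>mk_symmetric wedge_graph\<^esub> u" "u \<rightarrow>\<^sup>*\<^bsub>mk_symmetric wedge_graph\<^esub> 0"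
    if "u \<in> {0, 1, 2}" for u
  proof -
    have adj: "u \<rightarrow>\<^sup>*\<^bsub>mk_symmetric wedge_graph\<^esub> v" if "(u, v) \<in> parcs (mk_symmetric wedge_graph)" for u v
      using that by (intro S.reachable_adjI) simp
    have "0 \<rightarrow>\<^sup>*\<^bsub>mk_symmetric wedge_graph\<^esub> 0"
      by (rule S.reachable_refl) (simp add: wedge_graph_def)
    with adj[OF arcs(1)] adj[OF arcs(2)] adj[OF arcs(3)] adj[OF arcs(4)] that
    show "0 \<rightarrow>\<^sup>*\<^bsub>mk_symmetric wedge_graph\<^esub> u" "u \<rightarrow>\<^sup>*\<^bsub>mk_symmetric wedge_graph\<^esub> 0" by blast+
  qed
  have "Digraph_Component.connected wedge_graph"
    unfolding Digraph_Component.connected_def strongly_connected_def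
  proof (intro conjI ballI)
    fix u v assume "u \<in> verts (with_proj (mk_symmetric wedge_graph))" "v \<in> verts (with_proj (mk_symmetric wedge_graph))"
    then have "u \<in> {0, 1, 2}" "v \<in> {0, 1, 2}" by (auto simp: wedge_graph_def)
    then show "u \<rightarrow>\<^sup>*\<^bsub>mk_symmetric wedge_graph\<^esub> v"
      by (rule S.reachable_trans[OF center(2) center(1)])
  qed (simp add: wedge_graph_def)
  then show ?thesis using assms fin_digraph_axioms by (auto simp: test_graph_def)
qed

text \<open>The trace is the sum over the columns of the squared column sums. It is written over
  triples with the centre first to agree with \<open>wedge_sum\<close>.\<close>

lemma graph_trace_wedge_graph:
  "graph_trace wedge_graph (\<lambda>_. i) n A = (\<Sum>(j, k, l)\<in>{1..n} \<times> {1..n} \<times> {1..n}. A i k j * A i l j)"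
proof -
  have "graph_trace wedge_graph (\<lambda>_. i) n A
      = (\<Sum>\<phi>\<in>insert (0::nat) (insert 1 (insert 2 {})) \<rightarrow>\<^sub>E {1..n}. A i (\<phi> 1) (\<phi> 0) * A i (\<phi> 2) (\<phi> 0))"
    by (simp add: graph_trace_def wedge_graph_def numeral_2_eq_2)
  also have "\<dots> = (\<Sum>l\<in>{1..n}. \<Sum>k\<in>{1..n}. \<Sum>j\<in>{1..n}. A i k j * A i l j)"
    by (subst sum_PiE_insert, simp, subst sum_PiE_insert, simp, subst sum_PiE_insert, simp) simp
  also have "\<dots> = (\<Sum>l\<in>{1..n}. \<Sum>j\<in>{1..n}. \<Sum>k\<in>{1..n}. A i k j * A i l j)"
    by (intro sum.cong refl sum.swap)
  also have "\<dots> = (\<Sum>j\<in>{1..n}. \<Sum>l\<in>{1..n}. \<Sum>k\<in>{1..n}. A i k j * A i l j)"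
    by (rule sum.swap)
  also have "\<dots> = (\<Sum>j\<in>{1..n}. \<Sum>k\<in>{1..n}. \<Sum>l\<in>{1..n}. A i k j * A i l j)"
    by (intro sum.cong refl sum.swap)
  finally show ?thesis by (simp add: sum.cartesian_product)
qed

section \<open>Upper and lower bounds for band matrices\<close>

locale mixed_band_matrices = mixed_band_widths I1 I2 I3 I4 c b
  for I1 I2 I3 I4 :: "'i set" and c b +
  fixes M :: "nat \<Rightarrow> 'w measure" and X :: "nat \<Rightarrow> 'i \<Rightarrow> 'w \<Rightarrow> cmatrix" and \<beta> :: "'i \<Rightarrow> complex"
    and m :: nat
  assumes wigner: "wigner_family M (I1 \<union> I2 \<union> I3 \<union> I4) \<beta> X" and m_pos: "1 \<le> m"
begin

abbreviation "labels \<equiv> I1 \<union> I2 \<union> I3 \<union> I4"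
abbreviation "Q \<equiv> mixed_band_family I1 I2 I3 c b X"

lemma graph_trace_Q:
  assumes "test_graph labels G \<gamma>"
  shows "graph_trace G \<gamma> n (\<lambda>i. Q n i \<omega>)
    = graph_trace G \<gamma> n (\<lambda>i j k. complex_of_real (band_weight n i j k) * X n i \<omega> j k)"
  unfolding graph_trace_def using assms
  by (intro sum.cong prod.cong refl mixed_band_family_eq) (auto simp: test_graph_def)

lemma trace_moment_bigo:
  fixes G :: "('v, 'e) pre_digraph"
  assumes T: "test_graph labels G \<gamma>"
  shows "trace_moment M Q G \<gamma> (2 * m) \<in> O(\<lambda>n. 1 / real n ^ m)"
proof -
  interpret fin_digraph G using T by (simp add: test_graph_def)
  have lab: "\<gamma> \<in> arcs G \<rightarrow> labels" using T by (simp add: test_graph_def)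
  interpret copied_graph G \<gamma> "2 * m" using T by unfold_locales (simp add: test_graph_def)
  have fin: "finite (\<gamma> ` arcs G)" "\<gamma> ` arcs G \<subseteq> labels" using lab finite_arcs by auto
  obtain B1 where B1: "0 \<le> B1" "\<forall>n. \<forall>i\<in>\<gamma> ` arcs G. \<forall>j k. (j, k) \<in> upper_indices n \<longrightarrow>
       (\<integral>\<omega>. cmod (X n i \<omega> j k) ^ (2 * m * card (arcs G)) \<partial>M n) \<le> B1"
    by (rule wigner_family_moment_bound[OF wigner fin, where l = "2 * m * card (arcs G)"])
  obtain B2 where B2: "0 \<le> B2" "\<forall>n. \<forall>i\<in>\<gamma> ` arcs G. \<forall>j k. (j, k) \<in> upper_indices n \<longrightarrow>
       (\<integral>\<omega>. cmod (X n i \<omega> j k) ^ card (arcs G) \<partial>M n) \<le> B2"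
    by (rule wigner_family_moment_bound[OF wigner fin, where l = "card (arcs G)"])
  have "\<forall>i\<in>\<gamma> ` arcs G. \<exists>C\<ge>0. eventually (\<lambda>n. \<forall>j\<in>{1..n}. (\<Sum>k\<in>{1..n}. (band_weight n i j k)\<^sup>2) \<le> C) sequentially"
    using eventually_band_weight_sum_le fin(2) by blast
  from bchoice[OF this] obtain C where C0: "\<forall>i\<in>\<gamma> ` arcs G. 0 \<le> C i \<and>
      eventually (\<lambda>n. \<forall>j\<in>{1..n}. (\<Sum>k\<in>{1..n}. (band_weight n i j k)\<^sup>2) \<le> C i) sequentially" ..
  note C = bspec[OF C0, THEN conjunct1] bspec[OF C0, THEN conjunct2]
  \<comment> \<open>Sums serve as common bounds for the two moment orders and for all labels of the
    graph, since every summand is nonnegative.\<close>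
  let ?B = "B1 + B2" and ?C = "\<Sum>i\<in>\<gamma> ` arcs G. C i"
  let ?D = "1 + card (arcs G) * ?B"
  let ?K = "(1 + 2 * m * (2 ^ (2 * m) * (?D + ?D ^ (2 * m)))) *
       (card gluings * ((2 * m) * card (verts G) + ?C + 1) ^ (2 * m * card (verts G)))"
  \<comment> \<open>For small \<open>n\<close> the weights of proportional bands may exceed 1, so
    the estimate is made for large \<open>n\<close> only. Finitely many labels occur, which allows
    one threshold for all of them.\<close>
  have "eventually (\<lambda>n. (\<forall>i\<in>\<gamma> ` arcs G. band_factor n i \<le> 1) \<and>
      (\<forall>i\<in>\<gamma> ` arcs G. \<forall>j\<in>{1..n}. (\<Sum>k\<in>{1..n}. (band_weight n i j k)\<^sup>2) \<le> C i) \<and> 0 < n) sequentially"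
    using C(2) fin eventually_band_factor_le_1
    by (intro eventually_conj eventually_ball_finite eventually_gt_at_top) auto
  then have "eventually (\<lambda>n. trace_moment M Q G \<gamma> (2 * m) n \<le> ?K * (1 / real n ^ m)) sequentially"
  proof eventually_elim
    case (elim n)
    interpret wigner_matrices "M n" labels n "X n"
      by (rule wigner_family_imp_wigner_matrices[OF wigner])
    interpret weighted_trace "M n" labels n "X n" G \<gamma> m "band_weight n"
      using elim lab band_weight_nonneg band_weight_sym order.trans[OF band_weight_le]
      by unfold_locales auto
    have "trace_moment M Q G \<gamma> (2 * m) n = abs_central_moment (M n) (2 * m) normalized_trace"
      unfolding trace_moment_def normalized_trace_def graph_trace_Q[OF T] ..
    also have "\<dots> \<le> ?K * (1 / real n ^ m)"
    proof (rule trace_moment_le)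
      show "0 \<le> ?B" using B1 B2 by simp
      show "0 \<le> ?C" using C(1) by (intro sum_nonneg) auto
      show "expectation (\<lambda>\<omega>. cmod (X n i \<omega> j k) ^ (2 * m * card (arcs G))) \<le> ?B"
        if "i \<in> \<gamma> ` arcs G" "(j, k) \<in> upper_indices n" for i j k
        using B1(2)[rule_format, OF that] B2(1) by linarith
      show "expectation (\<lambda>\<omega>. cmod (X n i \<omega> j k) ^ card (arcs G)) \<le> ?B"
        if "i \<in> \<gamma> ` arcs G" "(j, k) \<in> upper_indices n" for i j k
        using B2(2)[rule_format, OF that] B1(1) by linarith
      fix e a assume e: "e \<in> arcs G" "a \<in> {1..n}"
      have "(\<Sum>k\<in>{1..n}. (band_weight n (\<gamma> e) a k)\<^sup>2) \<le> C (\<gamma> e)" using elim e by blast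
      also have "\<dots> \<le> ?C" using e C(1) fin by (intro member_le_sum) auto
      finally show "(\<Sum>k\<in>{1..n}. (band_weight n (\<gamma> e) a k)\<^sup>2) \<le> ?C" .
    qed
    finally show ?case .
  qed
  moreover have "0 \<le> trace_moment M Q G \<gamma> (2 * m) n" for n
    by (simp add: trace_moment_def abs_central_moment_def)
  ultimately have "eventually (\<lambda>n. norm (trace_moment M Q G \<gamma> (2 * m) n) \<le> ?K * norm (1 / real n ^ m)) sequentially"
    by (simp add: eventually_mono)
  then show ?thesis by (rule bigoI)
qed

text \<open>The variance of the unnormalized trace is at least \<open>4 * \<epsilon> * n\<close>.
  Dividing the trace by \<open>n\<close> turns this into order \<open>1 / n\<close>, and Jensen's
  inequality raises it to the power \<open>m\<close>.\<close>

lemma wedge_trace_moment_bigomega: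
  assumes i: "i \<in> labels" and lin: "i \<in> I1 \<longrightarrow> (\<lambda>n. real (b i n)) \<in> O(\<lambda>n. real n)"
  shows "trace_moment M Q wedge_graph (\<lambda>_. i) (2 * m) \<in> \<Omega>(\<lambda>n. 1 / real n ^ m)"
proof -
  obtain \<epsilon> where \<epsilon>: "0 < \<epsilon>" and ev: "eventually (\<lambda>n. \<exists>S \<subseteq> {1..n} \<times> {1..n} \<times> {1..n}.
      (\<forall>(j, k, l)\<in>S. j < k \<and> k < l) \<and>
      \<epsilon> * real n \<le> (\<Sum>(j, k, l)\<in>S. (band_weight n i k j * band_weight n i l j)\<^sup>2)) sequentially"
    by (rule eventually_wedge_weight_ge[OF i lin])
  have "eventually (\<lambda>n. (4 * \<epsilon>) ^ m * (1 / real n ^ m)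
      \<le> trace_moment M Q wedge_graph (\<lambda>_. i) (2 * m) n) sequentially"
    using ev eventually_gt_at_top[of 0]
  proof eventually_elim
    case (elim n)
    interpret wigner_matrices "M n" labels n "X n"
      by (rule wigner_family_imp_wigner_matrices[OF wigner])
    obtain S where S: "S \<subseteq> {1..n} \<times> {1..n} \<times> {1..n}" "\<forall>(j, k, l)\<in>S. j < k \<and> k < l"
      "\<epsilon> * real n \<le> (\<Sum>(j, k, l)\<in>S. (band_weight n i k j * band_weight n i l j)\<^sup>2)"
      using elim(1) by (elim exE conjE)
    have lt: "j < k \<and> k < l" if "(j, k, l) \<in> S" for j k l
      using bspec[OF S(2) that] by simp
    define Z where "Z = wedge_sum (band_weight n i) i ({1..n} \<times> {1..n} \<times> {1..n})"
    have am: "all_moments Z" unfolding Z_def using i by (rule all_moments_wedge_sum) simp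
    have Z_eq: "graph_trace wedge_graph (\<lambda>_. i) n (\<lambda>i. Q n i \<omega>) = Z \<omega>" for \<omega>
      unfolding graph_trace_wedge_graph Z_def wedge_sum_def wedge_def
      by (simp add: mixed_band_family_eq[OF i] case_prod_beta mult_ac)
    have "4 * (\<epsilon> * real n) \<le> abs_central_moment (M n) 2 Z"
      using wedge_sum_variance_ge[OF i S(1) lt, of "band_weight n i"] S(3) unfolding Z_def by linarith
    then have "(4 * (\<epsilon> * real n)) ^ m \<le> abs_central_moment (M n) 2 Z ^ m"
      using \<epsilon> by (intro power_mono) auto
    also have "\<dots> \<le> abs_central_moment (M n) (2 * m) Z"
      by (rule abs_central_moment_power_ge[OF am m_pos])
    finally have "(1 / real n) ^ (2 * m) * (4 * (\<epsilon> * real n)) ^ m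
        \<le> (1 / real n) ^ (2 * m) * abs_central_moment (M n) (2 * m) Z"
      by (intro mult_left_mono) auto
    also have "(1 / real n) ^ (2 * m) * (4 * (\<epsilon> * real n)) ^ m = (4 * \<epsilon>) ^ m * (1 / real n ^ m)"
      using elim(2) by (simp add: power_mult_distrib power_divide mult_2 power_add)
    also have "(1 / real n) ^ (2 * m) * abs_central_moment (M n) (2 * m) Z
        = trace_moment M Q wedge_graph (\<lambda>_. i) (2 * m) n"
      unfolding trace_moment_def Z_eq abs_central_moment_cmult by (simp add: norm_divide)
    finally show ?case .
  qed
  then have "eventually (\<lambda>n. (4 * \<epsilon>) ^ m * norm (1 / real n ^ m)
      \<le> norm (trace_moment M Q wedge_graph (\<lambda>_. i) (2 * m) n)) sequentially"
    by eventually_elim simp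
  then show ?thesis using \<epsilon> by (intro landau_omega.bigI[of "(4 * \<epsilon>) ^ m"]) auto
qed

end

text \<open>Tightness is claimed when some label is not periodic or has a width of order at most
  \<open>n\<close>. Without labels there are only graphs without edges, whose traces do not
  fluctuate. A periodic matrix with \<open>b / n\<close> tending to infinity is eventually a
  normalized full Wigner matrix times the square root of \<open>n / (2 * b)\<close>, so if all
  labels were of this kind, every edge would contribute a vanishing factor and the moments would be
  of smaller order.\<close>

theorem theorem4p3p8:
  fixes M :: "nat \<Rightarrow> 'w measure"
    and X :: "nat \<Rightarrow> 'i \<Rightarrow> 'w \<Rightarrow> cmatrix"
    and \<beta> :: "'i \<Rightarrow> complex"
    and b :: "'i \<Rightarrow> nat \<Rightarrow> nat"
    and c :: "'i \<Rightarrow> real"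
    and I I1 I2 I3 I4 :: "'i set"
    and Q :: "nat \<Rightarrow> 'i \<Rightarrow> 'w \<Rightarrow> cmatrix"
    and m :: nat
  assumes "I = I1 \<union> I2 \<union> I3 \<union> I4"
    and "I1 \<inter> I2 = {}" and "(I1 \<union> I2) \<inter> I3 = {}" and "(I1 \<union> I2 \<union> I3) \<inter> I4 = {}"
    and "wigner_family M I \<beta> X"
    and "\<And>i. i \<in> I1 \<Longrightarrow> filterlim (b i) at_top at_top"
    and "\<And>i. i \<in> I2 \<Longrightarrow> slow_growth (b i)"
    and "\<And>i. i \<in> I3 \<Longrightarrow> proportional_growth (b i) 1"
    and "\<And>i. i \<in> I4 \<Longrightarrow> c i < 1 \<and> proportional_growth (b i) (c i)"
    and "Q = mixed_band_family I1 I2 I3 c b X"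
    and "m \<ge> 1"
  shows "(\<forall>(G :: ('v, 'e) pre_digraph) (\<gamma> :: 'e \<Rightarrow> 'i). test_graph I G \<gamma> \<longrightarrow>
            trace_moment M Q G \<gamma> (2 * m) \<in> O(\<lambda>n. 1 / real n ^ m)) \<and>
         ((\<exists>i\<in>I. i \<in> I1 \<longrightarrow> (\<lambda>n. real (b i n)) \<in> O(\<lambda>n. real n)) \<longrightarrow>
          (\<exists>(G :: (nat, nat) pre_digraph) (\<gamma> :: nat \<Rightarrow> 'i). test_graph I G \<gamma> \<and>
            trace_moment M Q G \<gamma> (2 * m) \<in> \<Theta>(\<lambda>n. 1 / real n ^ m)))"
proof -
  interpret mixed_band_matrices I1 I2 I3 I4 c b M X \<beta> m
    using assms by unfold_locales auto
  show ?thesis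
  proof (intro conjI allI impI)
    fix G :: "('v, 'e) pre_digraph" and \<gamma> :: "'e \<Rightarrow> 'i"
    assume "test_graph I G \<gamma>"
    then show "trace_moment M Q G \<gamma> (2 * m) \<in> O(\<lambda>n. 1 / real n ^ m)"
      unfolding assms(1,10) by (rule trace_moment_bigo)
  next
    assume "\<exists>i\<in>I. i \<in> I1 \<longrightarrow> (\<lambda>n. real (b i n)) \<in> O(\<lambda>n. real n)"
    then obtain i where i: "i \<in> I" "i \<in> I1 \<longrightarrow> (\<lambda>n. real (b i n)) \<in> O(\<lambda>n. real n)" by blast
    have T: "test_graph I wedge_graph (\<lambda>_. i)" by (rule test_graph_wedge_graph[OF i(1)])
    moreover have "trace_moment M Q wedge_graph (\<lambda>_. i) (2 * m) \<in> \<Theta>(\<lambda>n. 1 / real n ^ m)"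
      using trace_moment_bigo[OF T[unfolded assms(1)]] wedge_trace_moment_bigomega i
      unfolding assms(1,10) by (intro bigthetaI) auto
    ultimately show "\<exists>(G :: (nat, nat) pre_digraph) (\<gamma> :: nat \<Rightarrow> 'i). test_graph I G \<gamma> \<and>
            trace_moment M Q G \<gamma> (2 * m) \<in> \<Theta>(\<lambda>n. 1 / real n ^ m)" by blast
  qed
qed

end
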